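(* Let $n\ge1$ be an integer, $s\in\mathbb{C}\setminus\{0\}$, $\tau_0:=|s|^2$, and let $Z=(T^*\mathbb{CP}^n)_\lambda$ be the twisted cotangent bundle with parameter $s$, with complex structure $I$ and function $\tau\in C^\infty(Z)$ as defined in the context. For a constant $a\ge0$ let $$f(\tau)=\left(\frac{\big(a+(\tau-\tau_0)^n\big)^{1/n}}{\tau(\tau-\tau_0)}\right)^{1/2}$$ (for $a=0$ this is read as $f(\tau)=\tau^{-1/2}$), and let $\omega_I=\mathrm{d}\big(\tfrac{\sqrt{-1}}{4}f(\tau)(\overline{\partial}\tau-\partial\tau)\big)$ and $g(v,w)=\omega_I(v,Iw)$. Then $g$ provides a hyperk\"ahler metric on $Z$ (that is, $g$ is a smooth Riemannian metric on all of $Z$ and $(g,I,J,K)$ is a hyperk\"ahler structure on $Z$, where $J,K$ are the endomorphisms of $TZ$ determined by $\omega_I$ and the holomorphic symplectic form as in the context) if and only if $a=0$, i.e. if and only if $f(\tau)=\tau^{-1/2}$.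
   Context: Indices of $\mathbb{C}^{n+1}$ run over $0,1,\dots,n$, and $e_n={}^t(0,\dots,0,1)$. Put $G^c=\mathrm{SL}_{n+1}(\mathbb{C})$, and let $Q\subset G^c$ be the subgroup of block lower triangular matrices $\left[\begin{smallmatrix} a&0\\ c&d\end{smallmatrix}\right]$ ($a\in \mathrm{GL}_n(\mathbb{C})$, $c$ a row vector, $d\in\mathbb{C}^\times$), and $L\subset Q$ the subgroup of block diagonal ones ($c=0$). $G^c/Q\cong\mathbb{CP}^n$ by $gQ\mapsto[g e_n]$. For a column vector $z\in\mathbb{C}^n$ and a row vector $w\in(\mathbb{C}^n)^*$ put $u_z=\left[\begin{smallmatrix}1_n&z\\0&1\end{smallmatrix}\right]$ and $u^-_w=\left[\begin{smallmatrix}1_n&0\\ w&1\end{smallmatrix}\right]$. For $\alpha=0,\dots,n$, let $\sigma_\alpha\in \mathrm{SU}(n+1)$ be a fixed signed permutation matrix of determinant one corresponding to the cyclic permutation $(\alpha,\alpha+1,\dots,n)$ (so $\sigma_\alpha e_n=\pm e_\alpha$), let $U_\alpha=\{[\zeta_0:\dots:\zeta_n]:\zeta_\alpha\ne0\}$, and let $\varphi_\alpha:U_\alpha\to\mathbb{C}^n$ be the holomorphic chart sending $[\sigma_\alpha u_{z}e_n]$ to $z=z_\alpha$. Let $\lambda$ be the linear functional on $\mathfrak{sl}_{n+1}(\mathbb{C})$ given by $\langle\lambda,X\rangle=\operatorname{tr}(\lambda^\vee X)$ with $\lambda^\vee=\frac{s}{n+1}\left[\begin{smallmatrix}1_n&0\\0&-n\end{smallmatrix}\right]$;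 thus $\langle\lambda,\left[\begin{smallmatrix}a&0\\ c&d\end{smallmatrix}\right]\rangle=-sd$. Twisted cotangent bundle: $Z=(T^*\mathbb{CP}^n)_\lambda:=\bigsqcup_{\alpha=0}^n T^*U_\alpha/\sim$, where a point of the holomorphic cotangent bundle $T^*U_\alpha$ is written $\xi_\alpha\,\mathrm{d}z_\alpha=\sum_i\xi_{\alpha,i}\,\mathrm{d}z_{\alpha,i}$ ($z_\alpha$ a column vector, $\xi_\alpha$ a row vector), and over $U_\alpha\cap U_\beta$ the point $\xi_\beta\,\mathrm{d}z_\beta$ is equivalent to $\xi_\alpha\,\mathrm{d}z_\alpha$ iff $z_\beta=(\varphi_\beta\circ\varphi_\alpha^{-1})(z_\alpha)$ and $\xi_\beta\,\mathrm{d}z_\beta=\xi_\alpha\,\mathrm{d}z_\alpha-\langle\lambda,\mathrm{d}t_{\alpha\beta}\,t_{\alpha\beta}^{-1}\rangle$. Here $t_{\alpha\beta}\in L$ is the unique element with $\sigma_\beta u_{z_\beta}u^-_{w_\beta}=\sigma_\alpha u_{z_\alpha}u^-_{w_\alpha}t_{\alpha\beta}$, where $\xi_\alpha=-sw_\alpha$, $\xi_\beta=-sw_\beta$. The projection is $\pi_\lambda:Z\to\mathbb{CP}^n$, so $\pi_\lambda^{-1}(U_\alpha)=T^*U_\alpha$ has holomorphic coordinates $(z,\xi)=(z_1,\dots,z_n,\xi_1,\dots,\xi_n)\in\mathbb{C}^{2n}$ (index $\alpha$ suppressed). $Z$ is a complex manifold of complex dimension $2n$, with complex structure $I$. The map $\mu_+:Z\to\mathfrak{sl}_{n+1}(\mathbb{C})$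 is given on $\pi_\lambda^{-1}(U_\alpha)$ by $\mu_+(z,\xi)=h\lambda^\vee h^{-1}$ with $h=\sigma_\alpha u_zu^-_w$, $\xi=-sw$ (it is well defined on $Z$). The function $\tau:=\operatorname{tr}(\mu_+\mu_+^* )+\frac{|s|^2}{n+1}$ on $Z$ (with $*$ the conjugate transpose) is given on every $\pi_\lambda^{-1}(U_\alpha)$ by $\tau=(\|z\|^2+1)(\|\xi\|^2+|s-\xi z|^2)$, where $\|z\|^2=z^*z$, $\|\xi\|^2=\xi\xi^*$. It takes values in $[\tau_0,\infty)$, with minimum $\tau_0$ attained on a nonempty closed submanifold; for $a>0$ the expression for $f$ is defined and smooth only for $\tau>\tau_0$, so $g$ is then a priori given by the formula only where $\tau>\tau_0$. Symplectic forms: $Z$ carries the holomorphic symplectic form $\omega_+$ given on each $\pi_\lambda^{-1}(U_\alpha)$ by $\omega_+=\sum_{i=1}^n\mathrm{d}z_i\wedge\mathrm{d}\xi_i$. Write $\omega_+=\omega_J+\sqrt{-1}\,\omega_K$ with $\omega_J,\omega_K$ real. For a non-degenerate bilinear form $\omega$ on $T_pZ$ let $\omega^\flat:T_pZ\to T_p^*Z$, $\omega^\flat(v)=\omega(v,\cdot)$. Define $J=(\omega_I^\flat)^{-1}\circ\omega_K^\flat$ and $K=(\omega_J^\flat)^{-1}\circ\omega_I^\flat$. Hyperk\"ahler structure: a Riemannian metric $g$ and almost complex structures $I,J,K$ such that $g(Iv,Iw)=g(Jv,Jw)=g(Kv,Kw)=g(v,w)$ for all vector fields $v,w$, $I^2=J^2=K^2=IJK=-1$,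 and $\nabla I=\nabla J=\nabla K=0$, where $\nabla$ is the Levi-Civita connection of $g$. *)

theory Defs
  imports "HOL-Analysis.Analysis"
begin

text \<open>
  The dimension is \<open>n = CARD('n)\<close>.  The indices \<open>0, ..., n\<close> of \<open>\<complex>\<^sup>n\<^sup>+\<^sup>1\<close> are the elements of
  \<open>'n option\<close>: \<open>Some\<close> of the elements of \<open>'n\<close>, in increasing order, are \<open>0, ..., n - 1\<close>, and
  \<open>None\<close> is the last index \<open>n\<close>.  (This is not the order on options from the library, in
  which \<open>None\<close> comes first; that order is not used here.)
\<close>

type_synonym 'n cvec = "complex^('n option)"
type_synonym 'n cmat = "complex^('n option)^('n option)"

type_synonym 'n coords = "(complex^'n) \<times> (complex^'n)"

text \<open>An element \<open>(z, \<xi>)\<close> of \<open>'n coords\<close> consists of a column vector \<open>z\<close> and a row vector \<open>\<xi>\<close>; it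
  serves both as a coordinate vector of a point of \<open>Z\<close> and as a coordinate vector of a tangent
  vector of \<open>Z\<close>, regarded as a real vector space of dimension \<open>4n\<close>.\<close>


section \<open>Matrices\<close>

definition block :: "complex^'n^'n \<Rightarrow> complex^'n \<Rightarrow> complex^'n \<Rightarrow> complex \<Rightarrow> ('n::finite) cmat" where
  "block A z c d =
     (\<chi> i j. case i of
        Some k \<Rightarrow> (case j of Some l \<Rightarrow> A $ k $ l | None \<Rightarrow> z $ k)
      | None \<Rightarrow> (case j of Some l \<Rightarrow> c $ l | None \<Rightarrow> d))"

definition u_plus :: "complex^'n \<Rightarrow> ('n::finite) cmat" where
  "u_plus z = block (mat 1) z 0 1"

definition u_minus :: "complex^'n \<Rightarrow> ('n::finite) cmat" where
  "u_minus w = block (mat 1) 0 w 1"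

definition L_group :: "('n::finite) cmat set" where
  "L_group = {block A 0 0 d | A d. invertible A \<and> d \<noteq> 0 \<and> det (block A 0 0 d) = 1}"

definition e_last :: "('n::finite) cvec" where
  "e_last = axis None 1"

definition adj :: "complex^'m^'m \<Rightarrow> complex^'m^'m" where
  "adj A = (\<chi> i j. cnj (A $ j $ i))"

definition next_index :: "('n::{finite,linorder}) \<Rightarrow> 'n option" where
  "next_index j = (if \<exists>k. j < k then Some (Min {k. j < k}) else None)"

text \<open>The cyclic permutation \<open>(\<alpha>, \<alpha> + 1, ..., n)\<close>, which sends \<open>n\<close> to \<open>\<alpha>\<close>.\<close>

fun cyc :: "('n::{finite,linorder}) option \<Rightarrow> 'n option \<Rightarrow> 'n option" where
  "cyc \<alpha> None = \<alpha>"
| "cyc None (Some j) = Some j"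
| "cyc (Some a) (Some j) = (if a \<le> j then next_index j else Some j)"

text \<open>Such a matrix is automatically unitary, hence in \<open>SU(n+1)\<close>.\<close>

definition signed_perm_matrix :: "('n option \<Rightarrow> 'n option) \<Rightarrow> ('n::finite) cmat \<Rightarrow> bool" where
  "signed_perm_matrix p M \<longleftrightarrow>
     (\<exists>\<epsilon>. (\<forall>j. \<epsilon> j \<in> {1, -1}) \<and> M = (\<chi> i j. if i = p j then \<epsilon> j else 0))"

definition sigma_family :: "('n option \<Rightarrow> ('n::{finite,linorder}) cmat) \<Rightarrow> bool" where
  "sigma_family \<sigma> \<longleftrightarrow> (\<forall>\<alpha>. signed_perm_matrix (cyc \<alpha>) (\<sigma> \<alpha>) \<and> det (\<sigma> \<alpha>) = 1)"

definition lambda_vee :: "complex \<Rightarrow> ('n::finite) cmat" where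
  "lambda_vee s =
     block (mat (s / of_nat (CARD('n) + 1))) 0 0 (- of_nat CARD('n) * s / of_nat (CARD('n) + 1))"

definition lambda_pairing :: "complex \<Rightarrow> ('n::finite) cmat \<Rightarrow> complex" where
  "lambda_pairing s X = trace (lambda_vee s ** X)"


section \<open>Projective space and its charts\<close>

definition proj_point :: "('n::finite) cvec \<Rightarrow> 'n cvec set" where
  "proj_point \<zeta> = {c *s \<zeta> | c. c \<noteq> 0}"

definition U_chart :: "'n option \<Rightarrow> ('n::finite) cvec set set" where
  "U_chart \<alpha> = {proj_point \<zeta> | \<zeta>. \<zeta> $ \<alpha> \<noteq> 0}"

definition phi_inv :: "('n option \<Rightarrow> ('n::finite) cmat) \<Rightarrow> 'n option \<Rightarrow> complex^'n \<Rightarrow> 'n cvec set" where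
  "phi_inv \<sigma> \<alpha> z = proj_point (\<sigma> \<alpha> *v (u_plus z *v e_last))"

definition phi :: "('n option \<Rightarrow> ('n::finite) cmat) \<Rightarrow> 'n option \<Rightarrow> 'n cvec set \<Rightarrow> complex^'n" where
  "phi \<sigma> \<alpha> p = (THE z. p = phi_inv \<sigma> \<alpha> z)"


section \<open>The twisted cotangent bundle\<close>

definition h_mat :: "complex \<Rightarrow> ('n option \<Rightarrow> ('n::finite) cmat) \<Rightarrow> 'n option \<Rightarrow> 'n coords \<Rightarrow> 'n cmat" where
  "h_mat s \<sigma> \<alpha> = (\<lambda>(z, \<xi>). \<sigma> \<alpha> ** u_plus z ** u_minus (- (1 / s) *s \<xi>))"

text \<open>\<open>t\<^sub>\<alpha>\<^sub>\<beta>\<close> as a function of the point \<open>(z\<^sub>\<alpha>, \<xi>\<^sub>\<alpha>)\<close> of \<open>T\<^sup>*U\<^sub>\<alpha>\<close>.  The pair \<open>(z\<^sub>\<beta>, \<xi>\<^sub>\<beta>)\<close> on the other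
  side is determined along with it, because \<open>(z, w, t) \<mapsto> u\<^sub>z u\<^sup>-\<^sub>w t\<close> is injective on
  \<open>\<complex>\<^sup>n \<times> (\<complex>\<^sup>n)\<^sup>* \<times> L\<close>.\<close>

definition t_mat ::
    "complex \<Rightarrow> ('n option \<Rightarrow> ('n::finite) cmat) \<Rightarrow> 'n option \<Rightarrow> 'n option \<Rightarrow> 'n coords \<Rightarrow> 'n cmat" where
  "t_mat s \<sigma> \<alpha> \<beta> x = (THE t. t \<in> L_group \<and> (\<exists>y. h_mat s \<sigma> \<beta> y = h_mat s \<sigma> \<alpha> x ** t))"

definition covector :: "complex^'n \<Rightarrow> complex^'n \<Rightarrow> complex" where
  "covector \<xi> v = (\<Sum>i\<in>UNIV. \<xi> $ i * v $ i)"

text \<open>The equality \<open>\<xi>\<^sub>\<beta> dz\<^sub>\<beta> = \<xi>\<^sub>\<alpha> dz\<^sub>\<alpha> - \<langle>\<lambda>, dt\<^sub>\<alpha>\<^sub>\<beta> t\<^sub>\<alpha>\<^sub>\<beta>\<^sup>-\<^sup>1\<rangle>\<close> of 1-forms is evaluated on an arbitrary tangent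
  vector \<open>(v, v')\<close>, written in the coordinates \<open>(z\<^sub>\<alpha>, \<xi>\<^sub>\<alpha>)\<close>.\<close>

definition glue_rel ::
    "complex \<Rightarrow> ('n option \<Rightarrow> ('n::finite) cmat) \<Rightarrow> (('n option \<times> 'n coords) \<times> ('n option \<times> 'n coords)) set" where
  "glue_rel s \<sigma> = {((\<alpha>, (z\<^sub>\<alpha>, \<xi>\<^sub>\<alpha>)), (\<beta>, (z\<^sub>\<beta>, \<xi>\<^sub>\<beta>))) | \<alpha> z\<^sub>\<alpha> \<xi>\<^sub>\<alpha> \<beta> z\<^sub>\<beta> \<xi>\<^sub>\<beta>.
     phi_inv \<sigma> \<alpha> z\<^sub>\<alpha> \<in> U_chart \<alpha> \<inter> U_chart \<beta> \<and>
     z\<^sub>\<beta> = (phi \<sigma> \<beta> \<circ> phi_inv \<sigma> \<alpha>) z\<^sub>\<alpha> \<and>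
     (\<forall>v v'.
        covector \<xi>\<^sub>\<beta> (frechet_derivative (phi \<sigma> \<beta> \<circ> phi_inv \<sigma> \<alpha>) (at z\<^sub>\<alpha>) v) =
        covector \<xi>\<^sub>\<alpha> v -
        lambda_pairing s
          (frechet_derivative (t_mat s \<sigma> \<alpha> \<beta>) (at (z\<^sub>\<alpha>, \<xi>\<^sub>\<alpha>)) (v, v') **
           matrix_inv (t_mat s \<sigma> \<alpha> \<beta> (z\<^sub>\<alpha>, \<xi>\<^sub>\<alpha>))))}"

definition Z_space :: "complex \<Rightarrow> ('n option \<Rightarrow> ('n::finite) cmat) \<Rightarrow> ('n option \<times> 'n coords) set set" where
  "Z_space s \<sigma> = UNIV // glue_rel s \<sigma>"

text \<open>\<open>Z_point s \<sigma> \<alpha>\<close> parametrises \<open>\<pi>\<^sub>\<lambda>\<^sup>-\<^sup>1(U\<^sub>\<alpha>)\<close> by all of \<open>\<complex>\<^sup>2\<^sup>n\<close>; \<open>Z_coord s \<sigma> \<alpha>\<close> is the inverse chart.\<close>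

definition Z_point ::
    "complex \<Rightarrow> ('n option \<Rightarrow> ('n::finite) cmat) \<Rightarrow> 'n option \<Rightarrow> 'n coords \<Rightarrow> ('n option \<times> 'n coords) set" where
  "Z_point s \<sigma> \<alpha> x = glue_rel s \<sigma> `` {(\<alpha>, x)}"

definition Z_coord ::
    "complex \<Rightarrow> ('n option \<Rightarrow> ('n::finite) cmat) \<Rightarrow> 'n option \<Rightarrow> ('n option \<times> 'n coords) set \<Rightarrow> 'n coords" where
  "Z_coord s \<sigma> \<alpha> p = (THE x. p = Z_point s \<sigma> \<alpha> x)"

definition Z_transition ::
    "complex \<Rightarrow> ('n option \<Rightarrow> ('n::finite) cmat) \<Rightarrow> 'n option \<Rightarrow> 'n option \<Rightarrow> 'n coords \<Rightarrow> 'n coords" where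
  "Z_transition s \<sigma> \<alpha> \<beta> = Z_coord s \<sigma> \<beta> \<circ> Z_point s \<sigma> \<alpha>"

text \<open>A point of \<open>Z\<close> is an equivalence class; the local expression of \<open>\<mu>\<^sub>+\<close> is constant on it.\<close>

definition mu_plus :: "complex \<Rightarrow> ('n option \<Rightarrow> ('n::finite) cmat) \<Rightarrow> ('n option \<times> 'n coords) set \<Rightarrow> 'n cmat" where
  "mu_plus s \<sigma> p =
     the_elem ((\<lambda>(\<alpha>, x). h_mat s \<sigma> \<alpha> x ** lambda_vee s ** matrix_inv (h_mat s \<sigma> \<alpha> x)) ` p)"

text \<open>The trace is real; \<open>Re\<close> only adjusts the type.\<close>

definition tau :: "complex \<Rightarrow> ('n option \<Rightarrow> ('n::finite) cmat) \<Rightarrow> ('n option \<times> 'n coords) set \<Rightarrow> real" where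
  "tau s \<sigma> p =
     Re (trace (mu_plus s \<sigma> p ** adj (mu_plus s \<sigma> p))) + (cmod s)\<^sup>2 / real (CARD('n) + 1)"


section \<open>Smooth tensor fields on Z\<close>

primrec C_diff :: "nat \<Rightarrow> ('a::real_normed_vector \<Rightarrow> 'b::real_normed_vector) \<Rightarrow> bool" where
  "C_diff 0 F \<longleftrightarrow> continuous_on UNIV F"
| "C_diff (Suc k) F \<longleftrightarrow>
     (\<forall>x. F differentiable (at x)) \<and> (\<forall>v. C_diff k (\<lambda>x. frechet_derivative F (at x) v))"

definition smooth :: "('a::real_normed_vector \<Rightarrow> 'b::real_normed_vector) \<Rightarrow> bool" where
  "smooth F \<longleftrightarrow> (\<forall>k. C_diff k F)"

text \<open>A tensor field on \<open>Z\<close> is given by its local expressions in the charts \<open>\<pi>\<^sub>\<lambda>\<^sup>-\<^sup>1(U\<^sub>\<alpha>) \<cong> \<complex>\<^sup>2\<^sup>n\<close>,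
  which have to transform into each other under the changes of coordinates.  In
  \<open>b \<alpha> x v w\<close> and \<open>A \<alpha> x v\<close>, \<open>x\<close> is the coordinate vector of a point and \<open>v\<close>, \<open>w\<close> are those of
  tangent vectors.\<close>

type_synonym 'n form_field = "'n option \<Rightarrow> 'n coords \<Rightarrow> 'n coords \<Rightarrow> 'n coords \<Rightarrow> real"
type_synonym 'n endo_field = "'n option \<Rightarrow> 'n coords \<Rightarrow> 'n coords \<Rightarrow> 'n coords"

definition smooth_bilinear_field ::
    "complex \<Rightarrow> ('n option \<Rightarrow> ('n::finite) cmat) \<Rightarrow> 'n form_field \<Rightarrow> bool" where
  "smooth_bilinear_field s \<sigma> b \<longleftrightarrow>
     (\<forall>\<alpha> x. bilinear (b \<alpha> x)) \<and>
     (\<forall>\<alpha> v w. smooth (\<lambda>x. b \<alpha> x v w)) \<and>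
     (\<forall>\<alpha> \<beta> x y. Z_point s \<sigma> \<alpha> x = Z_point s \<sigma> \<beta> y \<longrightarrow>
        (\<forall>v w. b \<alpha> x v w =
           b \<beta> y (frechet_derivative (Z_transition s \<sigma> \<alpha> \<beta>) (at x) v)
                 (frechet_derivative (Z_transition s \<sigma> \<alpha> \<beta>) (at x) w)))"

definition smooth_endo_field ::
    "complex \<Rightarrow> ('n option \<Rightarrow> ('n::finite) cmat) \<Rightarrow> 'n endo_field \<Rightarrow> bool" where
  "smooth_endo_field s \<sigma> A \<longleftrightarrow>
     (\<forall>\<alpha> x. linear (A \<alpha> x)) \<and>
     (\<forall>\<alpha> v. smooth (\<lambda>x. A \<alpha> x v)) \<and>
     (\<forall>\<alpha> \<beta> x y. Z_point s \<sigma> \<alpha> x = Z_point s \<sigma> \<beta> y \<longrightarrow>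
        (\<forall>v. frechet_derivative (Z_transition s \<sigma> \<alpha> \<beta>) (at x) (A \<alpha> x v) =
           A \<beta> y (frechet_derivative (Z_transition s \<sigma> \<alpha> \<beta>) (at x) v)))"

definition smooth_two_form ::
    "complex \<Rightarrow> ('n option \<Rightarrow> ('n::finite) cmat) \<Rightarrow> 'n form_field \<Rightarrow> bool" where
  "smooth_two_form s \<sigma> \<omega> \<longleftrightarrow>
     smooth_bilinear_field s \<sigma> \<omega> \<and> (\<forall>\<alpha> x v. \<omega> \<alpha> x v v = 0)"

definition riemannian_metric ::
    "complex \<Rightarrow> ('n option \<Rightarrow> ('n::finite) cmat) \<Rightarrow> 'n form_field \<Rightarrow> bool" where
  "riemannian_metric s \<sigma> g \<longleftrightarrow>
     smooth_bilinear_field s \<sigma> g \<and>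
     (\<forall>\<alpha> x v w. g \<alpha> x v w = g \<alpha> x w v) \<and>
     (\<forall>\<alpha> x v. v \<noteq> 0 \<longrightarrow> g \<alpha> x v v > 0)"

text \<open>\<open>\<Gamma>\<close> consists of the connection coefficients: \<open>\<nabla>\<^sub>X Y = D Y(X) + \<Gamma>(X, Y)\<close> in each chart.  The
  conditions say that \<open>\<nabla>\<close> is torsion-free and that \<open>\<nabla> g = 0\<close>; they determine \<open>\<Gamma>\<close> at every point of
  every chart when \<open>g\<close> is a Riemannian metric (and thereby its transformation behaviour under
  changes of coordinates).\<close>

definition levi_civita :: "('n::finite) form_field \<Rightarrow>
    ('n option \<Rightarrow> 'n coords \<Rightarrow> 'n coords \<Rightarrow> 'n coords \<Rightarrow> 'n coords) \<Rightarrow> bool" where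
  "levi_civita g \<Gamma> \<longleftrightarrow>
     (\<forall>\<alpha> x. bilinear (\<Gamma> \<alpha> x)) \<and>
     (\<forall>\<alpha> x u v. \<Gamma> \<alpha> x u v = \<Gamma> \<alpha> x v u) \<and>
     (\<forall>\<alpha> x u v w. frechet_derivative (\<lambda>y. g \<alpha> y v w) (at x) u =
        g \<alpha> x (\<Gamma> \<alpha> x u v) w + g \<alpha> x v (\<Gamma> \<alpha> x u w))"

text \<open>\<open>\<nabla> A = 0\<close>, from \<open>(\<nabla>\<^sub>u A) v = \<nabla>\<^sub>u (A v) - A (\<nabla>\<^sub>u v)\<close>.\<close>

definition parallel_endo ::
    "('n option \<Rightarrow> 'n coords \<Rightarrow> 'n coords \<Rightarrow> 'n coords \<Rightarrow> 'n coords) \<Rightarrow> ('n::finite) endo_field \<Rightarrow> bool" where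
  "parallel_endo \<Gamma> A \<longleftrightarrow>
     (\<forall>\<alpha> x u v. frechet_derivative (\<lambda>y. A \<alpha> y v) (at x) u +
        \<Gamma> \<alpha> x u (A \<alpha> x v) - A \<alpha> x (\<Gamma> \<alpha> x u v) = 0)"

definition hyperkaehler ::
    "complex \<Rightarrow> ('n option \<Rightarrow> ('n::finite) cmat) \<Rightarrow> 'n form_field \<Rightarrow>
     'n endo_field \<Rightarrow> 'n endo_field \<Rightarrow> 'n endo_field \<Rightarrow> bool" where
  "hyperkaehler s \<sigma> g I J K \<longleftrightarrow>
     riemannian_metric s \<sigma> g \<and>
     smooth_endo_field s \<sigma> I \<and> smooth_endo_field s \<sigma> J \<and> smooth_endo_field s \<sigma> K \<and>
     (\<forall>\<alpha> x v w.
        g \<alpha> x (I \<alpha> x v) (I \<alpha> x w) = g \<alpha> x v w \<and>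
        g \<alpha> x (J \<alpha> x v) (J \<alpha> x w) = g \<alpha> x v w \<and>
        g \<alpha> x (K \<alpha> x v) (K \<alpha> x w) = g \<alpha> x v w) \<and>
     (\<forall>\<alpha> x v.
        I \<alpha> x (I \<alpha> x v) = - v \<and> J \<alpha> x (J \<alpha> x v) = - v \<and> K \<alpha> x (K \<alpha> x v) = - v \<and>
        I \<alpha> x (J \<alpha> x (K \<alpha> x v)) = - v) \<and>
     (\<exists>\<Gamma>. levi_civita g \<Gamma> \<and> parallel_endo \<Gamma> I \<and> parallel_endo \<Gamma> J \<and> parallel_endo \<Gamma> K)"


section \<open>The forms and complex structures in question\<close>

definition mult_i :: "('n::finite) coords \<Rightarrow> 'n coords" where
  "mult_i v = (\<i> *s fst v, \<i> *s snd v)"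

definition I_struct :: "('n::finite) endo_field" where
  "I_struct \<alpha> x = mult_i"

text \<open>\<open>\<omega>\<^sub>+ = \<Sum>\<^sub>i dz\<^sub>i \<and> d\<xi>\<^sub>i\<close>, with constant coefficients in every chart.\<close>

definition omega_plus :: "('n::finite) coords \<Rightarrow> 'n coords \<Rightarrow> complex" where
  "omega_plus v w = (\<Sum>i\<in>UNIV. fst v $ i * snd w $ i - fst w $ i * snd v $ i)"

definition omega_J :: "('n::finite) form_field" where
  "omega_J \<alpha> x v w = Re (omega_plus v w)"

definition omega_K :: "('n::finite) form_field" where
  "omega_K \<alpha> x v w = Im (omega_plus v w)"

text \<open>For a bilinear form \<open>\<omega>\<close> on a tangent space, the map \<open>\<omega>\<^sup>\<flat>\<close> is the curried function \<open>\<omega>\<close> itself.\<close>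

definition J_struct :: "('n::finite) form_field \<Rightarrow> 'n endo_field" where
  "J_struct \<omega> \<alpha> x = inv (\<omega> \<alpha> x) \<circ> omega_K \<alpha> x"

definition K_struct :: "('n::finite) form_field \<Rightarrow> 'n endo_field" where
  "K_struct \<omega> \<alpha> x = inv (omega_J \<alpha> x) \<circ> \<omega> \<alpha> x"

text \<open>\<open>\<partial>F\<close> (\<open>del\<close>) and its conjugate (\<open>del_bar\<close>): the complex linear and the conjugate linear part of \<open>dF\<close>, for real \<open>F\<close>.\<close>

definition del :: "(('n::finite) coords \<Rightarrow> real) \<Rightarrow> 'n coords \<Rightarrow> 'n coords \<Rightarrow> complex" where
  "del F x v = (of_real (frechet_derivative F (at x) v)
                - \<i> * of_real (frechet_derivative F (at x) (mult_i v))) / 2"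

definition del_bar :: "(('n::finite) coords \<Rightarrow> real) \<Rightarrow> 'n coords \<Rightarrow> 'n coords \<Rightarrow> complex" where
  "del_bar F x v = (of_real (frechet_derivative F (at x) v)
                + \<i> * of_real (frechet_derivative F (at x) (mult_i v))) / 2"

definition ext_deriv ::
    "('a::real_normed_vector \<Rightarrow> 'a \<Rightarrow> 'b::real_normed_vector) \<Rightarrow> 'a \<Rightarrow> 'a \<Rightarrow> 'a \<Rightarrow> 'b" where
  "ext_deriv \<theta> x v w =
     frechet_derivative (\<lambda>y. \<theta> y w) (at x) v - frechet_derivative (\<lambda>y. \<theta> y v) (at x) w"

definition f_fun :: "nat \<Rightarrow> real \<Rightarrow> real \<Rightarrow> real \<Rightarrow> real" where
  "f_fun n \<tau>\<^sub>0 a \<tau> =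
     (if a = 0 then \<tau> powr (-1/2)
      else (((a + (\<tau> - \<tau>\<^sub>0) ^ n) powr (1 / real n)) / (\<tau> * (\<tau> - \<tau>\<^sub>0))) powr (1/2))"

text \<open>The formula for \<open>\<omega>\<^sub>I\<close>; the form is real, and \<open>Re\<close> only adjusts the type.\<close>

definition omega_I_formula ::
    "complex \<Rightarrow> ('n option \<Rightarrow> ('n::finite) cmat) \<Rightarrow> real \<Rightarrow> 'n form_field" where
  "omega_I_formula s \<sigma> a \<alpha> x v w =
     Re (ext_deriv
          (\<lambda>y u. \<i> / 4 * of_real (f_fun CARD('n) ((cmod s)\<^sup>2) a (tau s \<sigma> (Z_point s \<sigma> \<alpha> y))) *
                 (del_bar (\<lambda>y. tau s \<sigma> (Z_point s \<sigma> \<alpha> y)) y u -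
                  del (\<lambda>y. tau s \<sigma> (Z_point s \<sigma> \<alpha> y)) y u)) x v w)"

text \<open>The formula for \<open>\<omega>\<^sub>I\<close> makes sense on all of \<open>Z\<close> if \<open>a = 0\<close>, but only where \<open>\<tau> > \<tau>\<^sub>0\<close> if
  \<open>a > 0\<close>.  In the latter case the remaining values have to be supplied by a smooth extension
  (unique if it exists, as \<open>\<tau> > \<tau>\<^sub>0\<close> holds on a dense set).\<close>

definition provides_hyperkaehler_metric ::
    "complex \<Rightarrow> ('n option \<Rightarrow> ('n::finite) cmat) \<Rightarrow> real \<Rightarrow> bool" where
  "provides_hyperkaehler_metric s \<sigma> a \<longleftrightarrow>
     (\<exists>\<omega> g. smooth_two_form s \<sigma> \<omega> \<and>
        (\<forall>p\<in>Z_space s \<sigma>. a = 0 \<or> tau s \<sigma> p > (cmod s)\<^sup>2 \<longrightarrow>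
           (\<forall>\<alpha> x. p = Z_point s \<sigma> \<alpha> x \<longrightarrow> \<omega> \<alpha> x = omega_I_formula s \<sigma> a \<alpha> x)) \<and>
        g = (\<lambda>\<alpha> x v w. \<omega> \<alpha> x v (I_struct \<alpha> x w)) \<and>
        hyperkaehler s \<sigma> g I_struct (J_struct \<omega>) (K_struct \<omega>))"

end

theory Submission
  imports Defs
begin

text \<open>
  A point of \<open>Z\<close> is a pair \<open>(p, q)\<close> of vectors of \<open>\<complex>\<^sup>n\<^sup>+\<^sup>1\<close> with \<open>p \<bullet> q = s\<close>, up to the action
  \<open>(c p, c\<^sup>-\<^sup>1 q)\<close> of \<open>\<complex>\<^sup>*\<close>; then \<open>\<mu>\<^sub>+ = s/(n+1) - p q\<close> and \<open>\<tau> = \<parallel>p\<parallel>\<^sup>2 \<parallel>q\<parallel>\<^sup>2\<close>.  For \<open>a = 0\<close> the form \<open>\<omega>\<^sub>I\<close> is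
  \<open>\<i> \<partial>\<partial>\<^sup>- \<parallel>p\<parallel>\<parallel>q\<parallel>\<close>, which is the Kaehler form of the hyperkaehler quotient of flat \<open>\<complex>\<^sup>2\<^sup>n\<^sup>+\<^sup>2\<close> by \<open>U(1)\<close>: each
  tangent space of \<open>Z\<close> is identified with the quaternionic subspace of horizontal vectors in
  \<open>\<complex>\<^sup>2\<^sup>n\<^sup>+\<^sup>2\<close>, and \<open>J\<close> is induced by the flat one.  Closedness of \<open>\<omega>\<^sub>I\<close> makes the Christoffel symbols complex
  bilinear.  Since \<open>\<omega>\<^sub>+\<close> has constant coefficients, \<open>\<nabla>\<omega>\<^sub>+\<close> is then determined by them, depends complex
  linearly on the direction, and differentiating \<open>J\<^sup>2 = -1\<close> shows that it vanishes, hence \<open>\<nabla>J = 0\<close>.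

  For \<open>a > 0\<close> the function \<open>f\<close> is unbounded near \<open>\<tau> = \<tau>\<^sub>0\<close>, and \<open>g(v, v)\<close> equals \<open>f(\<tau>)\<close> times the Levi form of
  \<open>\<tau>\<close> on vectors with \<open>\<partial>\<tau>(v) = 0\<close>, so \<open>g\<close> does not extend continuously.
\<close>

section \<open>Smooth functions\<close>

text \<open>The pair (c p, q / c) has equal lengths when |c|^2 = |q| / |p|, and both squared lengths
  are then sqrt(tau). Half their sum, sqrt(tau), is the potential, and this explains the exponent
  -1/2: i/4 tau^(-1/2) (del_bar - del) tau = i/2 (del_bar - del) sqrt(tau). Normalised pairs do not
  depend holomorphically on the point, so the holomorphic slice with last entry of p equal to 1 is
  kept and the scaling enters the metric as the weight |c|^2. An obstacle is that the gluing of
  charts is prescribed by a differential condition on t. Since det t = 1, the trace of dt t^-1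
  vanishes and lambda sees only the corner entry d of t; the condition then becomes algebraic: (p,
  q) goes to (d M p, M q / d) with a real orthogonal matrix M. Differentiating this relation once
  gives the transformation laws of the metric, I and J, because the derivative of d only contributes
  a vector along the orbit, which the horizontal lift removes. For a > 0 the contradiction comes
  from one coefficient of the form along one ray ending on the minimum locus: its square times the
  squared parameter stays above a positive constant.\<close>

lemma C_diff_SucI:
  assumes "\<And>x. (F has_derivative F' x) (at x)" and "\<And>v. C_diff k (\<lambda>x. F' x v)"
  shows "C_diff (Suc k) F"
proof -
  have "frechet_derivative F (at x) = F' x" for x
    using frechet_derivative_at[OF assms(1)] by simp
  then show ?thesis
    using assms by (auto simp: differentiable_def)
qed

lemma C_diff_SucD:
  assumes "C_diff (Suc k) F"
  shows "(F has_derivative frechet_derivative F (at x)) (at x)"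
    and "C_diff k (\<lambda>x. frechet_derivative F (at x) v)"
  using assms by (auto simp: frechet_derivative_works)

text \<open>Product and chain rules leave undifferentiated factors, which have to be downgraded from
  order \<open>Suc k\<close> to order \<open>k\<close>.\<close>

lemma C_diff_Suc_imp: "C_diff (Suc k) F \<Longrightarrow> C_diff k F"
proof (induction k arbitrary: F)
  case 0
  then show ?case
    by (simp add: continuous_on_eq_continuous_within differentiable_imp_continuous_within)
next
  case (Suc k)
  show ?case
    by (rule C_diff_SucI[OF C_diff_SucD(1)[OF Suc.prems]])
      (rule Suc.IH, rule C_diff_SucD(2)[OF Suc.prems])
qed

lemma C_diff_const: "C_diff k (\<lambda>x. c)"
proof (induction k arbitrary: c)
  case (Suc k)
  show ?case
    by (rule C_diff_SucI[OF has_derivative_const]) (rule Suc)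
qed simp

lemma C_diff_ident: "C_diff k (\<lambda>x. x)"
proof (cases k)
  case (Suc k')
  show ?thesis
    unfolding Suc by (rule C_diff_SucI[OF has_derivative_ident]) (rule C_diff_const)
qed simp

lemma C_diff_linear:
  assumes "bounded_linear L"
  shows "C_diff k F \<Longrightarrow> C_diff k (\<lambda>x. L (F x))"
proof (induction k arbitrary: F)
  case 0
  then show ?case
    using assms by (simp add: bounded_linear.continuous_on)
next
  case (Suc k)
  show ?case
    by (rule C_diff_SucI[OF bounded_linear.has_derivative[OF assms C_diff_SucD(1)[OF Suc.prems]]])
      (rule Suc.IH, rule C_diff_SucD(2)[OF Suc.prems])
qed

lemma C_diff_add: "C_diff k F \<Longrightarrow> C_diff k G \<Longrightarrow> C_diff k (\<lambda>x. F x + G x)"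
proof (induction k arbitrary: F G)
  case 0
  then show ?case
    by (simp add: continuous_on_add)
next
  case (Suc k)
  show ?case
    by (rule C_diff_SucI[OF has_derivative_add[OF C_diff_SucD(1)[OF Suc.prems(1)] C_diff_SucD(1)[OF Suc.prems(2)]]])
      (rule Suc.IH; rule C_diff_SucD(2)[OF Suc.prems(1)] C_diff_SucD(2)[OF Suc.prems(2)])
qed

lemma C_diff_bilinear:
  assumes "bounded_bilinear B"
  shows "C_diff k F \<Longrightarrow> C_diff k G \<Longrightarrow> C_diff k (\<lambda>x. B (F x) (G x))"
proof (induction k arbitrary: F G)
  case 0
  then show ?case
    using assms by (simp add: bounded_bilinear.continuous_on)
next
  case (Suc k)
  show ?case
    by (rule C_diff_SucI[OF bounded_bilinear.FDERIV[OF assms C_diff_SucD(1)[OF Suc.prems(1)] C_diff_SucD(1)[OF Suc.prems(2)]]])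
      (intro C_diff_add Suc.IH C_diff_SucD(2)[OF Suc.prems(1)] C_diff_SucD(2)[OF Suc.prems(2)]
          C_diff_Suc_imp[OF Suc.prems(1)] C_diff_Suc_imp[OF Suc.prems(2)])
qed

text \<open>The exponent varies in the induction because differentiation lowers it to
  \<open>c - 1\<close>. The exponents -1 and 1/2 later supply division and square roots.\<close>

lemma C_diff_powr:
  fixes F :: "'a::real_normed_vector \<Rightarrow> real"
  assumes "\<And>x. F x > 0"
  shows "C_diff k F \<Longrightarrow> C_diff k (\<lambda>x. F x powr c)"
proof (induction k arbitrary: c)
  case 0
  then show ?case
    using assms by (auto intro!: continuous_on_powr simp: less_imp_neq[symmetric])
next
  case (Suc k)
  have "((\<lambda>x. F x powr c) has_derivative
      (\<lambda>h. c * F x powr (c - 1) * frechet_derivative F (at x) h)) (at x)" for x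
    using has_derivative_powr[OF C_diff_SucD(1)[OF Suc.prems] has_derivative_const[of c], of x] assms[of x]
    by (simp add: powr_diff mult_ac)
  then show ?case
    by (rule C_diff_SucI)
      (intro C_diff_bilinear[OF bounded_bilinear_mult] C_diff_const Suc.IH C_diff_Suc_imp[OF Suc.prems]
          C_diff_SucD(2)[OF Suc.prems])
qed

lemma smooth_differentiable:
  assumes "smooth F"
  shows "F differentiable (at x)"
proof -
  have "C_diff (Suc 0) F"
    using assms by (simp only: smooth_def)
  then show ?thesis
    by simp
qed

lemma smooth_frechet_derivative:
  assumes "smooth F"
  shows "smooth (\<lambda>x. frechet_derivative F (at x) v)"
  unfolding smooth_def
proof
  fix k
  have "C_diff (Suc k) F"
    using assms by (simp only: smooth_def)
  then show "C_diff k (\<lambda>x. frechet_derivative F (at x) v)"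
    by simp
qed

lemma smooth_has_derivative: "smooth F \<Longrightarrow> (F has_derivative frechet_derivative F (at x)) (at x)"
  by (rule frechet_derivative_works[THEN iffD1, OF smooth_differentiable])

lemma smooth_continuous: "smooth F \<Longrightarrow> continuous_on UNIV F"
  by (simp add: continuous_on_eq_continuous_within differentiable_imp_continuous_within
      smooth_differentiable)

lemma smooth_const: "smooth (\<lambda>x. c)"
  by (simp add: smooth_def C_diff_const)

lemma smooth_linear: "bounded_linear L \<Longrightarrow> smooth F \<Longrightarrow> smooth (\<lambda>x. L (F x))"
  unfolding smooth_def using C_diff_linear[of L _ F] by simp

lemma smooth_bounded_linear: "bounded_linear L \<Longrightarrow> smooth L"
  unfolding smooth_def using C_diff_linear[of L _ "\<lambda>x. x", OF _ C_diff_ident] by simp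

lemma smooth_add: "smooth F \<Longrightarrow> smooth G \<Longrightarrow> smooth (\<lambda>x. F x + G x)"
  unfolding smooth_def by (intro allI C_diff_add) auto

lemma smooth_minus: "smooth F \<Longrightarrow> smooth (\<lambda>x. - F x)"
  by (rule smooth_linear[OF bounded_linear_minus[OF bounded_linear_ident]])

lemma smooth_diff: "smooth F \<Longrightarrow> smooth G \<Longrightarrow> smooth (\<lambda>x. F x - G x)"
  using smooth_add[OF _ smooth_minus[of G], of F] by simp

lemma smooth_mult:
  fixes F :: "_ \<Rightarrow> 'b::real_normed_algebra"
  shows "smooth F \<Longrightarrow> smooth G \<Longrightarrow> smooth (\<lambda>x. F x * G x)"
  unfolding smooth_def using C_diff_bilinear[OF bounded_bilinear_mult, of _ F G] by simp

lemma smooth_sum: "(\<And>i. i \<in> S \<Longrightarrow> smooth (F i)) \<Longrightarrow> smooth (\<lambda>x. \<Sum>i\<in>S. F i x)"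
  by (induction S rule: infinite_finite_induct) (auto intro: smooth_const smooth_add)

lemma smooth_powr:
  fixes F :: "_ \<Rightarrow> real"
  shows "smooth F \<Longrightarrow> (\<And>x. F x > 0) \<Longrightarrow> smooth (\<lambda>x. F x powr c)"
  unfolding smooth_def by (intro allI C_diff_powr) auto

text \<open>A vector is the sum of its entries placed by the linear maps \<open>axis i\<close>, so
  closure under linear maps and finite sums is enough.\<close>

lemma smooth_vec:
  fixes F :: "'a::real_normed_vector \<Rightarrow> complex^'m"
  assumes "\<And>i. smooth (\<lambda>x. F x $ i)"
  shows "smooth F"
proof -
  have eq: "F = (\<lambda>x. \<Sum>i\<in>UNIV. axis i (F x $ i))"
    by (simp add: fun_eq_iff vec_eq_iff axis_def sum.delta)
  have lin: "bounded_linear (axis i :: complex \<Rightarrow> complex^'m)" for i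
    by (rule linear_conv_bounded_linear[THEN iffD1], rule linearI) (auto simp: vec_eq_iff axis_def)
  then show ?thesis
    by (subst eq) (intro smooth_sum smooth_linear[OF lin] assms)
qed

lemma smooth_Pair:
  assumes "smooth F" "smooth G"
  shows "smooth (\<lambda>x. (F x, G x))"
proof -
  have "(\<lambda>x. (F x, G x)) = (\<lambda>x. (F x, 0) + (0, G x))"
    by auto
  moreover have "smooth (\<lambda>x. (F x, 0) + (0, G x))"
    by (intro smooth_add smooth_linear[of "\<lambda>y. (y, 0)"] smooth_linear[of "\<lambda>y. (0, y)"]
        bounded_linear_Pair bounded_linear_ident bounded_linear_zero assms)
  ultimately show ?thesis
    by metis
qed

lemma has_derivative_vec:
  fixes F :: "'a::real_normed_vector \<Rightarrow> ('b::euclidean_space)^'m"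
  assumes "\<And>i. ((\<lambda>x. F x $ i) has_derivative (\<lambda>h. F' h $ i)) net"
  shows "(F has_derivative F') net"
proof -
  have eq: "G = (\<lambda>x. \<Sum>i\<in>UNIV. axis i (G x $ i))" for G :: "'a \<Rightarrow> 'b^'m"
    by (simp add: fun_eq_iff vec_eq_iff axis_def sum.delta)
  have lin: "bounded_linear (axis i :: 'b \<Rightarrow> 'b^'m)" for i
    by (rule linear_conv_bounded_linear[THEN iffD1], rule linearI) (auto simp: vec_eq_iff axis_def)
  show ?thesis
    by (subst eq[of F], subst eq[of F'])
      (intro has_derivative_sum bounded_linear.has_derivative[OF lin] assms)
qed

text \<open>Product rule for a varying endomorphism applied to a moving vector, when derivatives are
  known only for each fixed vector; expansion in \<open>Basis\<close> reduces it to those. It serves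
  to differentiate \<open>J y (J y v)\<close>.\<close>

lemma has_derivative_fun_apply:
  fixes A :: "'a::euclidean_space \<Rightarrow> 'a \<Rightarrow> 'b::real_normed_vector"
  assumes lin: "\<And>y. linear (A y)"
    and A: "\<And>v. ((\<lambda>y. A y v) has_derivative (\<lambda>h. A' h v)) (at x)"
    and k: "(k has_derivative k') (at x)"
  shows "((\<lambda>y. A y (k y)) has_derivative (\<lambda>h. A x (k' h) + A' h (k x))) (at x)"
proof -
  have exp: "A y v = (\<Sum>b\<in>Basis. (v \<bullet> b) *\<^sub>R A y b)" for y v
    by (subst euclidean_representation[of v, symmetric])
      (simp add: linear_sum[OF lin] linear_cmul[OF lin])
  have "((\<lambda>y. \<Sum>b\<in>Basis. (k y \<bullet> b) *\<^sub>R A y b) has_derivative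
      (\<lambda>h. \<Sum>b\<in>Basis. (k x \<bullet> b) *\<^sub>R A' h b + (k' h \<bullet> b) *\<^sub>R A x b)) (at x)"
    by (auto intro!: derivative_eq_intros A k)
  \<comment> \<open>Linearity of \<open>A' h\<close> is inherited from that of \<open>A y\<close> by
    uniqueness of derivatives.\<close>
  moreover have "A' h (k x) = (\<Sum>b\<in>Basis. (k x \<bullet> b) *\<^sub>R A' h b)" for h
  proof -
    have "((\<lambda>y. A y (k x)) has_derivative (\<lambda>h. \<Sum>b\<in>Basis. (k x \<bullet> b) *\<^sub>R A' h b)) (at x)"
      by (subst exp) (auto intro!: derivative_eq_intros A)
    then show ?thesis
      using has_derivative_unique[OF A] by metis
  qed
  ultimately show ?thesis
    by (simp add: exp[symmetric] sum.distrib add.commute)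
qed

text \<open>The second difference of \<open>F\<close> over a parallelogram is estimated by two applications of the mean
  value theorem, once in each order of the two directions.\<close>

lemma second_derivative_symmetric:
  fixes F :: "'a::real_normed_vector \<Rightarrow> real"
  assumes "smooth F"
  shows "frechet_derivative (\<lambda>y. frechet_derivative F (at y) v) (at x) u =
         frechet_derivative (\<lambda>y. frechet_derivative F (at y) u) (at x) v"
proof -
  define D where "D v y = frechet_derivative F (at y) v" for v y
  define D2 where "D2 u v y = frechet_derivative (D v) (at y) u" for u v y
  have sD: "smooth (D v)" for v
    unfolding D_def by (rule smooth_frechet_derivative[OF assms])
  have sD2: "continuous_on UNIV (D2 u v)" for u v
    unfolding D2_def by (rule smooth_continuous[OF smooth_frechet_derivative[OF sD]])
  have line: "((\<lambda>t. y + t *\<^sub>R w) has_derivative (\<lambda>h. h *\<^sub>R w)) (at t)" for y w :: 'a and t :: real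
    by (auto intro!: derivative_eq_intros)
  have mult: "(\<lambda>h. frechet_derivative G (at y) (h *\<^sub>R w)) = (*) (frechet_derivative G (at y) w)"
    if "smooth G" for G :: "'a \<Rightarrow> real" and y w
    using linear_cmul[OF linear_frechet_derivative[OF smooth_differentiable[OF that]]]
    by (simp add: fun_eq_iff mult.commute)
  have DF: "((\<lambda>t. F (y + t *\<^sub>R w)) has_real_derivative D w (y + t *\<^sub>R w)) (at t)" for y w t
    using has_derivative_compose[OF line[of y w t] smooth_has_derivative[OF assms]]
    by (simp add: has_field_derivative_def D_def mult[OF assms])
  have DD: "((\<lambda>t. D v (y + t *\<^sub>R w)) has_real_derivative D2 w v (y + t *\<^sub>R w)) (at t)" for y w v t
    using has_derivative_compose[OF line[of y w t] smooth_has_derivative[OF sD]]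
    by (simp add: has_field_derivative_def D2_def mult[OF sD])
  have key: "\<exists>a b. 0 < a \<and> a < e \<and> 0 < b \<and> b < e \<and>
      F (x + e *\<^sub>R u + e *\<^sub>R v) - F (x + e *\<^sub>R u) - F (x + e *\<^sub>R v) + F x =
      e * e * D2 u v (x + a *\<^sub>R u + b *\<^sub>R v)" if e: "e > 0" for e u v
  proof -
    have "\<exists>b. 0 < b \<and> b < e \<and> (F (x + e *\<^sub>R u + e *\<^sub>R v) - F (x + e *\<^sub>R v)) - (F (x + e *\<^sub>R u + 0 *\<^sub>R v) - F (x + 0 *\<^sub>R v))
        = (e - 0) * (D v (x + e *\<^sub>R u + b *\<^sub>R v) - D v (x + b *\<^sub>R v))"
      using MVT2[of 0 e "\<lambda>t. F (x + e *\<^sub>R u + t *\<^sub>R v) - F (x + t *\<^sub>R v)"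
          "\<lambda>t. D v (x + e *\<^sub>R u + t *\<^sub>R v) - D v (x + t *\<^sub>R v)",
          OF e DERIV_diff[OF DF DF]]
      by auto
    then obtain b where b: "0 < b" "b < e"
      "F (x + e *\<^sub>R u + e *\<^sub>R v) - F (x + e *\<^sub>R v) - (F (x + e *\<^sub>R u) - F x)
        = e * (D v (x + e *\<^sub>R u + b *\<^sub>R v) - D v (x + b *\<^sub>R v))"
      by auto
    have "\<exists>a. 0 < a \<and> a < e \<and> D v ((x + b *\<^sub>R v) + e *\<^sub>R u) - D v ((x + b *\<^sub>R v) + 0 *\<^sub>R u)
       = (e - 0) * D2 u v ((x + b *\<^sub>R v) + a *\<^sub>R u)"
      using MVT2[of 0 e "\<lambda>t. D v ((x + b *\<^sub>R v) + t *\<^sub>R u)" "\<lambda>t. D2 u v ((x + b *\<^sub>R v) + t *\<^sub>R u)",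
          OF e DD]
      by auto
    then obtain a where a: "0 < a" "a < e"
      "D v ((x + b *\<^sub>R v) + e *\<^sub>R u) - D v (x + b *\<^sub>R v) = e * D2 u v ((x + b *\<^sub>R v) + a *\<^sub>R u)"
      by auto
    have "(x + b *\<^sub>R v) + e *\<^sub>R u = x + e *\<^sub>R u + b *\<^sub>R v" "(x + b *\<^sub>R v) + a *\<^sub>R u = x + a *\<^sub>R u + b *\<^sub>R v"
      by simp_all
    then have "F (x + e *\<^sub>R u + e *\<^sub>R v) - F (x + e *\<^sub>R u) - F (x + e *\<^sub>R v) + F x
      = e * e * D2 u v (x + a *\<^sub>R u + b *\<^sub>R v)"
      using a(3) b(3) by (simp add: algebra_simps)
    with a b show ?thesis
      by blast
  qed
  define e where "e n = inverse (real (Suc n))" for n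
  have e: "e n > 0" "e \<longlonglongrightarrow> 0" for n
    unfolding e_def using LIMSEQ_inverse_real_of_nat by (auto simp del: of_nat_Suc)
  define S where "S u v t = F (x + t *\<^sub>R u + t *\<^sub>R v) - F (x + t *\<^sub>R u) - F (x + t *\<^sub>R v) + F x" for u v t
  have lim: "(\<lambda>n. S u v (e n) / (e n * e n)) \<longlonglongrightarrow> D2 u v x" for u v
  proof -
    have "\<forall>n. \<exists>ab. 0 < fst ab \<and> fst ab < e n \<and> 0 < snd ab \<and> snd ab < e n \<and>
        S u v (e n) = e n * e n * D2 u v (x + fst ab *\<^sub>R u + snd ab *\<^sub>R v)"
    proof
      fix n
      from key[OF e(1)[of n], of u v] obtain a b where "0 < a" "a < e n" "0 < b" "b < e n"
        "S u v (e n) = e n * e n * D2 u v (x + a *\<^sub>R u + b *\<^sub>R v)"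
        unfolding S_def by blast
      then show "\<exists>ab. 0 < fst ab \<and> fst ab < e n \<and> 0 < snd ab \<and> snd ab < e n \<and>
        S u v (e n) = e n * e n * D2 u v (x + fst ab *\<^sub>R u + snd ab *\<^sub>R v)"
        by (intro exI[of _ "(a, b)"]) simp
    qed
    then obtain ab where ab: "\<And>n. 0 < fst (ab n) \<and> fst (ab n) < e n \<and> 0 < snd (ab n) \<and> snd (ab n) < e n \<and>
        S u v (e n) = e n * e n * D2 u v (x + fst (ab n) *\<^sub>R u + snd (ab n) *\<^sub>R v)"
      by metis
    have "(\<lambda>n. fst (ab n)) \<longlonglongrightarrow> 0" "(\<lambda>n. snd (ab n)) \<longlonglongrightarrow> 0"
      by (rule tendsto_sandwich[OF _ _ tendsto_const e(2)]; use ab less_imp_le in \<open>auto intro!: always_eventually\<close>)+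
    then have "(\<lambda>n. x + fst (ab n) *\<^sub>R u + snd (ab n) *\<^sub>R v) \<longlonglongrightarrow> x + 0 *\<^sub>R u + 0 *\<^sub>R v"
      by (intro tendsto_intros)
    then have "(\<lambda>n. D2 u v (x + fst (ab n) *\<^sub>R u + snd (ab n) *\<^sub>R v)) \<longlonglongrightarrow> D2 u v x"
      by (intro continuous_on_tendsto_compose[OF sD2]) auto
    moreover have "S u v (e n) / (e n * e n) = D2 u v (x + fst (ab n) *\<^sub>R u + snd (ab n) *\<^sub>R v)" for n
      using ab[of n] e(1)[of n] by simp
    ultimately show ?thesis
      by presburger
  qed
  have "S u v t = S v u t" for t
    unfolding S_def by (simp add: add_ac)
  then have "D2 u v x = D2 v u x"
    using LIMSEQ_unique[OF lim[of u v]] lim[of v u] by simp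
  then show ?thesis
    by (simp add: D2_def D_def[abs_def])
qed

section \<open>Parallel complex structures\<close>

text \<open>One chart of Z: I, \<open>\<omega>J\<close> and \<open>\<omega>K\<close> have constant
  coefficients there, while \<open>\<omega>\<close> and J vary. \<open>K_I_left\<close> and
  \<open>K_I_right\<close> express that the form with real part \<open>\<omega>J\<close> and
  imaginary part \<open>\<omega>K\<close> is complex bilinear; \<open>K_J\<close> is the relation
  \<open>\<omega>\<close> (J v, w) = \<open>\<omega>K\<close> (v, w) with J v substituted for
  v.\<close>

locale quaternionic_chart =
  fixes \<omega> :: "'a::euclidean_space \<Rightarrow> 'a \<Rightarrow> 'a \<Rightarrow> real"
    and I :: "'a \<Rightarrow> 'a" and J :: "'a \<Rightarrow> 'a \<Rightarrow> 'a"
    and \<omega>J \<omega>K :: "'a \<Rightarrow> 'a \<Rightarrow> real"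
  assumes bilinear_form: "bilinear (\<omega> x)"
    and smooth_form: "smooth (\<lambda>x. \<omega> x v w)"
    and alternating: "\<omega> x w v = - \<omega> x v w"
    and closed: "frechet_derivative (\<lambda>y. \<omega> y v w) (at x) u +
      frechet_derivative (\<lambda>y. \<omega> y w u) (at x) v +
      frechet_derivative (\<lambda>y. \<omega> y u v) (at x) w = 0"
    and linear_I: "linear I" and I_I: "I (I v) = - v"
    and I_invariant: "\<omega> x (I v) (I w) = \<omega> x v w"
    and positive: "v \<noteq> 0 \<Longrightarrow> \<omega> x v (I v) > 0"
    and bilinear_K: "bilinear \<omega>K"
    and K_alternating: "\<omega>K w v = - \<omega>K v w"
    and K_I_left: "\<omega>K (I v) w = \<omega>J v w" and K_I_right: "\<omega>K v (I w) = \<omega>J v w"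
    and linear_J: "linear (J x)" and smooth_J: "smooth (\<lambda>x. J x v)"
    and J_J: "J x (J x v) = - v" and J_I: "J x (I v) = - I (J x v)"
    and K_J: "\<omega>K (J x v) w = - \<omega> x v w"
begin

definition metric :: "'a \<Rightarrow> 'a \<Rightarrow> 'a \<Rightarrow> real" where
  "metric x v w = \<omega> x v (I w)"

definition Dform :: "'a \<Rightarrow> 'a \<Rightarrow> 'a \<Rightarrow> 'a \<Rightarrow> real" where
  "Dform x u v w = frechet_derivative (\<lambda>y. \<omega> y v w) (at x) u"

text \<open>Koszul's formula for the Levi-Civita connection. As I is constant,
  \<open>Dform x u v (I w)\<close> is the derivative of the metric coefficient (v, w) in direction
  u.\<close>

definition koszul :: "'a \<Rightarrow> 'a \<Rightarrow> 'a \<Rightarrow> 'a \<Rightarrow> real" where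
  "koszul x u v w = (Dform x u v (I w) + Dform x v u (I w) - Dform x w u (I v)) / 2"

definition christoffel :: "'a \<Rightarrow> 'a \<Rightarrow> 'a \<Rightarrow> 'a" where
  "christoffel x u v = (SOME a. \<forall>w. metric x a w = koszul x u v w)"

lemmas form_simps = bilinear_ladd[OF bilinear_form] bilinear_radd[OF bilinear_form]
  bilinear_lmul[OF bilinear_form] bilinear_rmul[OF bilinear_form]
  bilinear_lneg[OF bilinear_form] bilinear_rneg[OF bilinear_form]
  bilinear_lsub[OF bilinear_form] bilinear_rsub[OF bilinear_form]

lemmas K_simps = bilinear_ladd[OF bilinear_K] bilinear_radd[OF bilinear_K]
  bilinear_lmul[OF bilinear_K] bilinear_rmul[OF bilinear_K]
  bilinear_lneg[OF bilinear_K] bilinear_rneg[OF bilinear_K]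
  bilinear_lsub[OF bilinear_K] bilinear_rsub[OF bilinear_K]

lemmas I_simps = linear_add[OF linear_I] linear_cmul[OF linear_I] linear_neg[OF linear_I]
  linear_diff[OF linear_I] I_I

lemmas J_simps = linear_add[OF linear_J] linear_cmul[OF linear_J] linear_neg[OF linear_J]
  linear_diff[OF linear_J] J_J

lemma form_has_derivative: "((\<lambda>y. \<omega> y v w) has_derivative (\<lambda>u. Dform x u v w)) (at x)"
  unfolding Dform_def by (rule smooth_has_derivative[OF smooth_form])

lemma Dform_eqI: "((\<lambda>y. \<omega> y v w) has_derivative F) (at x) \<Longrightarrow> Dform x u v w = F u"
  using has_derivative_unique[OF form_has_derivative] by metis

lemma Dform_linear: "linear (\<lambda>u. Dform x u v w)"
  unfolding Dform_def by (rule linear_frechet_derivative[OF smooth_differentiable[OF smooth_form]])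

lemma Dform_simps:
  "Dform x (u + u') v w = Dform x u v w + Dform x u' v w"
  "Dform x (c *\<^sub>R u) v w = c * Dform x u v w"
  "Dform x u (v + v') w = Dform x u v w + Dform x u v' w"
  "Dform x u (c *\<^sub>R v) w = c * Dform x u v w"
  "Dform x u v (w + w') = Dform x u v w + Dform x u v w'"
  "Dform x u v (c *\<^sub>R w) = c * Dform x u v w"
  using linear_add[OF Dform_linear] linear_cmul[OF Dform_linear]
  by (auto simp: form_simps intro!: Dform_eqI derivative_eq_intros form_has_derivative)

lemma Dform_neg:
  "Dform x (- u) v w = - Dform x u v w" "Dform x u (- v) w = - Dform x u v w"
  "Dform x u v (- w) = - Dform x u v w"
  using Dform_simps(2)[of x "-1"] Dform_simps(4)[of x u "-1"] Dform_simps(6)[of x u v "-1"] by simp_all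

lemma Dform_alternating: "Dform x u w v = - Dform x u v w"
proof (rule Dform_eqI)
  show "((\<lambda>y. \<omega> y w v) has_derivative (\<lambda>u. - Dform x u v w)) (at x)"
    using has_derivative_minus[OF form_has_derivative, of v w x] by (simp add: alternating[of _ w v])
qed

lemma Dform_I: "Dform x u (I v) (I w) = Dform x u v w"
  by (simp add: Dform_def I_invariant)

lemma Dform_closed: "Dform x u v w + Dform x v w u + Dform x w u v = 0"
  unfolding Dform_def by (rule closed)

lemma metric_sym: "metric x v w = metric x w v"
  using alternating[of x w "I v"] I_invariant[of x "I v" w]
  by (simp add: metric_def I_simps form_simps)

lemma metric_unique:
  assumes "\<And>w. metric x v w = metric x v' w"
  shows "v = v'"
proof (rule ccontr)
  assume "v \<noteq> v'"
  then have "\<omega> x (v - v') (I (v - v')) > 0"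
    by (intro positive) simp
  with assms[of "v - v'"] show False
    by (simp add: metric_def form_simps)
qed

text \<open>Riesz representation: \<open>T\<close> sends v to the Euclidean representative of
  \<open>metric x v\<close>, is injective by positivity and hence onto by dimension.\<close>

lemma metric_representation:
  assumes "linear L"
  obtains v where "\<And>w. metric x v w = L w"
proof -
  define T where "T v = (\<Sum>b\<in>Basis. metric x v b *\<^sub>R b)" for v
  have lin: "linear (\<lambda>w. metric x v w)" for v
    by (rule linearI) (simp_all add: metric_def form_simps I_simps)
  have exp: "M w = T' \<bullet> w" if "linear M" "T' = (\<Sum>b\<in>Basis. M b *\<^sub>R b)" for M :: "'a \<Rightarrow> real" and T' w
    unfolding that(2)
    by (subst (1) euclidean_representation[of w, symmetric])
      (simp add: linear_sum[OF that(1)] linear_cmul[OF that(1)] inner_sum_left inner_commute[of w] mult.commute)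
  have "linear T"
    by (rule linearI) (simp_all add: T_def metric_def form_simps sum.distrib scaleR_add_left scaleR_sum_right)
  moreover have "inj T"
  proof (rule injI)
    fix v v'
    assume "T v = T v'"
    then show "v = v'"
      using exp[OF lin T_def, of v] exp[OF lin T_def, of v'] by (intro metric_unique[of x]) simp
  qed
  ultimately have "surj T"
    by (rule linear_inj_imp_surj)
  then obtain v where v: "T v = (\<Sum>b\<in>Basis. L b *\<^sub>R b)"
    by (metis surj_def)
  then have "metric x v w = L w" for w
    using exp[OF lin T_def, of v w] exp[OF assms v, of w] by simp
  then show ?thesis
    by (rule that)
qed

section \<open>The Levi-Civita connection of a Kaehler metric\<close>

lemma metric_christoffel: "metric x (christoffel x u v) w = koszul x u v w"
proof -
  have "linear (\<lambda>w. koszul x u v w)"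
    by (rule linearI) (simp_all add: koszul_def Dform_simps I_simps add_divide_distrib diff_divide_distrib algebra_simps)
  then have "\<exists>a. \<forall>w. metric x a w = koszul x u v w"
    using metric_representation[of "\<lambda>w. koszul x u v w" x] by blast
  from someI_ex[OF this, folded christoffel_def] show ?thesis
    by (rule spec)
qed

lemma christoffel_eqI: "(\<And>w. koszul x u v w = metric x a w) \<Longrightarrow> christoffel x u v = a"
  by (rule metric_unique[of x]) (simp add: metric_christoffel)

lemma metric_simps:
  "metric x (v + v') w = metric x v w + metric x v' w" "metric x (c *\<^sub>R v) w = c * metric x v w"
  "metric x (- v) w = - metric x v w"
  by (simp_all add: metric_def form_simps)

lemma christoffel_bilinear: "bilinear (christoffel x)"
  unfolding bilinear_def
  by (auto intro!: linearI christoffel_eqI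
      simp: metric_simps metric_christoffel koszul_def Dform_simps I_simps field_simps)

lemma form_I_swap: "\<omega> x v (I w) = \<omega> x w (I v)"
  using metric_sym by (simp add: metric_def)

lemma christoffel_sym: "christoffel x u v = christoffel x v u"
  by (rule christoffel_eqI) (simp add: metric_christoffel koszul_def Dform_def form_I_swap[of _ u v])

text \<open>In the sum of the Koszul expressions for (u, v, w) and (u, w, v), the derivatives in the
  directions v and w cancel.\<close>

lemma metric_parallel:
  "frechet_derivative (\<lambda>y. metric y v w) (at x) u =
    metric x (christoffel x u v) w + metric x v (christoffel x u w)"
proof -
  have "Dform x u w (I v) = Dform x u v (I w)" "Dform x w u (I v) = Dform x w v (I u)"
    "Dform x v u (I w) = Dform x v w (I u)"
    by (simp_all add: Dform_def form_I_swap[of _ v w] form_I_swap[of _ u v] form_I_swap[of _ w u])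
  then have "Dform x u v (I w) = koszul x u v w + koszul x u w v"
    by (simp add: koszul_def field_simps)
  moreover have "frechet_derivative (\<lambda>y. metric y v w) (at x) u = Dform x u v (I w)"
    by (simp add: metric_def Dform_def)
  ultimately show ?thesis
    by (simp add: metric_sym[of x v] metric_christoffel)
qed

text \<open>The classical step from closedness to a parallel complex structure: the Koszul
  expressions for (u, I v, w) and, with a sign, for (u, v, I w) differ by the cyclic sums of the
  closed form at (I v, u, I w) and (v, u, w), up to invariance under I.\<close>

lemma christoffel_I_right: "christoffel x u (I v) = I (christoffel x u v)"
proof (rule christoffel_eqI)
  fix w
  have "metric x (I (christoffel x u v)) w = - metric x (christoffel x u v) (I w)"
    using I_invariant[of x "christoffel x u v" "w"] by (simp add: metric_def I_simps form_simps)
  also have "\<dots> = - koszul x u v (I w)"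
    by (simp add: metric_christoffel)
  also have "\<dots> = koszul x u (I v) w"
    using Dform_closed[of x "I v" u "I w"] Dform_closed[of x v u w]
    by (simp add: koszul_def I_simps Dform_neg Dform_I Dform_alternating[of x u w v]
      Dform_alternating[of x u "I w" "I v"]
      Dform_alternating[of x _ "I v" u] Dform_alternating[of x _ "I w" u] 
      Dform_alternating[of x _ v u] Dform_alternating[of x _ w u] field_simps)
  finally show "koszul x u (I v) w = metric x (I (christoffel x u v)) w"
    by simp
qed

lemma christoffel_I_left: "christoffel x (I u) v = I (christoffel x u v)"
  using christoffel_I_right christoffel_sym by metis

lemma form_parallel:
  "Dform x u v w = \<omega> x (christoffel x u v) w + \<omega> x v (christoffel x u w)"
proof -
  have "Dform x u v w = frechet_derivative (\<lambda>y. metric y v (- I w)) (at x) u"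
    by (simp add: metric_def I_simps Dform_def)
  also have "\<dots> = \<omega> x (christoffel x u v) w + \<omega> x v (christoffel x u w)"
    unfolding metric_parallel bilinear_rneg[OF christoffel_bilinear] christoffel_I_right
    by (simp add: metric_def I_simps)
  finally show ?thesis .
qed

lemma K_nondegenerate:
  assumes "\<And>w. \<omega>K v w = 0"
  shows "v = 0"
proof (rule ccontr)
  assume "v \<noteq> 0"
  then have "J x v \<noteq> 0" for x
    using J_J[of x v] linear_0[OF linear_J, of x] by auto
  then have "\<omega> x (J x v) (I (J x v)) > 0" for x
    by (rule positive)
  moreover have "\<omega> x (J x v) w = 0" for x w
    using K_J[of x "J x v" w] assms by (simp add: J_simps K_simps)
  ultimately show False
    by (metis less_irrefl)
qed

text \<open>The tensor \<open>B\<close> is complex bilinear in its last two arguments and has the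
  same complex linearity in the direction, whereas J is antilinear. Invariance of \<open>B\<close>
  under J then forces a sign contradiction unless \<open>B\<close> is 0, and \<open>B\<close>
  controls the covariant derivative of J.\<close>

lemma J_parallel:
  "frechet_derivative (\<lambda>y. J y v) (at x) u + christoffel x u (J x v) - J x (christoffel x u v) = 0"
proof -
  define J' where "J' u v = frechet_derivative (\<lambda>y. J y v) (at x) u" for u v
  define \<Gamma> where "\<Gamma> = christoffel x"
  define C where "C u v = J' u v + \<Gamma> u (J x v) - J x (\<Gamma> u v)" for u v
  \<comment> \<open>\<open>C\<close> is the covariant derivative of J. Since
    \<open>\<omega>K\<close> has constant coefficients, its covariant derivative is -
    \<open>B\<close>. Differentiating \<open>K_J\<close> covariantly, with \<open>\<omega>\<close>
    parallel, yields \<open>K_C\<close>.\<close>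
  define B where "B u v w = \<omega>K (\<Gamma> u v) w + \<omega>K v (\<Gamma> u w)" for u v w
  note bil = bilinear_ladd[OF christoffel_bilinear] bilinear_radd[OF christoffel_bilinear]
    bilinear_lneg[OF christoffel_bilinear] bilinear_rneg[OF christoffel_bilinear]
  have J': "((\<lambda>y. J y v) has_derivative (\<lambda>u. J' u v)) (at x)" for v
    unfolding J'_def by (rule smooth_has_derivative[OF smooth_J])
  have K_lin: "bounded_linear (\<lambda>v. \<omega>K v w)" for w
    using bilinear_K by (simp add: bilinear_def linear_conv_bounded_linear)
  have K_J': "\<omega>K (J' u v) w = - Dform x u v w" for u v w
  proof -
    have "((\<lambda>y. \<omega>K (J y v) w) has_derivative (\<lambda>u. \<omega>K (J' u v) w)) (at x)"
      by (rule bounded_linear.has_derivative[OF K_lin J'])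
    then have "((\<lambda>y. - \<omega> y v w) has_derivative (\<lambda>u. \<omega>K (J' u v) w)) (at x)"
      by (simp add: K_J)
    then have "((\<lambda>y. - (- \<omega> y v w)) has_derivative (\<lambda>u. - \<omega>K (J' u v) w)) (at x)"
      by (rule has_derivative_minus)
    then show ?thesis
      using Dform_eqI by fastforce
  qed
  have K_C: "\<omega>K (C u v) w = B u (J x v) w" for u v w
  proof -
    have "\<omega> x v (\<Gamma> u w) = - \<omega>K (J x v) (\<Gamma> u w)" "\<omega> x (\<Gamma> u v) w = - \<omega>K (J x (\<Gamma> u v)) w"
      by (simp_all add: K_J)
    then show ?thesis
      unfolding C_def B_def K_simps K_J' form_parallel \<Gamma>_def[symmetric] by simp
  qed
  have J'_J: "J x (J' u v) + J' u (J x v) = 0" for u v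
  proof -
    have "((\<lambda>y. J y (J y v)) has_derivative (\<lambda>u. J x (J' u v) + J' u (J x v))) (at x)"
      by (rule has_derivative_fun_apply[OF linear_J J' J'])
    then have "(\<lambda>u. J x (J' u v) + J' u (J x v)) = (\<lambda>u. 0)"
      unfolding J_J by (rule has_derivative_unique[OF _ has_derivative_const])
    then show ?thesis
      by metis
  qed
  have C_J: "C u (J x v) + J x (C u v) = 0" for u v
    using J'_J[of u v] unfolding C_def by (simp add: J_simps \<Gamma>_def bil add.commute)
  have J_skew: "\<omega>K (J x v) w = \<omega>K v (J x w)" for v w
    using K_J[of x v w] K_J[of x w v] alternating[of x v w] K_alternating[of v "J x w"] by simp
  have B_neg: "B u (- v) w = - B u v w" "B u v (- w) = - B u v w" for u v w
    by (simp_all add: B_def \<Gamma>_def bil K_simps)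
  have B_J: "B u (J x v) (J x w) = B u v w" for u v w
  proof -
    have "\<omega>K (C u (J x v) + J x (C u v)) w = 0"
      by (simp only: C_J bilinear_lzero[OF bilinear_K])
    then show ?thesis
      by (simp add: K_simps J_skew K_C J_simps B_neg)
  qed
  have B_I: "B u (I v) w = B (I u) v w" "B u v (I w) = B (I u) v w" for u v w
    by (simp_all add: B_def \<Gamma>_def christoffel_I_left christoffel_I_right K_I_left K_I_right)
  \<comment> \<open>Moving I from the direction to v, inserting J in both arguments, and moving I
    back through the antilinear J costs one sign, so the value equals its negative.\<close>
  have B_0: "B (I u) v w = 0" for u v w
  proof -
    have "B (I u) v w = B u (J x (I v)) (J x w)"
      by (simp add: B_I B_J)
    also have "\<dots> = - B (I u) (J x v) (J x w)"
      by (simp add: J_I B_neg B_I)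
    also have "\<dots> = - B (I u) v w"
      by (simp add: B_J)
    finally show ?thesis
      by simp
  qed
  have "B u v w = 0" for u v w
    using B_0[of "- I u"] by (simp add: I_simps)
  then have "C u v = 0" for u v
    by (intro K_nondegenerate) (simp add: K_C)
  then show ?thesis
    by (simp add: C_def J'_def \<Gamma>_def)
qed

lemma I_J_parallel:
  "frechet_derivative (\<lambda>y. I (J y v)) (at x) u + christoffel x u (I (J x v)) - I (J x (christoffel x u v)) = 0"
proof -
  have "frechet_derivative (\<lambda>y. I (J y v)) (at x) u = I (frechet_derivative (\<lambda>y. J y v) (at x) u)"
    using frechet_derivative_at[OF bounded_linear.has_derivative[OF
        linear_I[unfolded linear_conv_bounded_linear] smooth_has_derivative[OF smooth_J]]]
    by metis
  then have "frechet_derivative (\<lambda>y. I (J y v)) (at x) u + christoffel x u (I (J x v)) - I (J x (christoffel x u v))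
    = I (frechet_derivative (\<lambda>y. J y v) (at x) u + christoffel x u (J x v) - J x (christoffel x u v))"
    by (simp add: I_simps christoffel_I_right)
  then show ?thesis
    by (simp add: J_parallel linear_0[OF linear_I])
qed

end

section \<open>Pairs of vectors representing points of the twisted cotangent bundle\<close>

definition herm :: "complex^'m \<Rightarrow> complex^'m \<Rightarrow> complex" where
  "herm a b = (\<Sum>i\<in>UNIV. a $ i * cnj (b $ i))"

definition nsq :: "complex^'m \<Rightarrow> real" where
  "nsq a = (\<Sum>i\<in>UNIV. (cmod (a $ i))\<^sup>2)"

text \<open>Conjugation exchanges the bilinear pairing \<open>covector\<close>, which carries the
  constraint p . q = s, with the Hermitian pairing \<open>herm\<close>, which carries the metric.
  This is why J can exchange tangency and orthogonality.\<close>

definition cvec :: "complex^'m \<Rightarrow> complex^'m" where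
  "cvec a = (\<chi> i. cnj (a $ i))"

definition snoc :: "complex^'n \<Rightarrow> complex \<Rightarrow> ('n::finite) cvec" where
  "snoc u c = (\<chi> i. case i of Some k \<Rightarrow> u $ k | None \<Rightarrow> c)"

lemma snoc_nth [simp]: "snoc u c $ Some k = u $ k" "snoc u c $ None = c"
  by (simp_all add: snoc_def)

lemma cvec_nth [simp]: "cvec a $ i = cnj (a $ i)"
  by (simp add: cvec_def)

lemma sum_option: "(\<Sum>i\<in>UNIV. F i) = F None + (\<Sum>k\<in>(UNIV::'n::finite set). F (Some k))"
  by (simp add: UNIV_option_conv sum.reindex)

lemma covector_snoc: "covector (snoc a c) (snoc b d) = covector a b + c * d"
  by (simp add: covector_def sum_option)

lemma covector_add: "covector (a + a') b = covector a b + covector a' b"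
    "covector b (a + a') = covector b a + covector b a'"
  and covector_scale: "covector (c *s a) b = c * covector a b" "covector b (c *s a) = c * covector b a"
  and covector_minus: "covector (- a) b = - covector a b" "covector b (- a) = - covector b a"
  and covector_diff: "covector (a - a') b = covector a b - covector a' b"
    "covector b (a - a') = covector b a - covector b a'"
  by (simp_all add: covector_def sum.distrib sum_distrib_left sum_negf sum_subtractf algebra_simps)

lemma covector_commute: "covector a b = covector b a"
  by (simp add: covector_def mult.commute)

lemma herm_add: "herm (a + a') b = herm a b + herm a' b" "herm b (a + a') = herm b a + herm b a'"
  and herm_scale: "herm (c *s a) b = c * herm a b" "herm b (c *s a) = cnj c * herm b a"
  and herm_minus: "herm (- a) b = - herm a b" "herm b (- a) = - herm b a"
  and herm_diff: "herm (a - a') b = herm a b - herm a' b" "herm b (a - a') = herm b a - herm b a'"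
  by (simp_all add: herm_def sum.distrib sum_distrib_left sum_negf sum_subtractf algebra_simps)

lemma cnj_herm: "cnj (herm a b) = herm b a"
  by (simp add: herm_def mult.commute)

lemma herm_self: "herm a a = of_real (nsq a)"
  by (simp add: herm_def nsq_def complex_norm_square del: of_real_power)

lemma herm_cvec: "herm a (cvec b) = covector a b" "herm (cvec a) b = cnj (covector a b)"
  "covector a (cvec b) = herm a b"
  by (simp_all add: herm_def covector_def)

lemma nsq_nonneg [simp]: "nsq a \<ge> 0"
  by (simp add: nsq_def sum_nonneg)

lemma nsq_pos: "a $ i \<noteq> 0 \<Longrightarrow> nsq a > 0"
  unfolding nsq_def by (rule sum_pos2[of _ i]) auto

lemma nsq_eq_0: "nsq a = 0 \<longleftrightarrow> a = 0"
  by (auto simp: nsq_def sum_nonneg_eq_0_iff vec_eq_iff)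

definition pvec :: "('n::finite) coords \<Rightarrow> 'n cvec" where
  "pvec x = snoc (fst x) 1"

text \<open>The last entry is forced by p . q = s once the last entry of p is 1.\<close>

definition qvec :: "complex \<Rightarrow> ('n::finite) coords \<Rightarrow> 'n cvec" where
  "qvec s x = snoc (snd x) (s - covector (snd x) (fst x))"

definition dpvec :: "('n::finite) coords \<Rightarrow> 'n cvec" where
  "dpvec v = snoc (fst v) 0"

definition dqvec :: "('n::finite) coords \<Rightarrow> 'n coords \<Rightarrow> 'n cvec" where
  "dqvec x v = snoc (snd v) (- covector (snd v) (fst x) - covector (snd x) (fst v))"

lemma covector_pq: "covector (pvec x) (qvec s x) = s"
  by (simp add: pvec_def qvec_def covector_snoc covector_commute)

lemma covector_tangent: "covector (qvec s x) (dpvec v) + covector (pvec x) (dqvec x v) = 0"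
  by (simp add: pvec_def qvec_def dpvec_def dqvec_def covector_snoc covector_commute)

lemma nsq_pvec_pos: "nsq (pvec x) > 0"
  by (rule nsq_pos[of _ None]) (simp add: pvec_def)

lemma nsq_qvec_pos: "s \<noteq> 0 \<Longrightarrow> nsq (qvec s x) > 0"
  using covector_pq[of x s] nsq_eq_0[of "qvec s x"] nsq_nonneg[of "qvec s x"]
  by (cases "qvec s x = 0") (auto simp: covector_def less_le)

definition cscale :: "complex \<Rightarrow> ('n::finite) coords \<Rightarrow> 'n coords" where
  "cscale c v = (c *s fst v, c *s snd v)"

lemma mult_i_eq: "mult_i v = cscale \<i> v"
  by (simp add: mult_i_def cscale_def)

lemma scaleR_eq_cscale: "r *\<^sub>R v = cscale (of_real r) v"
  by (auto simp: cscale_def prod_eq_iff vec_eq_iff) (simp_all add: scaleR_conv_of_real)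

lemma dpvec_simps: "dpvec (v + w) = dpvec v + dpvec w" "dpvec (cscale c v) = c *s dpvec v"
  by (auto simp: dpvec_def cscale_def vec_eq_iff snoc_def split: option.splits)

lemma dqvec_simps: "dqvec x (v + w) = dqvec x v + dqvec x w" "dqvec x (cscale c v) = c *s dqvec x v"
  by (auto simp: dqvec_def cscale_def vec_eq_iff snoc_def covector_add covector_scale algebra_simps
      split: option.splits)

text \<open>\<open>Z\<close> is the quotient of \<open>{(p, q). p \<bullet> q = s}\<close> by the action \<open>(c p, c\<^sup>-\<^sup>1 q)\<close> of \<open>\<complex>\<^sup>*\<close>, and the
  coordinates \<open>(z, \<xi>)\<close> are those of the slice on which the last entry of \<open>p\<close> is 1.  The pair
  \<open>(hor_p, hor_q)\<close> is the lift of a tangent vector that is orthogonal to the orbits, for the metric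
  rescaled so that \<open>p\<close> and \<open>q\<close> have equal length; \<open>mom\<close> is the square of the scaling factor, and
  \<open>log_p\<close>, \<open>log_q\<close> are \<open>\<partial> log \<parallel>p\<parallel>\<^sup>2\<close>, \<open>\<partial> log \<parallel>q\<parallel>\<^sup>2\<close>.\<close>

definition mom :: "complex \<Rightarrow> ('n::finite) coords \<Rightarrow> real" where
  "mom s x = sqrt (nsq (qvec s x) / nsq (pvec x))"

definition log_p :: "('n::finite) coords \<Rightarrow> 'n coords \<Rightarrow> complex" where
  "log_p x v = herm (dpvec v) (pvec x) / of_real (nsq (pvec x))"

definition log_q :: "complex \<Rightarrow> ('n::finite) coords \<Rightarrow> 'n coords \<Rightarrow> complex" where
  "log_q s x v = herm (dqvec x v) (qvec s x) / of_real (nsq (qvec s x))"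

definition shift :: "complex \<Rightarrow> ('n::finite) coords \<Rightarrow> 'n coords \<Rightarrow> complex" where
  "shift s x v = (log_q s x v - log_p x v) / 2"

definition hor_p :: "complex \<Rightarrow> ('n::finite) coords \<Rightarrow> 'n coords \<Rightarrow> 'n cvec" where
  "hor_p s x v = dpvec v + shift s x v *s pvec x"

definition hor_q :: "complex \<Rightarrow> ('n::finite) coords \<Rightarrow> 'n coords \<Rightarrow> 'n cvec" where
  "hor_q s x v = dqvec x v - shift s x v *s qvec s x"

text \<open>Projection back to the slice: the multiple \<open>a $ None\<close> of the orbit
  direction (p, -q) is subtracted, which makes the last entry of the p-part 0.\<close>

definition hor_inv :: "('n::finite) coords \<Rightarrow> 'n cvec \<Rightarrow> 'n cvec \<Rightarrow> 'n coords" where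
  "hor_inv x a b = (\<chi> k. a $ Some k - a $ None * fst x $ k, \<chi> k. b $ Some k + a $ None * snd x $ k)"

text \<open>The first equation is tangency to p . q = s. The second is orthogonality to (p, -q) in
  the rescaled metric, m herm a p = herm b q / m, with denominators cleared by m^2 = |q|^2 /
  |p|^2.\<close>

definition horizontal :: "complex \<Rightarrow> ('n::finite) coords \<Rightarrow> 'n cvec \<Rightarrow> 'n cvec \<Rightarrow> bool" where
  "horizontal s x a b \<longleftrightarrow> covector (qvec s x) a + covector (pvec x) b = 0 \<and>
     of_real (nsq (qvec s x)) * herm a (pvec x) = of_real (nsq (pvec x)) * herm b (qvec s x)"

text \<open>The flat Hermitian form evaluated on the lifts (c a, b / c) at the normalised pair,
  where |c|^2 = \<open>mom\<close>.\<close>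

definition H_form :: "complex \<Rightarrow> ('n::finite) coords \<Rightarrow> 'n coords \<Rightarrow> 'n coords \<Rightarrow> complex" where
  "H_form s x v w = of_real (mom s x) * herm (hor_p s x v) (hor_p s x w) +
     herm (hor_q s x v) (hor_q s x w) / of_real (mom s x)"

text \<open>The arguments are swapped so that the value at (v, i v) is + Re of \<open>H_form\<close>
  at (v, v).\<close>

definition W_form :: "complex \<Rightarrow> ('n::finite) coords \<Rightarrow> 'n coords \<Rightarrow> 'n coords \<Rightarrow> real" where
  "W_form s x v w = Im (H_form s x w v)"

text \<open>The flat structure (a, b) to (- cnj b, cnj a), conjugated by the rescaling (c a, b / c)
  with |c|^2 = \<open>mom\<close>.\<close>

definition J_op :: "complex \<Rightarrow> ('n::finite) coords \<Rightarrow> 'n coords \<Rightarrow> 'n coords" where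
  "J_op s x v = hor_inv x ((- of_real (1 / mom s x)) *s cvec (hor_q s x v)) (of_real (mom s x) *s cvec (hor_p s x v))"

lemma log_simps: "log_p x (v + w) = log_p x v + log_p x w" "log_p x (cscale c v) = c * log_p x v"
  "log_q s x (v + w) = log_q s x v + log_q s x w" "log_q s x (cscale c v) = c * log_q s x v"
  by (simp_all add: log_p_def log_q_def dpvec_simps dqvec_simps herm_add herm_scale add_divide_distrib)

lemma shift_simps: "shift s x (v + w) = shift s x v + shift s x w" "shift s x (cscale c v) = c * shift s x v"
  by (simp_all add: shift_def log_simps field_simps)

lemma hor_simps: "hor_p s x (v + w) = hor_p s x v + hor_p s x w" "hor_p s x (cscale c v) = c *s hor_p s x v"
  "hor_q s x (v + w) = hor_q s x v + hor_q s x w" "hor_q s x (cscale c v) = c *s hor_q s x v"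
  by (simp_all add: hor_p_def hor_q_def shift_simps dpvec_simps dqvec_simps vec_eq_iff algebra_simps)

lemma hor_inv_hor: "hor_inv x (hor_p s x v) (hor_q s x v) = v"
  by (simp add: hor_inv_def hor_p_def hor_q_def dpvec_def dqvec_def pvec_def qvec_def prod_eq_iff vec_eq_iff)

lemma mom_pos: "s \<noteq> 0 \<Longrightarrow> mom s x > 0"
  by (simp add: mom_def nsq_pvec_pos nsq_qvec_pos)

lemma mom_square: "s \<noteq> 0 \<Longrightarrow> mom s x * mom s x * nsq (pvec x) = nsq (qvec s x)"
  using nsq_pvec_pos[of x] nsq_qvec_pos[of s x]
  by (simp add: mom_def real_sqrt_mult_self abs_of_pos)

section \<open>Quaternionic structure on the horizontal vectors\<close>

lemma horizontal_hor:
  assumes "s \<noteq> 0"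
  shows "horizontal s x (hor_p s x v) (hor_q s x v)"
proof -
  have "covector (qvec s x) (hor_p s x v) + covector (pvec x) (hor_q s x v) =
      covector (qvec s x) (dpvec v) + covector (pvec x) (dqvec x v)"
    by (simp add: hor_p_def hor_q_def covector_add covector_diff covector_scale covector_commute[of "qvec s x" "pvec x"])
  moreover have "of_real (nsq (qvec s x)) * herm (hor_p s x v) (pvec x) =
      of_real (nsq (pvec x)) * herm (hor_q s x v) (qvec s x)"
    using nsq_pvec_pos[of x] nsq_qvec_pos[OF assms, of x]
    by (simp add: hor_p_def hor_q_def herm_add herm_diff herm_scale herm_self
        shift_def log_p_def log_q_def field_simps)
  ultimately show ?thesis
    by (simp add: horizontal_def covector_tangent)
qed

text \<open>The vector (a, b) and the slice vector of its projection differ by a multiple of (p,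
  -q), and orthogonality identifies that multiple with \<open>shift\<close>. The last entry of
  \<open>dqvec\<close> is recovered from tangency, as all its other entries are known and p ends in
  1.\<close>

lemma hor_hor_inv:
  assumes s: "s \<noteq> 0" and hor: "horizontal s x a b"
  shows "hor_p s x (hor_inv x a b) = a" and "hor_q s x (hor_inv x a b) = b"
proof -
  let ?v = "hor_inv x a b"
  have p: "dpvec ?v = a - a $ None *s pvec x"
    by (auto simp: vec_eq_iff dpvec_def pvec_def snoc_def hor_inv_def split: option.splits)
  have q_Some: "dqvec x ?v $ Some k = (b + a $ None *s qvec s x) $ Some k" for k
    by (simp add: dqvec_def qvec_def hor_inv_def)
  have "covector (pvec x) (dqvec x ?v) = - covector (qvec s x) (a - a $ None *s pvec x)"
    using covector_tangent[of s x ?v] by (simp add: p eq_neg_iff_add_eq_0 add.commute)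
  also have "\<dots> = covector (pvec x) (b + a $ None *s qvec s x)"
    using hor by (simp add: horizontal_def covector_add covector_diff covector_scale
        covector_commute[of "qvec s x" "pvec x"] add_eq_0_iff)
  finally have "dqvec x ?v $ None = (b + a $ None *s qvec s x) $ None"
    unfolding covector_def sum_option q_Some by (simp add: pvec_def)
  with q_Some have q: "dqvec x ?v = b + a $ None *s qvec s x"
    unfolding vec_eq_iff by (metis option.exhaust)
  have "herm a (pvec x) / of_real (nsq (pvec x)) = herm b (qvec s x) / of_real (nsq (qvec s x))"
    using hor nsq_pvec_pos[of x] nsq_qvec_pos[OF s, of x] by (simp add: horizontal_def field_simps)
  then have "shift s x ?v = a $ None"
    using nsq_pvec_pos[of x] nsq_qvec_pos[OF s, of x]
    by (simp add: shift_def log_p_def log_q_def p q herm_add herm_diff herm_scale herm_self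
        add_divide_distrib diff_divide_distrib)
  then show "hor_p s x ?v = a" "hor_q s x ?v = b"
    by (simp_all add: hor_p_def hor_q_def p q)
qed

text \<open>Conjugation turns the tangency of (a, b) into the orthogonality of its image and the
  orthogonality into the tangency, so the horizontal space is stable under the flat J.\<close>

lemma horizontal_conj:
  assumes s: "s \<noteq> 0" and hor: "horizontal s x a b"
  shows "horizontal s x ((- of_real (1 / mom s x)) *s cvec b) (of_real (mom s x) *s cvec a)"
proof -
  define m where "m = (of_real (mom s x) :: complex)"
  define P where "P = (of_real (nsq (pvec x)) :: complex)"
  define Q where "Q = (of_real (nsq (qvec s x)) :: complex)"
  have m0: "m \<noteq> 0" "P \<noteq> 0"
    using mom_pos[OF s, of x] nsq_pvec_pos[of x] by (simp_all add: m_def P_def)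
  have mm: "m * m * P = Q"
    unfolding m_def P_def Q_def mom_square[OF s, symmetric] by simp
  have hq: "herm b (qvec s x) = m * m * herm a (pvec x)"
    using hor m0 by (simp add: horizontal_def P_def[symmetric] Q_def[symmetric] mm[symmetric] mult.assoc)
  have cp: "covector b (pvec x) = - covector a (qvec s x)"
    using hor by (simp add: horizontal_def covector_commute[of b] covector_commute[of a] add_eq_0_iff)
  have hq': "herm (qvec s x) b = m * m * herm (pvec x) a"
    using arg_cong[OF hq, of cnj] by (simp add: cnj_herm m_def)
  show ?thesis
    unfolding horizontal_def m_def[symmetric] P_def[symmetric] Q_def[symmetric] covector_scale herm_scale
      herm_cvec of_real_divide of_real_1 hq' cp mm[symmetric]
    using m0 by (simp add: field_simps)
qed

lemma hor_J:
  assumes s: "s \<noteq> 0"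
  shows "hor_p s x (J_op s x v) = (- of_real (1 / mom s x)) *s cvec (hor_q s x v)"
    and "hor_q s x (J_op s x v) = of_real (mom s x) *s cvec (hor_p s x v)"
  unfolding J_op_def by (rule hor_hor_inv[OF s horizontal_conj[OF s horizontal_hor[OF s]]])+

lemma hor_eqI:
  "hor_p s x v = hor_p s x w \<Longrightarrow> hor_q s x v = hor_q s x w \<Longrightarrow> v = w"
  by (metis hor_inv_hor)

text \<open>The form is the restriction of the flat dp ^ dq, and on vectors tangent to p . q = s the
  orbit direction (p, -q) lies in its kernel, so lifting changes nothing.\<close>

lemma omega_plus_hor:
  "omega_plus v w = covector (hor_p s x v) (hor_q s x w) - covector (hor_p s x w) (hor_q s x v)"
proof -
  have eq: "omega_plus v w = covector (dpvec v) (dqvec x w) - covector (dpvec w) (dqvec x v)"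
    by (simp add: omega_plus_def dpvec_def dqvec_def covector_snoc) (simp add: covector_def sum_subtractf)
  have t: "covector (pvec x) (dqvec x u) = - covector (dpvec u) (qvec s x)" for u
    using covector_tangent[of s x u] by (simp add: eq_neg_iff_add_eq_0 add.commute covector_commute)
  show ?thesis
    by (simp add: eq hor_p_def hor_q_def covector_add covector_diff covector_scale t covector_pq algebra_simps)
qed

lemma H_simps:
  "H_form s x (v + v') w = H_form s x v w + H_form s x v' w"
  "H_form s x (cscale c v) w = c * H_form s x v w"
  "H_form s x v (w + w') = H_form s x v w + H_form s x v w'"
  "H_form s x v (cscale c w) = cnj c * H_form s x v w"
  by (simp_all add: H_form_def hor_simps herm_add herm_scale add_divide_distrib algebra_simps)

lemma cnj_H: "cnj (H_form s x v w) = H_form s x w v"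
  by (simp add: H_form_def cnj_herm)

lemma H_self_pos:
  assumes "s \<noteq> 0" "v \<noteq> 0"
  shows "Re (H_form s x v v) > 0"
proof -
  have m: "mom s x > 0"
    by (rule mom_pos[OF assms(1)])
  have "nsq (hor_p s x v) > 0 \<or> nsq (hor_q s x v) > 0"
  proof (rule ccontr)
    assume "\<not> ?thesis"
    then have "hor_p s x v = 0" "hor_q s x v = 0"
      using nsq_nonneg[of "hor_p s x v"] nsq_nonneg[of "hor_q s x v"] by (auto simp flip: nsq_eq_0)
    then have "v = hor_inv x 0 0"
      using hor_inv_hor[of x s v] by simp
    then show False
      using assms(2) by (simp add: hor_inv_def vec_eq_iff prod_eq_iff)
  qed
  moreover have "Re (H_form s x v v) = mom s x * nsq (hor_p s x v) + nsq (hor_q s x v) / mom s x"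
    by (simp add: H_form_def herm_self flip: of_real_mult of_real_divide)
  ultimately show ?thesis
    using m by (auto intro: add_pos_nonneg add_nonneg_pos)
qed

lemma W_J:
  assumes "s \<noteq> 0"
  shows "W_form s x (J_op s x v) w = Im (omega_plus v w)"
  using mom_pos[OF assms, of x]
  by (simp add: W_form_def H_form_def hor_J[OF assms] herm_scale herm_minus herm_cvec omega_plus_hor[of v w s x]
      covector_commute[of _ "hor_q s x v"] covector_commute[of "hor_q s x w"])

lemma J_J: "s \<noteq> 0 \<Longrightarrow> J_op s x (J_op s x v) = - v"
proof -
  assume s: "s \<noteq> 0"
  have "- v = cscale (-1) v"
    by (simp add: cscale_def prod_eq_iff vec_eq_iff)
  then show ?thesis
    using mom_pos[OF s, of x]
    by (intro hor_eqI[of s x]) (simp_all add: hor_J[OF s] hor_simps vec_eq_iff)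
qed

lemma J_cscale: "s \<noteq> 0 \<Longrightarrow> J_op s x (cscale c v) = cscale (cnj c) (J_op s x v)"
  by (rule hor_eqI[of s x]) (simp_all add: hor_J hor_simps vec_eq_iff)

lemma J_add: "s \<noteq> 0 \<Longrightarrow> J_op s x (v + w) = J_op s x v + J_op s x w"
  by (rule hor_eqI[of s x]) (simp_all add: hor_J hor_simps vec_eq_iff algebra_simps)

text \<open>Pythagoras: the lift is the slice vector minus its component along (p, -q), whose
  rescaled squared length is m |p|^2 + |q|^2 / m = 2 m |p|^2.\<close>

lemma W_form_eq:
  assumes s: "s \<noteq> 0"
  shows "W_form s x v w = mom s x * Im (herm (dpvec w) (dpvec v)) + Im (herm (dqvec x w) (dqvec x v)) / mom s x
    - 2 * (mom s x * nsq (pvec x)) * Im (shift s x w * cnj (shift s x v))"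
proof -
  define m P Q where mPQ: "m = mom s x" "P = nsq (pvec x)" "Q = nsq (qvec s x)"
  have pos: "m > 0" "P > 0" "Q > 0"
    using mom_pos[OF s] nsq_pvec_pos nsq_qvec_pos[OF s] by (simp_all add: mPQ)
  have Q: "Q = m * m * P"
    using mom_square[OF s, of x] by (simp add: mPQ)
  have hp: "herm (dpvec u) (pvec x) = of_real P * log_p x u" "herm (pvec x) (dpvec u) = of_real P * cnj (log_p x u)" for u
    using pos cnj_herm[of "dpvec u" "pvec x"] by (auto simp: log_p_def mPQ)
  have hq: "herm (dqvec x u) (qvec s x) = of_real Q * log_q s x u" "herm (qvec s x) (dqvec x u) = of_real Q * cnj (log_q s x u)" for u
    using pos cnj_herm[of "dqvec x u" "qvec s x"] by (auto simp: log_q_def mPQ)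
  have lq: "log_q s x u = 2 * shift s x u + log_p x u" for u
    by (simp add: shift_def field_simps)
  have "H_form s x w v = of_real m * herm (dpvec w) (dpvec v) + herm (dqvec x w) (dqvec x v) / of_real m
    - 2 * of_real (m * P) * (shift s x w * cnj (shift s x v))"
    unfolding H_form_def hor_p_def hor_q_def herm_add herm_diff herm_scale hp hq herm_self mPQ[symmetric] lq
    using pos by (simp add: Q field_simps)
  then show ?thesis
    by (simp add: W_form_def mPQ)
qed

section \<open>The Kaehler form in a chart\<close>

lemma smooth_cnj: "smooth F \<Longrightarrow> smooth (\<lambda>x. cnj (F x))"
  by (rule smooth_linear[OF bounded_linear_cnj])

lemma smooth_Re: "smooth F \<Longrightarrow> smooth (\<lambda>x. Re (F x))"
  by (rule smooth_linear[OF bounded_linear_Re])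

lemma smooth_Im: "smooth F \<Longrightarrow> smooth (\<lambda>x. Im (F x))"
  by (rule smooth_linear[OF bounded_linear_Im])

lemma smooth_of_real: "smooth F \<Longrightarrow> smooth (\<lambda>x. complex_of_real (F x))"
  by (rule smooth_linear[OF bounded_linear_of_real])

lemma smooth_divide:
  fixes F G :: "_ \<Rightarrow> real"
  assumes "smooth F" "smooth G" "\<And>x. G x > 0"
  shows "smooth (\<lambda>x. F x / G x)"
proof -
  have "(\<lambda>x. F x / G x) = (\<lambda>x. F x * G x powr - 1)"
    using assms(3) by (simp add: fun_eq_iff powr_minus less_imp_le divide_inverse)
  moreover have "smooth (\<lambda>x. F x * G x powr - 1)"
    by (intro smooth_mult smooth_powr assms)
  ultimately show ?thesis
    by (simp only:)
qed

lemma smooth_sqrt: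
  fixes F :: "_ \<Rightarrow> real"
  assumes "smooth F" "\<And>x. F x > 0"
  shows "smooth (\<lambda>x. sqrt (F x))"
proof -
  have "(\<lambda>x. sqrt (F x)) = (\<lambda>x. F x powr (1 / 2))"
    using assms(2) by (simp add: fun_eq_iff powr_half_sqrt less_imp_le)
  moreover have "smooth (\<lambda>x. F x powr (1 / 2))"
    by (intro smooth_powr assms)
  ultimately show ?thesis
    by (simp only:)
qed

lemma smooth_nth: "smooth F \<Longrightarrow> smooth (\<lambda>x. F x $ i)"
  by (rule smooth_linear[OF bounded_linear_vec_nth])

lemma smooth_snoc: "smooth F \<Longrightarrow> smooth G \<Longrightarrow> smooth (\<lambda>x. snoc (F x) (G x))"
proof (rule smooth_vec)
  fix i
  assume "smooth F" "smooth G"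
  then show "smooth (\<lambda>x. snoc (F x) (G x) $ i)"
    by (cases i) (simp_all add: smooth_nth)
qed

lemma smooth_covector: "smooth F \<Longrightarrow> smooth G \<Longrightarrow> smooth (\<lambda>x. covector (F x) (G x))"
  unfolding covector_def by (intro smooth_sum smooth_mult smooth_nth)

lemma smooth_herm: "smooth F \<Longrightarrow> smooth G \<Longrightarrow> smooth (\<lambda>x. herm (F x) (G x))"
  unfolding herm_def by (intro smooth_sum smooth_mult smooth_cnj smooth_nth)

lemma smooth_nsq: "smooth F \<Longrightarrow> smooth (\<lambda>x. nsq (F x))"
  using smooth_Re[OF smooth_herm[of F F]] by (simp add: herm_self)

lemma smooth_scale: "smooth F \<Longrightarrow> smooth G \<Longrightarrow> smooth (\<lambda>x. F x *s G x)" for F :: "_ \<Rightarrow> complex"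
  by (rule smooth_vec) (simp add: smooth_mult smooth_nth)

lemma smooth_cvec: "smooth F \<Longrightarrow> smooth (\<lambda>x. cvec (F x))"
  by (rule smooth_vec) (simp add: smooth_cnj smooth_nth)

lemma smooth_fst: "smooth (\<lambda>x::('n::finite) coords. fst x)" and smooth_snd: "smooth (\<lambda>x::'n coords. snd x)"
  by (intro smooth_bounded_linear bounded_linear_fst bounded_linear_snd)+

lemmas smooth_intros = smooth_add smooth_diff smooth_minus smooth_mult smooth_cnj smooth_Re smooth_Im
  smooth_of_real smooth_covector smooth_herm smooth_nsq smooth_scale smooth_cvec smooth_snoc
  smooth_fst smooth_snd smooth_const

lemma smooth_pvec: "smooth (\<lambda>x. pvec x)" and smooth_qvec: "smooth (\<lambda>x. qvec s x)"
    and smooth_dqvec: "smooth (\<lambda>x. dqvec x v)"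
  unfolding pvec_def qvec_def dqvec_def by (intro smooth_intros)+

lemma smooth_mom: "s \<noteq> 0 \<Longrightarrow> smooth (\<lambda>x. mom s x)"
  unfolding mom_def
  by (intro smooth_sqrt smooth_divide smooth_nsq smooth_pvec smooth_qvec) (simp_all add: nsq_pvec_pos nsq_qvec_pos)

lemma complex_divide_of_real: "z / complex_of_real r = of_real (1 / r) * z"
  by simp

lemma smooth_log:
  assumes "s \<noteq> 0"
  shows "smooth (\<lambda>x. log_p x v)" "smooth (\<lambda>x. log_q s x v)"
  unfolding log_p_def log_q_def complex_divide_of_real
  by (intro smooth_intros smooth_divide smooth_pvec smooth_qvec smooth_dqvec nsq_pvec_pos
      nsq_qvec_pos assms)+

lemma smooth_shift: "s \<noteq> 0 \<Longrightarrow> smooth (\<lambda>x. shift s x v)"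
  using smooth_mult[OF smooth_const[of "1/2"] smooth_diff[OF smooth_log(2,1)]] by (simp add: shift_def)

lemma smooth_hor: "s \<noteq> 0 \<Longrightarrow> smooth (\<lambda>x. hor_p s x v)" "s \<noteq> 0 \<Longrightarrow> smooth (\<lambda>x. hor_q s x v)"
  unfolding hor_p_def hor_q_def
  by (intro smooth_intros smooth_pvec smooth_qvec smooth_dqvec smooth_shift; assumption)+

lemma smooth_W: "s \<noteq> 0 \<Longrightarrow> smooth (\<lambda>x. W_form s x v w)"
  unfolding W_form_def H_form_def complex_divide_of_real
  by (intro smooth_intros smooth_hor smooth_mom smooth_divide mom_pos; assumption)

lemma smooth_J_op: "s \<noteq> 0 \<Longrightarrow> smooth (\<lambda>x. J_op s x v)"
  unfolding J_op_def hor_inv_def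
  by (intro smooth_Pair smooth_vec; simp only: vec_lambda_beta;
      intro smooth_intros smooth_hor smooth_mom smooth_divide mom_pos smooth_nth; assumption)

text \<open>\<open>f(\<tau>) theta0\<close> is the primitive \<open>\<i>/4 f(\<tau>) (\<partial>\<^sup>-\<tau> - \<partial>\<tau>)\<close> of \<open>\<omega>\<^sub>I\<close>.\<close>

definition theta0 :: "complex \<Rightarrow> ('n::finite) coords \<Rightarrow> 'n coords \<Rightarrow> real" where
  "theta0 s x u = (nsq (qvec s x) * Im (herm (dpvec u) (pvec x)) + nsq (pvec x) * Im (herm (dqvec x u) (qvec s x))) / 2"

definition tau_loc :: "complex \<Rightarrow> ('n::finite) coords \<Rightarrow> real" where
  "tau_loc s x = nsq (pvec x) * nsq (qvec s x)"

definition dtau :: "complex \<Rightarrow> ('n::finite) coords \<Rightarrow> 'n coords \<Rightarrow> real" where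
  "dtau s x v = 2 * (nsq (qvec s x) * Re (herm (dpvec v) (pvec x)) + nsq (pvec x) * Re (herm (dqvec x v) (qvec s x)))"

definition dtheta0 :: "complex \<Rightarrow> ('n::finite) coords \<Rightarrow> 'n coords \<Rightarrow> 'n coords \<Rightarrow> real" where
  "dtheta0 s x v w =
     Re (herm (dqvec x v) (qvec s x)) * Im (herm (dpvec w) (pvec x)) - Re (herm (dqvec x w) (qvec s x)) * Im (herm (dpvec v) (pvec x)) +
     Re (herm (dpvec v) (pvec x)) * Im (herm (dqvec x w) (qvec s x)) - Re (herm (dpvec w) (pvec x)) * Im (herm (dqvec x v) (qvec s x)) +
     nsq (qvec s x) * Im (herm (dpvec w) (dpvec v)) + nsq (pvec x) * Im (herm (dqvec x w) (dqvec x v))"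

lemma tau_loc_pos: "s \<noteq> 0 \<Longrightarrow> tau_loc s x > 0"
  by (simp add: tau_loc_def nsq_pvec_pos nsq_qvec_pos)

section \<open>Derivatives of the pair (p, q), of tau and of the primitive\<close>

lemma has_derivative_nth: "(F has_derivative F') net \<Longrightarrow> ((\<lambda>x. F x $ i) has_derivative (\<lambda>h. F' h $ i)) net"
  by (rule bounded_linear.has_derivative[OF bounded_linear_vec_nth])

lemma has_derivative_herm:
  assumes "(F has_derivative F') (at x)" "(G has_derivative G') (at x)"
  shows "((\<lambda>y. herm (F y) (G y)) has_derivative (\<lambda>h. herm (F x) (G' h) + herm (F' h) (G x))) (at x)"
  unfolding herm_def sum.distrib[symmetric]
  by (intro has_derivative_sum has_derivative_mult bounded_linear.has_derivative[OF bounded_linear_cnj]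
      has_derivative_nth assms)

lemma has_derivative_covector:
  assumes "(F has_derivative F') (at x)" "(G has_derivative G') (at x)"
  shows "((\<lambda>y. covector (F y) (G y)) has_derivative (\<lambda>h. covector (F x) (G' h) + covector (F' h) (G x))) (at x)"
  unfolding covector_def sum.distrib[symmetric]
  by (intro has_derivative_sum has_derivative_mult has_derivative_nth assms)

lemma has_derivative_snoc:
  assumes "(F has_derivative F') (at x)" "(G has_derivative G') (at x)"
  shows "((\<lambda>y. snoc (F y) (G y)) has_derivative (\<lambda>h. snoc (F' h) (G' h))) (at x)"
proof (rule has_derivative_vec)
  fix i
  show "((\<lambda>y. snoc (F y) (G y) $ i) has_derivative (\<lambda>h. snoc (F' h) (G' h) $ i)) (at x)"
    by (cases i) (simp_all add: has_derivative_nth assms)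
qed

lemma has_derivative_nsq:
  assumes "(F has_derivative F') (at x)"
  shows "((\<lambda>y. nsq (F y)) has_derivative (\<lambda>h. 2 * Re (herm (F' h) (F x)))) (at x)"
proof -
  have "Re (herm (F x) (F' h)) = Re (herm (F' h) (F x))" for h
    using arg_cong[OF cnj_herm[of "F x" "F' h"], of Re] by simp
  then show ?thesis
    using bounded_linear.has_derivative[OF bounded_linear_Re has_derivative_herm[OF assms assms]]
    by (simp add: herm_self)
qed

lemma has_derivative_fst': "((\<lambda>x. fst x) has_derivative (\<lambda>h. fst h)) (at x)"
  and has_derivative_snd': "((\<lambda>x. snd x) has_derivative (\<lambda>h. snd h)) (at x)"
  by (intro bounded_linear_imp_has_derivative bounded_linear_fst bounded_linear_snd)+

lemma has_derivative_pvec: "(pvec has_derivative dpvec) (at x)"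
  unfolding pvec_def[abs_def] dpvec_def[abs_def]
  by (intro has_derivative_snoc has_derivative_fst' has_derivative_const)

lemma has_derivative_qvec: "(qvec s has_derivative dqvec x) (at x)"
proof -
  have "((\<lambda>x. snoc (snd x) (s - covector (snd x) (fst x))) has_derivative
    (\<lambda>h. snoc (snd h) (0 - (covector (snd x) (fst h) + covector (snd h) (fst x))))) (at x)"
    by (intro has_derivative_snoc has_derivative_diff has_derivative_covector has_derivative_fst' has_derivative_snd' has_derivative_const)
  then show ?thesis
    by (simp add: qvec_def[abs_def] dqvec_def[abs_def] algebra_simps)
qed

text \<open>The second derivative of \<open>qvec\<close>, constant because q is quadratic in (z,
  \<xi>).\<close>

definition ddqvec :: "('n::finite) coords \<Rightarrow> 'n coords \<Rightarrow> 'n cvec" where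
  "ddqvec u v = snoc 0 (- (covector (snd u) (fst v) + covector (snd v) (fst u)))"

lemma ddqvec_sym: "ddqvec u v = ddqvec v u"
  by (simp add: ddqvec_def add.commute)

lemma covector_0 [simp]: "covector 0 a = 0" "covector a 0 = 0"
  by (simp_all add: covector_def)

lemma has_derivative_dqvec: "((\<lambda>y. dqvec y u) has_derivative ddqvec u) (at x)"
proof -
  have "((\<lambda>x. snoc (snd u) (- covector (snd u) (fst x) - covector (snd x) (fst u))) has_derivative
    (\<lambda>h. snoc 0 (- (covector (snd u) (fst h) + covector 0 (fst x)) - (covector (snd x) 0 + covector (snd h) (fst u))))) (at x)"
    by (intro has_derivative_snoc has_derivative_diff has_derivative_minus has_derivative_covector
        has_derivative_fst' has_derivative_snd' has_derivative_const)
  then show ?thesis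
    by (simp add: ddqvec_def[abs_def] dqvec_def[abs_def] algebra_simps)
qed

lemma has_derivative_tau_loc: "(tau_loc s has_derivative dtau s x) (at x)"
proof -
  have "((\<lambda>y. nsq (pvec y) * nsq (qvec s y)) has_derivative
    (\<lambda>h. nsq (pvec x) * (2 * Re (herm (dqvec x h) (qvec s x))) + 2 * Re (herm (dpvec h) (pvec x)) * nsq (qvec s x))) (at x)"
    by (intro has_derivative_mult has_derivative_nsq has_derivative_pvec has_derivative_qvec)
  then show ?thesis
    by (simp add: tau_loc_def[abs_def] dtau_def[abs_def] algebra_simps)
qed

lemma has_derivative_theta0:
  "((\<lambda>y. theta0 s y u) has_derivative (\<lambda>v.
     Re (herm (dqvec x v) (qvec s x)) * Im (herm (dpvec u) (pvec x)) +
     Re (herm (dpvec v) (pvec x)) * Im (herm (dqvec x u) (qvec s x)) +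
     (nsq (qvec s x) * Im (herm (dpvec u) (dpvec v)) + nsq (pvec x) *
       (Im (herm (dqvec x u) (dqvec x v)) + Im (herm (ddqvec u v) (qvec s x)))) / 2)) (at x)"
proof -
  have "((\<lambda>y. (nsq (qvec s y) * Im (herm (dpvec u) (pvec y)) + nsq (pvec y) * Im (herm (dqvec y u) (qvec s y))) / 2) has_derivative
    (\<lambda>v. ((nsq (qvec s x) * Im (herm (dpvec u) (dpvec v) + herm 0 (pvec x)) + 2 * Re (herm (dqvec x v) (qvec s x)) * Im (herm (dpvec u) (pvec x)))
       + (nsq (pvec x) * Im (herm (dqvec x u) (dqvec x v) + herm (ddqvec u v) (qvec s x))
         + 2 * Re (herm (dpvec v) (pvec x)) * Im (herm (dqvec x u) (qvec s x)))) / 2)) (at x)"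
    by (intro bounded_linear.has_derivative[OF bounded_linear_divide] has_derivative_add has_derivative_mult has_derivative_nsq
        bounded_linear.has_derivative[OF bounded_linear_Im] has_derivative_herm
        has_derivative_const has_derivative_pvec has_derivative_qvec has_derivative_dqvec)
  moreover have "herm 0 (pvec x) = 0"
    by (simp add: herm_def)
  ultimately show ?thesis
    by (simp add: theta0_def[abs_def] field_simps)
qed

text \<open>The Leibniz rule for f(tau) \<open>theta0\<close>. The second derivative of q enters
  symmetrically and cancels, so \<open>dtheta0\<close> contains only first derivatives of p and
  q.\<close>

lemma ext_deriv_theta:
  assumes "(f has_real_derivative f') (at (tau_loc s x))"
  shows "ext_deriv (\<lambda>y u. f (tau_loc s y) * theta0 s y u) x v w =
    f' * (dtau s x v * theta0 s x w - dtau s x w * theta0 s x v) + f (tau_loc s x) * dtheta0 s x v w"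
    and "(\<lambda>y. f (tau_loc s y) * theta0 s y u) differentiable (at x)"
proof -
  define T where "T u v =
     Re (herm (dqvec x v) (qvec s x)) * Im (herm (dpvec u) (pvec x)) +
     Re (herm (dpvec v) (pvec x)) * Im (herm (dqvec x u) (qvec s x)) +
     (nsq (qvec s x) * Im (herm (dpvec u) (dpvec v)) + nsq (pvec x) *
       (Im (herm (dqvec x u) (dqvec x v)) + Im (herm (ddqvec u v) (qvec s x)))) / 2" for u v
  have f: "((\<lambda>y. f (tau_loc s y)) has_derivative (\<lambda>v. f' * dtau s x v)) (at x)"
    using has_derivative_compose[OF has_derivative_tau_loc assms[unfolded has_field_derivative_def]]
    by simp
  have D: "((\<lambda>y. f (tau_loc s y) * theta0 s y u) has_derivative
      (\<lambda>v. f (tau_loc s x) * T u v + f' * dtau s x v * theta0 s x u)) (at x)" for u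
    unfolding T_def by (rule has_derivative_mult[OF f has_derivative_theta0])
  show "(\<lambda>y. f (tau_loc s y) * theta0 s y u) differentiable (at x)"
    using D by (rule differentiableI)
  have skew: "Im (herm a b) = - Im (herm b a)" for a b :: "'a cvec"
    using arg_cong[OF cnj_herm[of a b], of Im] by simp
  have "T w v - T v w = dtheta0 s x v w"
    unfolding T_def dtheta0_def ddqvec_sym[of v w] skew[of "dpvec v" "dpvec w"]
      skew[of "dqvec x v" "dqvec x w"] by (simp add: field_simps)
  then show "ext_deriv (\<lambda>y u. f (tau_loc s y) * theta0 s y u) x v w =
    f' * (dtau s x v * theta0 s x w - dtau s x w * theta0 s x v) + f (tau_loc s x) * dtheta0 s x v w"
    unfolding ext_deriv_def frechet_derivative_at[OF D, symmetric] by (simp add: algebra_simps flip: \<open>T w v - T v w = dtheta0 s x v w\<close>)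
qed

definition theta :: "complex \<Rightarrow> ('n::finite) coords \<Rightarrow> 'n coords \<Rightarrow> real" where
  "theta s x u = tau_loc s x powr (-1/2) * theta0 s x u"

lemma smooth_theta: "s \<noteq> 0 \<Longrightarrow> smooth (\<lambda>x. theta s x u)"
  unfolding theta_def theta0_def tau_loc_def
  by (intro smooth_intros smooth_powr smooth_divide smooth_pvec smooth_qvec smooth_dqvec)
   (simp_all add: nsq_pvec_pos nsq_qvec_pos)

text \<open>This is the identification of the quotient Kaehler form with the one of potential
  sqrt(tau). Written in terms of \<open>log_p\<close>, \<open>shift\<close>, the weight m and r =
  sqrt(tau), both sides are rational and can be compared directly.\<close>

lemma W_form_ext_deriv:
  assumes s: "s \<noteq> 0"
  shows "W_form s x v w = ext_deriv (theta s) x v w"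
proof -
  define m P Q where mPQ: "m = mom s x" "P = nsq (pvec x)" "Q = nsq (qvec s x)"
  have pos: "m > 0" "P > 0" "Q > 0"
    using mom_pos[OF s] nsq_pvec_pos nsq_qvec_pos[OF s] by (simp_all add: mPQ)
  have Q: "Q = m * m * P"
    using mom_square[OF s, of x] by (simp add: mPQ)
  \<comment> \<open>r is sqrt(tau), because tau = P Q = m^2 P^2.\<close>
  define r where "r = m * P"
  have r: "r > 0" "tau_loc s x = r\<^sup>2"
    using pos by (simp_all add: r_def tau_loc_def mPQ[symmetric] Q power2_eq_square)
  have hp: "herm (dpvec u) (pvec x) = of_real P * log_p x u" for u
    using pos by (auto simp: log_p_def mPQ)
  have hq: "herm (dqvec x u) (qvec s x) = of_real Q * log_q s x u" for u
    using pos by (auto simp: log_q_def mPQ)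
  have lq: "log_q s x u = 2 * shift s x u + log_p x u" for u
    by (simp add: shift_def field_simps)
  have p1: "(r\<^sup>2) powr (-1/2) = 1 / r"
    using r(1) powr_minus[of "r\<^sup>2" "1/2"] by (simp add: powr_half_sqrt inverse_eq_divide)
  have p3: "(r\<^sup>2) powr (-1/2 - 1) = 1 / r ^ 3"
    using r(1) by (simp only: powr_diff p1) (simp add: power2_eq_square power3_eq_cube)
  have D: "((\<lambda>t. t powr (-1/2)) has_real_derivative (-1/2) * (r\<^sup>2) powr (-1/2 - 1)) (at (tau_loc s x))"
    unfolding r(2) by (rule has_real_derivative_powr) (use r(1) in simp)
  have E: "ext_deriv (theta s) x v w = (-1/2) * (1 / r ^ 3) * (dtau s x v * theta0 s x w - dtau s x w * theta0 s x v)
      + 1 / r * dtheta0 s x v w"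
    using ext_deriv_theta(1)[OF D, of v w] unfolding theta_def[abs_def] p3 r(2) p1 by simp
  have QP: "Q * P = r\<^sup>2" "P * Q = r\<^sup>2" "Q = m * r" "P = r / m"
    using pos by (simp_all add: Q r_def power2_eq_square)
  have dt: "dtau s x u = 2 * r\<^sup>2 * (Re (log_p x u) + Re (log_q s x u))" for u
    by (simp add: dtau_def hp hq mPQ[symmetric] algebra_simps QP(1,2)[symmetric])
  have th: "theta0 s x u = r\<^sup>2 * (Im (log_p x u) + Im (log_q s x u)) / 2" for u
    by (simp add: theta0_def hp hq mPQ[symmetric] algebra_simps QP(1,2)[symmetric])
  have dth: "dtheta0 s x v w = r\<^sup>2 * (Re (log_q s x v) * Im (log_p x w) - Re (log_q s x w) * Im (log_p x v) +
      Re (log_p x v) * Im (log_q s x w) - Re (log_p x w) * Im (log_q s x v)) +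
      m * r * Im (herm (dpvec w) (dpvec v)) + r / m * Im (herm (dqvec x w) (dqvec x v))"
    unfolding QP(3,4)[symmetric]
    by (simp add: dtheta0_def hp hq mPQ[symmetric] algebra_simps QP(1,2)[symmetric])
  show ?thesis
    unfolding E W_form_eq[OF s] mPQ[symmetric] r_def[symmetric] dt th dth lq
    using r(1) pos(1) by (simp add: field_simps power3_eq_cube power2_eq_square)
qed

text \<open>The form is exact, so the cyclic sum vanishes by symmetry of the second derivatives of
  \<open>theta\<close>.\<close>

lemma W_closed:
  assumes s: "s \<noteq> 0"
  shows "frechet_derivative (\<lambda>y. W_form s y v w) (at x) u +
      frechet_derivative (\<lambda>y. W_form s y w u) (at x) v +
      frechet_derivative (\<lambda>y. W_form s y u v) (at x) w = 0"
proof -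
  define D2 where "D2 u v w = frechet_derivative (\<lambda>y. frechet_derivative (\<lambda>y. theta s y w) (at y) v) (at x) u" for u v w
  have D: "((\<lambda>y. W_form s y v w) has_derivative (\<lambda>u. D2 u v w - D2 u w v)) (at x)" for v w
    unfolding W_form_ext_deriv[OF s] ext_deriv_def D2_def
    by (intro has_derivative_diff smooth_has_derivative smooth_frechet_derivative smooth_theta s)
  have "D2 u v w = D2 v u w" for u v w
    unfolding D2_def by (rule second_derivative_symmetric[OF smooth_theta[OF s]])
  then show ?thesis
    unfolding frechet_derivative_at[OF D, symmetric] by (smt (verit))
qed

section \<open>A chart of Z as an instance of the abstract quaternionic chart\<close>

lemma cscale_cscale: "cscale c (cscale d v) = cscale (c * d) v"
  by (simp add: cscale_def vec_eq_iff prod_eq_iff)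

lemma minus_eq_cscale: "- v = cscale (-1) v"
  by (simp add: cscale_def vec_eq_iff prod_eq_iff)

lemma cscale_add: "cscale c (v + w) = cscale c v + cscale c w"
  by (simp add: cscale_def vec_eq_iff prod_eq_iff algebra_simps)

lemma omega_plus_simps:
  "omega_plus (v + v') w = omega_plus v w + omega_plus v' w"
  "omega_plus v (w + w') = omega_plus v w + omega_plus v w'"
  "omega_plus (cscale c v) w = c * omega_plus v w" "omega_plus v (cscale c w) = c * omega_plus v w"
  by (simp_all add: omega_plus_def cscale_def sum.distrib sum_distrib_left sum_subtractf algebra_simps)

lemma omega_plus_alternating: "omega_plus w v = - omega_plus v w"
  by (simp add: omega_plus_def sum_subtractf)

lemma W_bilinear: "bilinear (W_form s x)"
  unfolding bilinear_def
  by (intro conjI allI linearI; simp add: W_form_def H_simps scaleR_eq_cscale[of _ v for v :: "'a coords"])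

lemma W_alternating: "W_form s x w v = - W_form s x v w"
  using arg_cong[OF cnj_H[of s x v w], of Im] by (simp add: W_form_def)

lemma W_mult_i: "W_form s x (mult_i v) (mult_i w) = W_form s x v w"
  by (simp add: W_form_def mult_i_eq H_simps)

lemma W_positive: "s \<noteq> 0 \<Longrightarrow> v \<noteq> 0 \<Longrightarrow> W_form s x v (mult_i v) > 0"
  using H_self_pos by (simp add: W_form_def mult_i_eq H_simps)

lemma quaternionic_chart_W:
  assumes s: "s \<noteq> 0"
  shows "quaternionic_chart (W_form s) mult_i (J_op s)
    (\<lambda>v w. Re (omega_plus v w)) (\<lambda>v w. Im (omega_plus v (w :: ('n::finite) coords)))"
proof (rule quaternionic_chart.intro)
  show "frechet_derivative (\<lambda>y. W_form s y v w) (at x) u +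
      frechet_derivative (\<lambda>y. W_form s y w u) (at x) v +
      frechet_derivative (\<lambda>y. W_form s y u v) (at x) w = 0" for x u v w :: "'n coords"
    by (rule W_closed[OF s])
  show "linear (mult_i :: 'n coords \<Rightarrow> _)"
    by (rule linearI) (simp_all add: mult_i_eq scaleR_eq_cscale[of _ v for v :: "'n coords"] cscale_add cscale_cscale mult.commute)
  show "bilinear (\<lambda>v w :: 'n coords. Im (omega_plus v w))"
    unfolding bilinear_def
    by (intro conjI allI linearI; simp add: omega_plus_simps scaleR_eq_cscale[of _ v for v :: "'n coords"])
  show "linear (J_op s x)" for x :: "'n coords"
    by (rule linearI) (simp_all add: J_add J_cscale s scaleR_eq_cscale[of _ v for v :: "'n coords"])
  show "Im (omega_plus (J_op s x v) w) = - W_form s x v w" for x v w :: "'n coords"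
    using W_J[OF s, of x "J_op s x v" w] W_bilinear[of s x] by (simp add: J_J[OF s] bilinear_lneg)
  show "W_form s x w v = - W_form s x v w" for x v w :: "'n coords"
    by (rule W_alternating)
  show "Im (omega_plus w v) = - Im (omega_plus v w)" for v w :: "'n coords"
    by (subst omega_plus_alternating) simp
  show "mult_i (mult_i v) = - v" for v :: "'n coords"
    by (simp add: mult_i_eq cscale_cscale minus_eq_cscale[of v])
  show "J_op s x (mult_i v) = - mult_i (J_op s x v)" for x v :: "'n coords"
    by (simp add: mult_i_eq J_cscale s minus_eq_cscale[of "cscale \<i> (J_op s x v)"] cscale_cscale)
qed (simp_all add: W_bilinear smooth_W s W_mult_i[unfolded mult_i_eq] W_positive[unfolded mult_i_eq] smooth_J_op J_J
    omega_plus_simps mult_i_eq)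

section \<open>Changes of coordinates\<close>

declare transpose_matrix_vector [simp del]

text \<open>Reality of the entries makes the same matrix preserve both \<open>covector\<close> and
  \<open>herm\<close>.\<close>

definition orth :: "('n::finite) cmat \<Rightarrow> bool" where
  "orth M \<longleftrightarrow> M ** transpose M = mat 1 \<and> transpose M ** M = mat 1 \<and> (\<forall>i j. cnj (M $ i $ j) = M $ i $ j)"

lemma orth_transpose: "orth M \<Longrightarrow> orth (transpose M)"
  by (auto simp: orth_def transpose_def)

lemma orth_mult: "orth M \<Longrightarrow> orth N \<Longrightarrow> orth (M ** N)"
  unfolding orth_def matrix_transpose_mul
proof (intro conjI allI; elim conjE)
  assume *: "M ** transpose M = mat 1" "N ** transpose N = mat 1"
    "transpose M ** M = mat 1" "transpose N ** N = mat 1"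
  have "(M ** N) ** (transpose N ** transpose M) = M ** (N ** transpose N) ** transpose M"
    by (simp only: matrix_mul_assoc)
  then show "(M ** N) ** (transpose N ** transpose M) = mat 1"
    by (simp add: *)
  have "(transpose N ** transpose M) ** (M ** N) = transpose N ** (transpose M ** M) ** N"
    by (simp only: matrix_mul_assoc)
  then show "(transpose N ** transpose M) ** (M ** N) = mat 1"
    by (simp add: *)
qed (simp add: matrix_matrix_mult_def)

lemma orth_cancel: "orth M \<Longrightarrow> transpose M *v (M *v a) = a" "orth M \<Longrightarrow> M *v (transpose M *v a) = a"
  by (simp_all add: orth_def matrix_vector_mul_assoc)

lemma covector_transpose: "covector (M *v a) b = covector a (transpose M *v b)"
  unfolding covector_def matrix_vector_mult_def transpose_def
  by (simp add: sum_distrib_left sum_distrib_right) (subst sum.swap, simp add: mult_ac)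

lemma covector_orth: "orth M \<Longrightarrow> covector (M *v a) (M *v b) = covector a b"
  by (simp add: covector_transpose orth_cancel)

lemma cvec_orth: "orth M \<Longrightarrow> cvec (M *v a) = M *v cvec a"
  by (simp add: vec_eq_iff matrix_vector_mult_def orth_def)

lemma herm_orth: "orth M \<Longrightarrow> herm (M *v a) (M *v b) = herm a b"
  by (simp flip: herm_cvec(3) add: cvec_orth covector_orth)

lemma nsq_orth: "orth M \<Longrightarrow> nsq (M *v a) = nsq a"
  using herm_orth[of M a a] by (simp add: herm_self)

text \<open>The pair at y is the image under M of the pair at x, moved along its orbit by d; the two
  coordinate vectors then describe one point of Z.\<close>

definition linked :: "('n::finite) cmat \<Rightarrow> complex \<Rightarrow> 'n coords \<Rightarrow> 'n coords \<Rightarrow> complex \<Rightarrow> bool" where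
  "linked M s x y d \<longleftrightarrow> d \<noteq> 0 \<and> pvec y = d *s (M *v pvec x) \<and> d *s qvec s y = M *v qvec s x"

text \<open>The derivative of both equations of \<open>linked\<close> in direction v, with d' the
  derivative of the multiplier d.\<close>

definition dlinked :: "('n::finite) cmat \<Rightarrow> complex \<Rightarrow> 'n coords \<Rightarrow> 'n coords \<Rightarrow> complex \<Rightarrow>
    'n coords \<Rightarrow> 'n coords \<Rightarrow> complex \<Rightarrow> bool" where
  "dlinked M s x y d v v' d' \<longleftrightarrow> dpvec v' = d *s (M *v dpvec v) + d' *s (M *v pvec x) \<and>
     d *s dqvec y v' + d' *s qvec s y = M *v dqvec x v"

lemma scale_cancel: "d \<noteq> 0 \<Longrightarrow> d *s a = b \<Longrightarrow> a = (1 / d) *s b" for d :: complex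
  by (auto simp: vec_eq_iff field_simps)

lemma herm_scaled: "herm (c *s a) (c *s b) = of_real ((cmod c)\<^sup>2) * herm a b"
  by (simp only: herm_scale mult.assoc[symmetric] complex_norm_square mult.commute[of "cnj c"])

lemma nsq_scale: "nsq (c *s a) = (cmod c)\<^sup>2 * nsq a"
  using herm_scaled[of c a a] by (simp only: herm_self of_real_mult[symmetric] of_real_eq_iff)

lemma linked_mom:
  assumes "orth M" and l: "linked M s x y d"
  shows "nsq (pvec y) = (cmod d)\<^sup>2 * nsq (pvec x)" "nsq (qvec s y) = nsq (qvec s x) / (cmod d)\<^sup>2"
    "mom s y = mom s x / (cmod d)\<^sup>2"
proof -
  have d: "d \<noteq> 0"
    using l by (simp add: linked_def)
  show p: "nsq (pvec y) = (cmod d)\<^sup>2 * nsq (pvec x)"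
    using l assms(1) by (simp add: linked_def nsq_scale nsq_orth)
  have "(cmod d)\<^sup>2 * nsq (qvec s y) = nsq (qvec s x)"
    using l assms(1) by (metis linked_def nsq_scale nsq_orth)
  then show q: "nsq (qvec s y) = nsq (qvec s x) / (cmod d)\<^sup>2"
    using d by (simp add: field_simps)
  have "nsq (qvec s y) / nsq (pvec y) = (nsq (qvec s x) / nsq (pvec x)) / ((cmod d)\<^sup>2)\<^sup>2"
    unfolding p q by (simp add: power2_eq_square)
  then show "mom s y = mom s x / (cmod d)\<^sup>2"
    by (simp only: mom_def real_sqrt_divide real_sqrt_abs abs_power2)
qed

text \<open>The terms with d' point along the orbit, and \<open>shift\<close> changes by exactly -
  d' / d. Hence lifts transform without an inhomogeneous term.\<close>

lemma dlinked_hor: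
  assumes s: "s \<noteq> 0" and M: "orth M" and l: "linked M s x y d" and dl: "dlinked M s x y d v v' d'"
  shows "hor_p s y v' = d *s (M *v hor_p s x v)" and "d *s hor_q s y v' = M *v hor_q s x v"
proof -
  have d: "d \<noteq> 0"
    using l by (simp add: linked_def)
  have p: "pvec y = d *s (M *v pvec x)" and q: "M *v qvec s x = d *s qvec s y"
    using l by (simp_all add: linked_def)
  have dp: "dpvec v' = d *s (M *v dpvec v) + (d' / d) *s pvec y"
    using dl d by (simp add: dlinked_def p)
  have dq: "M *v dqvec x v = d *s (dqvec y v' + (d' / d) *s qvec s y)"
    using dl d by (simp add: dlinked_def vec_eq_iff field_simps)
  have P: "nsq (pvec x) > 0" "nsq (qvec s x) > 0" "nsq (pvec y) > 0" "nsq (qvec s y) > 0"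
    using nsq_pvec_pos[of x] nsq_pvec_pos[of y] nsq_qvec_pos[OF s, of x] nsq_qvec_pos[OF s, of y] by auto
  have lp: "log_p y v' = log_p x v + d' / d"
  proof -
    have "herm (d *s (M *v dpvec v)) (pvec y) = of_real ((cmod d)\<^sup>2) * herm (dpvec v) (pvec x)"
      by (simp only: p herm_scaled herm_orth[OF M])
    then show ?thesis
      using d P unfolding log_p_def dp herm_add linked_mom(1)[OF M l]
      by (simp add: herm_scale herm_self linked_mom(1)[OF M l] add_divide_distrib)
  qed
  have lq: "log_q s x v = log_q s y v' + d' / d"
  proof -
    have "herm (dqvec x v) (qvec s x) = herm (M *v dqvec x v) (M *v qvec s x)"
      by (simp add: herm_orth[OF M])
    also have "\<dots> = of_real ((cmod d)\<^sup>2) * herm (dqvec y v' + (d' / d) *s qvec s y) (qvec s y)"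
      by (simp only: dq q herm_scaled)
    finally have "herm (dqvec x v) (qvec s x) = of_real ((cmod d)\<^sup>2) *
        (herm (dqvec y v') (qvec s y) + (d' / d) * of_real (nsq (qvec s y)))"
      by (simp only: herm_add herm_scale herm_self)
    moreover have "nsq (qvec s x) = (cmod d)\<^sup>2 * nsq (qvec s y)"
      using d linked_mom(2)[OF M l] by simp
    ultimately show ?thesis
      using d P unfolding log_q_def by (simp add: add_divide_distrib)
  qed
  have sh: "shift s y v' = shift s x v - d' / d"
    by (simp add: shift_def lp lq field_simps)
  show "hor_p s y v' = d *s (M *v hor_p s x v)"
    unfolding hor_p_def sh dp p matrix_vector_right_distrib vector_scalar_commute
    using d by (simp add: vec_eq_iff field_simps)
  show "d *s hor_q s y v' = M *v hor_q s x v"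
    unfolding hor_q_def sh matrix_vector_mult_diff_distrib vector_scalar_commute dq q
    using d by (simp add: vec_eq_iff field_simps)
qed

text \<open>\<open>mom\<close> is divided by |d|^2, which compensates the factors |d|^2 and |d|^-2
  gained by the two components of the lifts.\<close>

lemma dlinked_H:
  assumes s: "s \<noteq> 0" and M: "orth M" and l: "linked M s x y d"
    and v: "dlinked M s x y d v v' d'" and w: "dlinked M s x y d w w' d''"
  shows "H_form s y v' w' = H_form s x v w"
proof -
  have d: "d \<noteq> 0"
    using l by (simp add: linked_def)
  have "herm (hor_q s x v) (hor_q s x w) = of_real ((cmod d)\<^sup>2) * herm (hor_q s y v') (hor_q s y w')"
    unfolding herm_scaled[symmetric] dlinked_hor(2)[OF s M l v] dlinked_hor(2)[OF s M l w] herm_orth[OF M] ..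
  moreover have "herm (hor_p s y v') (hor_p s y w') = of_real ((cmod d)\<^sup>2) * herm (hor_p s x v) (hor_p s x w)"
    unfolding dlinked_hor(1)[OF s M l v] dlinked_hor(1)[OF s M l w] herm_scaled herm_orth[OF M] ..
  ultimately show ?thesis
    using d mom_pos[OF s, of x] by (simp add: H_form_def linked_mom(3)[OF M l])
qed

lemma dlinked_cscale: "dlinked M s x y d v v' d' \<Longrightarrow> dlinked M s x y d (cscale c v) (cscale c v') (c * d')"
  unfolding dlinked_def dpvec_simps dqvec_simps vector_scalar_commute
  by (auto simp: vec_eq_iff algebra_simps) (metis distrib_left mult.left_commute)

text \<open>Conjugation turns a factor d into \<open>cnj d\<close>; the factor |d|^2 = d
  \<open>cnj d\<close> contributed by \<open>mom\<close> turns it back.\<close>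

lemma dlinked_J:
  assumes s: "s \<noteq> 0" and M: "orth M" and l: "linked M s x y d"
    and v: "dlinked M s x y d v v' d'" and w: "dlinked M s x y d (J_op s x v) w' d''"
  shows "w' = J_op s y v'"
proof (rule hor_eqI[of s y])
  have d: "d \<noteq> 0"
    using l by (simp add: linked_def)
  have m: "mom s x > 0"
    by (rule mom_pos[OF s])
  have dd: "of_real ((cmod d)\<^sup>2) = d * cnj d"
    by (simp only: complex_norm_square)
  have q: "hor_q s y v' = (1 / d) *s (M *v hor_q s x v)"
    by (rule scale_cancel[OF d dlinked_hor(2)[OF s M l v]])
  have cs: "cvec (c *s a) = cnj c *s cvec a" for c and a :: "'a cvec"
    by (simp add: vec_eq_iff)
  show "hor_p s y w' = hor_p s y (J_op s y v')"
    unfolding dlinked_hor(1)[OF s M l w] hor_J[OF s] q cs cvec_orth[OF M] vector_scalar_commute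
      linked_mom(3)[OF M l] of_real_divide dd
    using d m by (simp add: vec_eq_iff)
  have "d *s hor_q s y w' = d *s hor_q s y (J_op s y v')"
    unfolding dlinked_hor(2)[OF s M l w] hor_J[OF s] dlinked_hor(1)[OF s M l v] cs cvec_orth[OF M] vector_scalar_commute
      linked_mom(3)[OF M l] of_real_divide dd
    using d m by (simp add: vec_eq_iff)
  then show "hor_q s y w' = hor_q s y (J_op s y v')"
    using d by (simp add: vec_eq_iff)
qed

text \<open>The image vector does not depend on d'. Combined with \<open>dlinked_cscale\<close> this
  yields complex linearity of the derivatives of the coordinate changes.\<close>

lemma dlinked_unique:
  assumes s: "s \<noteq> 0" and M: "orth M" and l: "linked M s x y d"
    and v: "dlinked M s x y d v v' d'" and w: "dlinked M s x y d v w' d''"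
  shows "v' = w'"
proof (rule hor_eqI[of s y])
  have "d \<noteq> 0"
    using l by (simp add: linked_def)
  moreover have "d *s hor_q s y v' = d *s hor_q s y w'"
    unfolding dlinked_hor(2)[OF s M l v] dlinked_hor(2)[OF s M l w] ..
  ultimately show "hor_q s y v' = hor_q s y w'"
    by (simp add: vec_eq_iff)
qed (simp add: dlinked_hor(1)[OF s M l v] dlinked_hor(1)[OF s M l w])

text \<open>The multiplier d of \<open>linked\<close>, forced by the last entry of the new p being
  1.\<close>

definition scale_factor :: "('n::finite) cmat \<Rightarrow> complex^'n \<Rightarrow> complex" where
  "scale_factor M z = 1 / (M *v snoc z 1) $ None"

definition zmap :: "('n::finite) cmat \<Rightarrow> complex^'n \<Rightarrow> complex^'n" where
  "zmap M z = (\<chi> k. scale_factor M z * (M *v snoc z 1) $ Some k)"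

definition trans_map :: "('n::finite) cmat \<Rightarrow> complex \<Rightarrow> 'n coords \<Rightarrow> 'n coords" where
  "trans_map M s x = (zmap M (fst x), \<chi> k. (M *v pvec x) $ None * (M *v qvec s x) $ Some k)"

definition dscale_factor :: "('n::finite) cmat \<Rightarrow> complex^'n \<Rightarrow> complex^'n \<Rightarrow> complex" where
  "dscale_factor M z v = - ((scale_factor M z)\<^sup>2 * (M *v snoc v 0) $ None)"

definition dzmap :: "('n::finite) cmat \<Rightarrow> complex^'n \<Rightarrow> complex^'n \<Rightarrow> complex^'n" where
  "dzmap M z v = (\<chi> k. scale_factor M z * (M *v snoc v 0) $ Some k + dscale_factor M z v * (M *v snoc z 1) $ Some k)"

lemma linked_iff:
  assumes M: "orth M"
  shows "linked M s x y d \<longleftrightarrow> (M *v pvec x) $ None \<noteq> 0 \<and> d = scale_factor M (fst x) \<and> y = trans_map M s x"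
proof
  assume l: "linked M s x y d"
  then have d0: "d \<noteq> 0" and p: "pvec y = d *s (M *v pvec x)" and q: "d *s qvec s y = M *v qvec s x"
    by (simp_all add: linked_def)
  have d: "d * (M *v pvec x) $ None = 1"
    using arg_cong[OF p, of "\<lambda>v. v $ None"] by (simp add: pvec_def)
  have "fst y $ k = d * (M *v pvec x) $ Some k" "d * snd y $ k = (M *v qvec s x) $ Some k" for k
    using arg_cong[OF p, of "\<lambda>v. v $ Some k"] arg_cong[OF q, of "\<lambda>v. v $ Some k"] by (simp_all add: pvec_def qvec_def)
  moreover have "snd y $ k = (M *v pvec x) $ None * (d * snd y $ k)" for k
    using d by (metis mult.assoc mult.commute mult_1)
  moreover have "(M *v pvec x) $ None \<noteq> 0" "d = scale_factor M (fst x)"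
    using d by (auto simp: scale_factor_def pvec_def eq_divide_eq)
  ultimately show "(M *v pvec x) $ None \<noteq> 0 \<and> d = scale_factor M (fst x) \<and> y = trans_map M s x"
    by (auto simp: trans_map_def zmap_def pvec_def prod_eq_iff vec_eq_iff)
next
  assume *: "(M *v pvec x) $ None \<noteq> 0 \<and> d = scale_factor M (fst x) \<and> y = trans_map M s x"
  then have d: "d = 1 / (M *v pvec x) $ None"
    by (simp add: scale_factor_def pvec_def)
  have y: "y = trans_map M s x"
    using * by simp
  have dN: "d * (M *v pvec x) $ None = 1"
    unfolding d using conjunct1[OF *] by simp
  have "pvec y $ i = (d *s (M *v pvec x)) $ i" for i
    using * dN by (cases i) (auto simp: pvec_def trans_map_def zmap_def)
  then have p: "pvec y = d *s (M *v pvec x)"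
    by (simp add: vec_eq_iff)
  have "(d *s qvec s y) $ i = (M *v qvec s x) $ i" for i
  proof (cases i)
    case (Some k)
    then show ?thesis
      by (simp add: y qvec_def trans_map_def mult.assoc[symmetric] dN)
  next
    case None
    \<comment> \<open>The remaining last entry follows from p . q = s: both vectors pair equally
      with \<open>pvec y\<close>, whose last entry is 1, and all other entries agree.\<close>
    have "covector (pvec y) (d *s qvec s y) = d * s"
      by (simp add: covector_scale covector_pq)
    also have "\<dots> = covector (pvec y) (M *v qvec s x)"
      by (simp add: p covector_scale covector_orth[OF M] covector_pq)
    finally have "covector (pvec y) (d *s qvec s y) = covector (pvec y) (M *v qvec s x)" .
    moreover have "(d *s qvec s y) $ Some k = (M *v qvec s x) $ Some k" for k
      by (simp add: y qvec_def trans_map_def mult.assoc[symmetric] dN)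
    ultimately show ?thesis
      unfolding covector_def sum_option by (simp add: None pvec_def)
  qed
  then show "linked M s x y d"
    using dN p by (auto simp: linked_def vec_eq_iff)
qed

section \<open>Differentiation of the coordinate changes\<close>

lemma bounded_linear_matrix: "bounded_linear (\<lambda>v. M *v v)" for M :: "complex^'m^'k"
  by (rule linear_conv_bounded_linear[THEN iffD1], rule linearI, rule matrix_vector_right_distrib)
    (simp add: vec_eq_iff matrix_vector_mult_def scaleR_sum_right)

lemma has_derivative_matrix: "(F has_derivative F') net \<Longrightarrow> ((\<lambda>x. M *v F x) has_derivative (\<lambda>h. M *v F' h)) net"
  for F :: "_ \<Rightarrow> complex^'m"
  by (rule bounded_linear.has_derivative[OF bounded_linear_matrix])

lemma has_derivative_scale_factor:
  assumes "(M *v snoc z 1) $ None \<noteq> 0"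
  shows "(scale_factor M has_derivative dscale_factor M z) (at z)"
proof -
  have "((\<lambda>z. inverse ((M *v snoc z 1) $ None)) has_derivative
      (\<lambda>h. - (inverse ((M *v snoc z 1) $ None) * (M *v snoc h 0) $ None * inverse ((M *v snoc z 1) $ None)))) (at z)"
    by (intro Deriv.has_derivative_inverse assms has_derivative_nth has_derivative_matrix has_derivative_snoc
        has_derivative_const has_derivative_ident)
  then show ?thesis
    by (simp add: scale_factor_def[abs_def] dscale_factor_def[abs_def] inverse_eq_divide power2_eq_square)
qed

lemma has_derivative_zmap:
  assumes "(M *v snoc z 1) $ None \<noteq> 0"
  shows "(zmap M has_derivative dzmap M z) (at z)"
  by (rule has_derivative_vec, simp only: zmap_def dzmap_def vec_lambda_beta)
    (intro has_derivative_mult has_derivative_scale_factor assms has_derivative_nth has_derivative_matrix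
      has_derivative_snoc has_derivative_const has_derivative_ident)

lemma snoc_dzmap:
  assumes "(M *v snoc z 1) $ None \<noteq> 0"
  shows "snoc (dzmap M z v) 0 = scale_factor M z *s (M *v snoc v 0) + dscale_factor M z v *s (M *v snoc z 1)"
proof (rule vec_eq_iff[THEN iffD2], rule allI)
  fix i
  show "snoc (dzmap M z v) 0 $ i =
      (scale_factor M z *s (M *v snoc v 0) + dscale_factor M z v *s (M *v snoc z 1)) $ i"
    using assms by (cases i) (simp_all add: dzmap_def dscale_factor_def scale_factor_def power2_eq_square)
qed

lemma open_chart_domain: "open {x. (M *v pvec x) $ None \<noteq> 0}"
proof -
  have "isCont (\<lambda>z. (M *v pvec z) $ None) z" for z
    by (rule has_derivative_continuous[OF has_derivative_nth[OF has_derivative_matrix[OF has_derivative_pvec]]])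
  then have "open ((\<lambda>z. (M *v pvec z) $ None) -` (- {0}))"
    by (intro open_vimage) (auto simp: continuous_on_eq_continuous_at)
  then show ?thesis
    by (simp add: vimage_def)
qed

lemma trans_map_derivative:
  fixes M :: "('n::finite) cmat"
  assumes M: "orth M" and x: "(M *v pvec x) $ None \<noteq> 0"
  obtains T' where "(trans_map M s has_derivative T') (at x)"
    and "\<And>v. dlinked M s x (trans_map M s x) (scale_factor M (fst x)) v (T' v) (dscale_factor M (fst x) (fst v))"
proof -
  have x': "(M *v snoc (fst x) 1) $ None \<noteq> 0"
    using x by (simp add: pvec_def)
  define X' where "X' v = (\<chi> k. (M *v pvec x) $ None * (M *v dqvec x v) $ Some k + (M *v dpvec v) $ None * (M *v qvec s x) $ Some k)" for v
  define T' where "T' v = (dzmap M (fst x) (fst v), X' v)" for v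
  have "((\<lambda>x. zmap M (fst x)) has_derivative (\<lambda>v. dzmap M (fst x) (fst v))) (at x)"
    by (rule has_derivative_compose[OF has_derivative_fst' has_derivative_zmap[OF x']])
  moreover have "((\<lambda>x. \<chi> k. (M *v pvec x) $ None * (M *v qvec s x) $ Some k) has_derivative X') (at x)"
    by (rule has_derivative_vec, simp only: X'_def vec_lambda_beta)
      (intro has_derivative_mult has_derivative_nth has_derivative_matrix has_derivative_pvec has_derivative_qvec)
  ultimately have T': "(trans_map M s has_derivative T') (at x)"
    unfolding trans_map_def[abs_def] T'_def[abs_def] by (rule has_derivative_Pair)
  have l: "linked M s y (trans_map M s y) (scale_factor M (fst y))" if "(M *v pvec y) $ None \<noteq> 0" for y
    using that by (simp add: linked_iff[OF M])
  define y where "y = trans_map M s x"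
  define d where "d = scale_factor M (fst x)"
  define d' where "d' v = dscale_factor M (fst x) (fst v)" for v :: "'n coords"
  have sf: "((\<lambda>x. scale_factor M (fst x)) has_derivative d') (at x)"
    unfolding d'_def by (rule has_derivative_compose[OF has_derivative_fst' has_derivative_scale_factor[OF x']])
  \<comment> \<open>Both sides are derivatives of the two sides of d q(y) = M q(x), an identity
    valid on a whole neighbourhood of x.\<close>
  have "d *s dqvec y (T' v) + d' v *s qvec s y = M *v dqvec x v" for v
  proof (rule vec_eq_iff[THEN iffD2], rule allI)
    fix i
    have 1: "((\<lambda>z. scale_factor M (fst z) * qvec s (trans_map M s z) $ i) has_derivative
        (\<lambda>v. d * dqvec y (T' v) $ i + d' v * qvec s y $ i)) (at x)"
      unfolding d_def y_def
      by (intro has_derivative_mult sf has_derivative_nth has_derivative_compose[OF T' has_derivative_qvec])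
    have 2: "((\<lambda>z. (M *v qvec s z) $ i) has_derivative (\<lambda>v. d * dqvec y (T' v) $ i + d' v * qvec s y $ i)) (at x)"
    proof (rule has_derivative_transform_within_open[OF 1 open_chart_domain])
      fix z
      assume "z \<in> {z. (M *v pvec z) $ None \<noteq> 0}"
      then have "scale_factor M (fst z) *s qvec s (trans_map M s z) = M *v qvec s z"
        using l[of z] by (simp add: linked_def)
      then show "scale_factor M (fst z) * qvec s (trans_map M s z) $ i = (M *v qvec s z) $ i"
        by (metis vector_smult_component)
    qed (use x in auto)
    have "((\<lambda>z. (M *v qvec s z) $ i) has_derivative (\<lambda>v. (M *v dqvec x v) $ i)) (at x)"
      by (intro has_derivative_nth has_derivative_matrix has_derivative_qvec)
    from fun_cong[OF has_derivative_unique[OF 2 this], of v]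
    show "(d *s dqvec y (T' v) + d' v *s qvec s y) $ i = (M *v dqvec x v) $ i"
      by simp
  qed
  moreover have "dpvec (T' v) = d *s (M *v dpvec v) + d' v *s (M *v pvec x)" for v
    using snoc_dzmap[OF x', of "fst v"] by (simp add: dpvec_def T'_def d_def d'_def pvec_def)
  ultimately have "dlinked M s x (trans_map M s x) (scale_factor M (fst x)) v (T' v) (dscale_factor M (fst x) (fst v))" for v
    unfolding dlinked_def d_def[symmetric] y_def[symmetric] d'_def[symmetric] by simp
  with T' show ?thesis
    by (rule that)
qed

section \<open>The gluing relation\<close>

text \<open>The second claim holds because \<open>cyc \<alpha>\<close> sends the last index to
  \<alpha>; it translates membership in a chart domain into nonvanishing of the last entry after
  undoing \<open>\<sigma>\<close>.\<close>

lemma sigma_orth: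
  assumes "sigma_family \<sigma>"
  shows "orth (\<sigma> \<alpha>)" and "\<exists>\<epsilon>. \<epsilon> \<noteq> 0 \<and> (\<forall>v. (transpose (\<sigma> \<alpha>) *v v) $ None = \<epsilon> * v $ \<alpha>)" and "det (\<sigma> \<alpha>) = 1"
proof -
  from assms obtain \<epsilon> where \<epsilon>: "\<And>j. \<epsilon> j = 1 \<or> \<epsilon> j = -1"
    and M: "\<sigma> \<alpha> = (\<chi> i j. if i = cyc \<alpha> j then \<epsilon> j else 0)" and det: "det (\<sigma> \<alpha>) = 1"
    unfolding sigma_family_def signed_perm_matrix_def by blast
  show "det (\<sigma> \<alpha>) = 1"
    by (rule det)
  have \<epsilon>2: "\<epsilon> j * \<epsilon> j = 1" "\<epsilon> j \<noteq> 0" "cnj (\<epsilon> j) = \<epsilon> j" for j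
    using \<epsilon>[of j] by auto
  have "invertible (\<sigma> \<alpha>)"
    using det by (simp add: invertible_det_nz)
  then have ker: "\<sigma> \<alpha> *v v = 0 \<Longrightarrow> v = 0" for v
    using matrix_left_invertible_ker[of "\<sigma> \<alpha>"] unfolding invertible_def by blast
  \<comment> \<open>Injectivity of the permutation is drawn from the determinant: two columns
    supported in the same row would give a nonzero kernel vector.\<close>
  have inj: "j = k" if eq: "cyc \<alpha> j = cyc \<alpha> k" for j k
  proof (rule ccontr)
    assume neq: "j \<noteq> k"
    have ax: "(\<sigma> \<alpha> *v axis l c) $ i = (if i = cyc \<alpha> l then \<epsilon> l * c else 0)" for i l c
      by (simp add: M matrix_vector_mult_def axis_def if_distrib[of "\<lambda>x. _ * x"] cong: if_cong)
    have "\<sigma> \<alpha> *v (axis j (\<epsilon> j) - axis k (\<epsilon> k)) = 0"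
      by (simp add: matrix_vector_mult_diff_distrib vec_eq_iff ax eq \<epsilon>2)
    then have "(axis j (\<epsilon> j) - axis k (\<epsilon> k)) $ j = 0"
      using ker by (metis zero_index)
    then show False
      using neq \<epsilon>2(2)[of j] by (simp add: axis_def)
  qed
  have "(\<Sum>i\<in>UNIV. (if i = cyc \<alpha> j then \<epsilon> j else 0) * (if i = cyc \<alpha> k then \<epsilon> k else 0)) = (if j = k then 1 else 0)" for j k
  proof -
    have "(\<Sum>i\<in>UNIV. (if i = cyc \<alpha> j then \<epsilon> j else 0) * (if i = cyc \<alpha> k then \<epsilon> k else 0)) =
        (\<Sum>i\<in>UNIV. if i = cyc \<alpha> j then \<epsilon> j * (if i = cyc \<alpha> k then \<epsilon> k else 0) else 0)"
      by (rule sum.cong) auto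
    also have "\<dots> = (if j = k then 1 else 0)"
      using inj[of j k] \<epsilon>2(1)[of j] by auto
    finally show ?thesis .
  qed
  then have left: "transpose (\<sigma> \<alpha>) ** \<sigma> \<alpha> = mat 1"
    by (simp add: M vec_eq_iff matrix_matrix_mult_def transpose_def mat_def)
  then have "\<sigma> \<alpha> ** transpose (\<sigma> \<alpha>) = mat 1"
    using matrix_left_right_inverse by blast
  moreover have "cnj (\<sigma> \<alpha> $ i $ j) = \<sigma> \<alpha> $ i $ j" for i j
    using \<epsilon>2(3) by (simp add: M)
  ultimately show "orth (\<sigma> \<alpha>)"
    using left by (simp add: orth_def)
  have "(transpose (\<sigma> \<alpha>) *v v) $ None = \<epsilon> None * v $ \<alpha>" for v
    by (simp add: M matrix_vector_mult_def transpose_def if_distrib[of "\<lambda>x. x * _"] cong: if_cong)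
  then show "\<exists>\<epsilon>. \<epsilon> \<noteq> 0 \<and> (\<forall>v. (transpose (\<sigma> \<alpha>) *v v) $ None = \<epsilon> * v $ \<alpha>)"
    using \<epsilon>2(2) by blast
qed

definition chg :: "('n option \<Rightarrow> ('n::finite) cmat) \<Rightarrow> 'n option \<Rightarrow> 'n option \<Rightarrow> 'n cmat" where
  "chg \<sigma> \<alpha> \<beta> = transpose (\<sigma> \<beta>) ** \<sigma> \<alpha>"

lemma orth_chg: "sigma_family \<sigma> \<Longrightarrow> orth (chg \<sigma> \<alpha> \<beta>)"
  unfolding chg_def by (intro orth_mult orth_transpose sigma_orth)

lemma chg_apply: "chg \<sigma> \<alpha> \<beta> *v v = transpose (\<sigma> \<beta>) *v (\<sigma> \<alpha> *v v)"
  by (simp add: chg_def matrix_vector_mul_assoc)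

lemma chg_None: "sigma_family \<sigma> \<Longrightarrow> (chg \<sigma> \<alpha> \<beta> *v v) $ None = 0 \<longleftrightarrow> (\<sigma> \<alpha> *v v) $ \<beta> = 0"
  unfolding chg_apply using sigma_orth(2)[of \<sigma> \<beta>] by auto

lemma sigma_chg: "sigma_family \<sigma> \<Longrightarrow> \<sigma> \<beta> *v (chg \<sigma> \<alpha> \<beta> *v v) = \<sigma> \<alpha> *v v"
  by (simp add: chg_apply orth_cancel sigma_orth)

lemma transpose_chg: "transpose (chg \<sigma> \<alpha> \<beta>) = chg \<sigma> \<beta> \<alpha>"
  by (simp add: chg_def matrix_transpose_mul)

section \<open>Block matrices and the dictionary between h and (p, q)\<close>

definition outer :: "complex^'n \<Rightarrow> complex^'n \<Rightarrow> complex^'n^'n" where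
  "outer a b = (\<chi> i j. a $ i * b $ j)"

lemma block_nth [simp]: "block A z c d $ Some k $ Some l = A $ k $ l" "block A z c d $ Some k $ None = z $ k"
  "block A z c d $ None $ Some l = c $ l" "block A z c d $ None $ None = d"
  by (simp_all add: block_def)

lemma cmat_eqI:
  assumes "\<And>k l. A $ Some k $ Some l = B $ Some k $ Some l" "\<And>k. A $ Some k $ None = B $ Some k $ None"
    "\<And>l. A $ None $ Some l = B $ None $ Some l" "A $ None $ None = B $ None $ None"
  shows "A = (B :: ('n::finite) cmat)"
  unfolding vec_eq_iff using assms by (metis option.exhaust)

lemma block_mult: "block A z c d ** block A' z' c' d' =
  block (A ** A' + outer z c') (A *v z' + d' *s z) (transpose A' *v c + d *s c') (covector c z' + d * d')"
  by (rule cmat_eqI) (simp_all add: matrix_matrix_mult_def matrix_vector_mult_def transpose_def outer_def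
      covector_def sum_option mult.commute add.commute)

lemma block_1: "block (mat 1) 0 0 1 = mat 1"
  by (rule cmat_eqI) (simp_all add: mat_def)

lemma outer_0 [simp]: "outer 0 a = 0" "outer a 0 = 0"
  by (simp_all add: outer_def vec_eq_iff)

lemma transpose_mat_1 [simp]: "transpose (mat 1) = mat 1"
  by (auto simp: transpose_def mat_def vec_eq_iff)

lemma u_plus_add: "u_plus a ** u_plus b = u_plus (a + b)"
  by (simp add: u_plus_def block_mult add.commute)

lemma u_minus_add: "u_minus a ** u_minus b = u_minus (a + b)"
  by (simp add: u_minus_def block_mult)

lemma u_0: "u_plus 0 = mat 1" "u_minus 0 = mat 1"
  by (simp_all add: u_plus_def u_minus_def block_1)

definition U_mat :: "complex \<Rightarrow> ('n::finite) coords \<Rightarrow> 'n cmat" where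
  "U_mat s x = u_plus (fst x) ** u_minus (- (1 / s) *s snd x)"

definition V_mat :: "complex \<Rightarrow> ('n::finite) coords \<Rightarrow> 'n cmat" where
  "V_mat s x = u_minus ((1 / s) *s snd x) ** u_plus (- fst x)"

lemma h_mat_eq: "h_mat s \<sigma> \<alpha> x = \<sigma> \<alpha> ** U_mat s x"
  by (cases x) (simp add: h_mat_def U_mat_def matrix_mul_assoc)

lemma V_U: "V_mat s x ** U_mat s x = mat 1" and U_V: "U_mat s x ** V_mat s x = mat 1"
proof -
  have "V_mat s x ** U_mat s x = u_minus ((1 / s) *s snd x) ** (u_plus (- fst x) ** u_plus (fst x)) ** u_minus (- (1 / s) *s snd x)"
    unfolding U_mat_def V_mat_def by (simp only: matrix_mul_assoc)
  then show "V_mat s x ** U_mat s x = mat 1"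
    by (simp add: u_plus_add u_minus_add u_0)
  then show "U_mat s x ** V_mat s x = mat 1"
    using matrix_left_right_inverse by blast
qed

lemma U_eq: "U_mat s x = block (mat 1 + outer (fst x) (- (1 / s) *s snd x)) (fst x) (- (1 / s) *s snd x) 1"
  by (simp add: U_mat_def u_plus_def u_minus_def block_mult)

lemma V_eq: "V_mat s x = block (mat 1) (- fst x) ((1 / s) *s snd x) (1 - covector (snd x) (fst x) / s)"
  by (simp add: V_mat_def u_plus_def u_minus_def block_mult covector_scale covector_minus)

lemma matrix_axis: "(A *v axis j 1) $ i = A $ i $ j" for A :: "complex^'m^'k"
  by (simp add: matrix_vector_mult_def axis_def if_distrib[of "\<lambda>x. _ * x"] cong: if_cong)

lemma U_e: "U_mat s x *v e_last = pvec x"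
  unfolding e_last_def by (rule vec_eq_iff[THEN iffD2], rule allI, rename_tac i, case_tac i)
    (simp_all add: matrix_axis U_eq pvec_def)

lemma V_p: "V_mat s x *v pvec x = e_last"
  by (simp add: U_e[of s x, symmetric] matrix_vector_mul_assoc V_U)

text \<open>With \<open>U_e\<close> this is the dictionary: p is the last column of
  \<open>U_mat\<close>, and q is s times the last row of its inverse \<open>V_mat\<close>.\<close>

lemma V_e: "s \<noteq> 0 \<Longrightarrow> transpose (V_mat s x) *v e_last = (1 / s) *s qvec s x"
  unfolding e_last_def by (rule vec_eq_iff[THEN iffD2], rule allI, rename_tac i, case_tac i)
    (simp_all add: matrix_axis transpose_def V_eq qvec_def diff_divide_distrib)

lemma U_q: "s \<noteq> 0 \<Longrightarrow> transpose (U_mat s x) *v qvec s x = s *s e_last"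
proof -
  assume s: "s \<noteq> 0"
  have "qvec s x = s *s (transpose (V_mat s x) *v e_last)"
    using s by (simp add: V_e vec_eq_iff)
  then show ?thesis
    by (simp add: vector_scalar_commute matrix_vector_mul_assoc matrix_transpose_mul[symmetric] V_U)
qed

text \<open>The matrix arises from the identity by adding a combination of the other rows to the
  last row.\<close>

lemma det_u_minus: "det (u_minus w) = 1"
proof -
  define x where "x = (\<Sum>l\<in>UNIV. w $ l *s axis (Some l) (1::complex))"
  have row: "row i (mat 1 :: complex^'m^'m) = axis i 1" for i
    by (auto simp: row_def mat_def axis_def vec_eq_iff)
  have "x \<in> vec.span {row j (mat 1 :: 'a cmat) | j. j \<noteq> None}"
    unfolding x_def by (intro vec.span_sum vec.span_scale vec.span_base) (auto simp: row)
  from det_row_span[OF this]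
  have "det (\<chi> k. if k = None then row None (mat 1) + x else row k (mat 1) :: 'a cmat) = (det (mat 1 :: 'a cmat) :: complex)" .
  moreover have "(\<chi> k. if k = None then row None (mat 1) + x else row k (mat 1)) = u_minus w"
    by (rule cmat_eqI) (simp_all add: u_minus_def row_def x_def axis_def mat_def if_distrib[of "\<lambda>x. _ * x"] cong: if_cong)
  ultimately show ?thesis
    by simp
qed

lemma det_u_plus: "det (u_plus z) = 1"
proof -
  have "u_plus z = transpose (u_minus z)"
    by (rule cmat_eqI) (simp_all add: u_plus_def u_minus_def transpose_def mat_def)
  then show ?thesis
    by (simp add: det_transpose det_u_minus)
qed

text \<open>Block diagonality means that the last basis vector is an eigenvector of both t and its
  transpose, the form in which the dictionary for p and q delivers it.\<close>

lemma L_groupI: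
  assumes col: "t *v e_last = d *s e_last" and row: "transpose t *v e_last = d *s e_last" and det: "det t = 1"
  shows "t \<in> L_group"
proof -
  define A where "A = (\<chi> k l. t $ Some k $ Some l)"
  have "t $ i $ None = d * (axis None 1 :: 'a cvec) $ i" for i
    using arg_cong[OF col, of "\<lambda>v. v $ i"] by (simp add: e_last_def matrix_axis)
  moreover have "t $ None $ i = d * (axis None 1 :: 'a cvec) $ i" for i
    using arg_cong[OF row, of "\<lambda>v. v $ i"] by (simp add: e_last_def matrix_axis transpose_def)
  ultimately have t: "t = block A 0 0 d"
    by (intro cmat_eqI) (simp_all add: A_def axis_def)
  have "invertible (block A 0 0 d)"
    using det by (simp add: t invertible_det_nz)
  then obtain B where B: "block A 0 0 d ** B = mat 1"
    unfolding invertible_def by blast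
  have "A ** (\<chi> k l. B $ Some k $ Some l) = mat 1"
    unfolding vec_eq_iff
  proof (intro allI)
    fix k l
    have "(block A 0 0 d ** B) $ Some k $ Some l = (mat 1 :: 'a cmat) $ Some k $ Some l"
      by (simp only: B)
    then show "(A ** (\<chi> k l. B $ Some k $ Some l)) $ k $ l = mat 1 $ k $ l"
      by (simp add: matrix_matrix_mult_def sum_option mat_def)
  qed
  then have "invertible A"
    by (auto simp: invertible_right_inverse)
  moreover have "d \<noteq> 0"
  proof
    assume "d = 0"
    have "(block A 0 0 d ** B) $ None $ None = (mat 1 :: 'a cmat) $ None $ None"
      by (simp only: B)
    with \<open>d = 0\<close> show False
      by (simp add: matrix_matrix_mult_def sum_option mat_def)
  qed
  ultimately show ?thesis
    using det unfolding L_group_def t by blast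
qed

lemma L_groupD:
  assumes "t \<in> L_group"
  obtains d where "d \<noteq> 0" "t *v e_last = d *s e_last" "transpose t *v e_last = d *s e_last"
proof -
  from assms obtain A d where t: "t = block A 0 0 d" and d: "d \<noteq> 0"
    unfolding L_group_def by blast
  have "(t *v e_last) $ i = (d *s e_last) $ i" for i
    unfolding t e_last_def matrix_axis by (cases i) (simp_all add: axis_def)
  moreover have "(transpose t *v e_last) $ i = (d *s e_last) $ i" for i
    unfolding t e_last_def matrix_axis by (cases i) (simp_all add: axis_def transpose_def)
  ultimately show ?thesis
    using that[OF d] unfolding vec_eq_iff by blast
qed

text \<open>The equation h(y) = h(x) t solved for t, with y the explicit transform of x.\<close>

definition t_loc :: "complex \<Rightarrow> ('n::finite) cmat \<Rightarrow> 'n coords \<Rightarrow> 'n cmat" where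
  "t_loc s M x = V_mat s x ** transpose M ** U_mat s (trans_map M s x)"

lemma t_loc_e:
  assumes s: "s \<noteq> 0" and M: "orth M" and l: "linked M s x y d"
  shows "(V_mat s x ** transpose M ** U_mat s y) *v e_last = d *s e_last"
    and "transpose (V_mat s x ** transpose M ** U_mat s y) *v e_last = d *s e_last"
proof -
  have p: "transpose M *v pvec y = d *s pvec x"
    using l by (simp add: linked_def vector_scalar_commute orth_cancel[OF M])
  show "(V_mat s x ** transpose M ** U_mat s y) *v e_last = d *s e_last"
    by (simp add: matrix_vector_mul_assoc[symmetric] U_e p vector_scalar_commute V_p)
  have q: "M *v qvec s x = d *s qvec s y"
    using l by (simp add: linked_def)
  show "transpose (V_mat s x ** transpose M ** U_mat s y) *v e_last = d *s e_last"
    using s by (simp add: matrix_transpose_mul matrix_vector_mul_assoc[symmetric] V_e vector_scalar_commute q U_q)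
qed

text \<open>Every solution y' gives t = h(x)^-1 h(y'), and t lies in L only if the last column and
  the last row of that equation are the two equations of \<open>linked\<close>, which determine
  y'.\<close>

lemma t_mat_eq:
  assumes \<sigma>: "sigma_family \<sigma>" and s: "s \<noteq> 0" and x: "(chg \<sigma> \<alpha> \<beta> *v pvec x) $ None \<noteq> 0"
  shows "t_mat s \<sigma> \<alpha> \<beta> x = t_loc s (chg \<sigma> \<alpha> \<beta>) x"
proof -
  define M where "M = chg \<sigma> \<alpha> \<beta>"
  have M: "orth M"
    unfolding M_def by (rule orth_chg[OF \<sigma>])
  define y where "y = trans_map M s x"
  have l: "linked M s x y (scale_factor M (fst x))"
    using x[folded M_def] by (simp add: linked_iff[OF M] y_def)
  have tM: "transpose M = transpose (\<sigma> \<alpha>) ** \<sigma> \<beta>"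
    by (simp add: M_def transpose_chg) (simp add: chg_def)
  have \<sigma>o: "\<sigma> \<gamma> ** transpose (\<sigma> \<gamma>) = mat 1" "transpose (\<sigma> \<gamma>) ** \<sigma> \<gamma> = mat 1" for \<gamma>
    using sigma_orth(1)[OF \<sigma>, of \<gamma>] by (simp_all add: orth_def)
  have eq: "h_mat s \<sigma> \<beta> y' = h_mat s \<sigma> \<alpha> x ** t \<longleftrightarrow> t = V_mat s x ** transpose M ** U_mat s y'" for y' t
  proof
    assume "h_mat s \<sigma> \<beta> y' = h_mat s \<sigma> \<alpha> x ** t"
    then have "V_mat s x ** transpose (\<sigma> \<alpha>) ** (\<sigma> \<beta> ** U_mat s y') = V_mat s x ** transpose (\<sigma> \<alpha>) ** (\<sigma> \<alpha> ** U_mat s x ** t)"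
      by (simp add: h_mat_eq)
    also have "\<dots> = V_mat s x ** (transpose (\<sigma> \<alpha>) ** \<sigma> \<alpha>) ** U_mat s x ** t"
      by (simp only: matrix_mul_assoc)
    also have "\<dots> = t"
      by (simp add: \<sigma>o V_U)
    finally show "t = V_mat s x ** transpose M ** U_mat s y'"
      by (simp add: tM matrix_mul_assoc)
  next
    assume "t = V_mat s x ** transpose M ** U_mat s y'"
    then have "h_mat s \<sigma> \<alpha> x ** t = \<sigma> \<alpha> ** (U_mat s x ** V_mat s x) ** transpose (\<sigma> \<alpha>) ** \<sigma> \<beta> ** U_mat s y'"
      by (simp only: h_mat_eq tM matrix_mul_assoc)
    then show "h_mat s \<sigma> \<beta> y' = h_mat s \<sigma> \<alpha> x ** t"
      by (simp add: U_V \<sigma>o h_mat_eq)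
  qed
  have "det (V_mat s x ** transpose M ** U_mat s y) = 1"
    by (simp add: det_mul V_mat_def U_mat_def det_u_minus det_u_plus tM det_transpose sigma_orth(3)[OF \<sigma>])
  then have L: "V_mat s x ** transpose M ** U_mat s y \<in> L_group"
    by (rule L_groupI[OF t_loc_e[OF s M l]])
  show ?thesis
    unfolding t_mat_def t_loc_def M_def[symmetric] y_def[symmetric]
  proof (rule the_equality)
    fix t
    assume "t \<in> L_group \<and> (\<exists>y'. h_mat s \<sigma> \<beta> y' = h_mat s \<sigma> \<alpha> x ** t)"
    then obtain y' where t: "t = V_mat s x ** transpose M ** U_mat s y'" and "t \<in> L_group"
      by (auto simp: eq)
    from L_groupD[OF this(2)] obtain d where d: "d \<noteq> 0" "t *v e_last = d *s e_last"
      "transpose t *v e_last = d *s e_last"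
      by blast
    \<comment> \<open>Applying h(y') = h(x) t to the last basis vector gives the equation for p; the
      transposed inverse equation below gives the one for q.\<close>
    have "M *v (U_mat s x *v (t *v e_last)) = M *v (U_mat s x *v (V_mat s x *v (transpose M *v pvec y')))"
      by (simp add: t matrix_vector_mul_assoc[symmetric] U_e)
    also have "\<dots> = pvec y'"
      by (simp add: matrix_vector_mul_assoc[of "U_mat s x" "V_mat s x"] U_V orth_cancel[OF M])
    finally have 1: "pvec y' = d *s (M *v pvec x)"
      by (simp add: d(2) vector_scalar_commute U_e)
    have "transpose (V_mat s y') *v (transpose t *v e_last) =
        transpose (V_mat s y') *v (transpose (U_mat s y') *v (M *v (transpose (V_mat s x) *v e_last)))"
      by (simp add: t matrix_transpose_mul matrix_vector_mul_assoc[symmetric])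
    also have "\<dots> = M *v (transpose (V_mat s x) *v e_last)"
      by (simp only: matrix_vector_mul_assoc[of "transpose (V_mat s y')"] matrix_transpose_mul[symmetric] U_V
          transpose_mat_1 matrix_vector_mul_lid)
    finally have "d *s ((1 / s) *s qvec s y') = (1 / s) *s (M *v qvec s x)"
      by (simp add: d(3) vector_scalar_commute V_e[OF s])
    then have "d *s qvec s y' = M *v qvec s x"
      using s by (simp add: vec_eq_iff)
    with 1 d(1) have "linked M s x y' d"
      by (simp add: linked_def)
    then have "y' = y"
      by (simp add: linked_iff[OF M] y_def)
    then show "t = V_mat s x ** transpose M ** U_mat s y"
      by (simp add: t)
  qed (use L eq[of y] in blast)
qed

section \<open>The derivative of t and its pairing with lambda\<close>

lemma has_derivative_mat:
  fixes F :: "'a::real_normed_vector \<Rightarrow> complex^'m^'k"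
  assumes "\<And>i j. ((\<lambda>x. F x $ i $ j) has_derivative (\<lambda>h. F' h $ i $ j)) net"
  shows "(F has_derivative F') net"
  by (intro has_derivative_vec assms)

lemma has_derivative_matrix_mult:
  fixes F :: "'a::real_normed_vector \<Rightarrow> complex^'m^'k" and G :: "'a \<Rightarrow> complex^'l^'m"
  assumes "(F has_derivative F') (at x)" "(G has_derivative G') (at x)"
  shows "((\<lambda>y. F y ** G y) has_derivative (\<lambda>h. F x ** G' h + F' h ** G x)) (at x)"
  by (rule has_derivative_mat)
    (simp only: matrix_matrix_mult_def vec_lambda_beta vector_add_component sum.distrib[symmetric],
      intro has_derivative_sum has_derivative_mult has_derivative_nth assms)

lemma has_derivative_block:
  assumes "(A has_derivative A') (at x)" "(z has_derivative z') (at x)" "(c has_derivative c') (at x)" "(d has_derivative d') (at x)"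
  shows "((\<lambda>y. block (A y) (z y) (c y) (d y)) has_derivative (\<lambda>h. block (A' h) (z' h) (c' h) (d' h))) (at x)"
proof (rule has_derivative_mat)
  fix i j
  show "((\<lambda>y. block (A y) (z y) (c y) (d y) $ i $ j) has_derivative (\<lambda>h. block (A' h) (z' h) (c' h) (d' h) $ i $ j)) (at x)"
    by (cases i; cases j) (simp_all add: has_derivative_nth assms)
qed

lemma has_derivative_scale:
  fixes F :: "'a::real_normed_vector \<Rightarrow> complex^'m"
  shows "(F has_derivative F') (at x) \<Longrightarrow> ((\<lambda>y. c *s F y) has_derivative (\<lambda>h. c *s F' h)) (at x)"
  by (rule has_derivative_vec) (simp add: has_derivative_mult_right has_derivative_nth)

lemma has_derivative_outer:
  assumes "(F has_derivative F') (at x)" "(G has_derivative G') (at x)"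
  shows "((\<lambda>y. outer (F y) (G y)) has_derivative (\<lambda>h. outer (F x) (G' h) + outer (F' h) (G x))) (at x)"
  by (rule has_derivative_mat)
    (simp only: outer_def vec_lambda_beta vector_add_component, intro has_derivative_mult has_derivative_nth assms)

definition dU_mat :: "complex \<Rightarrow> ('n::finite) coords \<Rightarrow> 'n coords \<Rightarrow> 'n cmat" where
  "dU_mat s x v = block (0 + (outer (fst x) (- (1 / s) *s snd v) + outer (fst v) (- (1 / s) *s snd x))) (fst v) (- (1 / s) *s snd v) 0"

definition dV_mat :: "complex \<Rightarrow> ('n::finite) coords \<Rightarrow> 'n coords \<Rightarrow> 'n cmat" where
  "dV_mat s x v = block 0 (- fst v) ((1 / s) *s snd v) (0 - (1 / s) * (covector (snd x) (fst v) + covector (snd v) (fst x)))"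

lemma has_derivative_U: "(U_mat s has_derivative dU_mat s x) (at x)"
  unfolding U_eq[abs_def] dU_mat_def[abs_def]
  by (intro has_derivative_block has_derivative_add has_derivative_outer has_derivative_scale has_derivative_const
      has_derivative_fst' has_derivative_snd')

lemma has_derivative_V: "(V_mat s has_derivative dV_mat s x) (at x)"
proof -
  have V: "V_mat s = (\<lambda>x. block (mat 1) (- fst x) ((1 / s) *s snd x) (1 - (1 / s) * covector (snd x) (fst x)))"
    by (simp add: fun_eq_iff V_eq)
  show ?thesis
    unfolding V dV_mat_def[abs_def]
    by (intro has_derivative_block has_derivative_minus has_derivative_diff has_derivative_mult_right
        has_derivative_covector has_derivative_scale has_derivative_const has_derivative_fst' has_derivative_snd')
qed

lemma trace_block: "trace (block A z c d) = trace A + d"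
  by (simp add: trace_def sum_option add.commute)

lemma trace_outer: "trace (outer a b) = covector a b"
  by (simp add: trace_def outer_def covector_def)

lemma zero_matrix_simps [simp]: "transpose (0 :: complex^'m^'k) = 0" "0 ** (A :: complex^'m^'l) = (0 :: complex^'m^'k)"
  by (simp_all add: vec_eq_iff transpose_def matrix_matrix_mult_def)

text \<open>The logarithmic derivative of det \<open>U_mat\<close> = 1, verified on the blocks;
  \<open>trace_dV_U\<close> is the same fact for the inverse.\<close>

lemma trace_dU_V: "trace (dU_mat s x v ** V_mat s x) = 0"
  by (simp add: dU_mat_def V_eq block_mult trace_block trace_add trace_outer covector_scale covector_minus
      covector_commute[of "fst x"] covector_commute[of "fst v"])

lemma trace_dV_U: "trace (dV_mat s x v ** U_mat s x) = 0"
  by (simp add: dV_mat_def U_eq block_mult trace_block trace_add trace_outer covector_scale covector_minus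
      covector_commute[of "fst x"] covector_commute[of "fst v"] distrib_left)

text \<open>\<open>lambda_vee s\<close> is the scalar matrix s/(n+1) minus s times the projection to
  the last coordinate, since -n s/(n+1) = s/(n+1) - s.\<close>

lemma lambda_vee_conj:
  "(A ** lambda_vee s ** B) $ i $ j = s / of_nat (CARD('n) + 1) * (A ** B) $ i $ j - s * (A *v e_last) $ i * (transpose B *v e_last) $ j"
  for A B :: "('n::finite) cmat"
proof -
  define c where "c = s / of_nat (CARD('n) + 1)"
  have "- of_nat CARD('n) * s / of_nat (CARD('n) + 1) = c - s"
  proof -
    have "(of_nat (CARD('n) + 1) :: complex) \<noteq> 0"
      by (metis of_nat_0_eq_iff Suc_eq_plus1 nat.distinct(1))
    then show ?thesis
      by (simp add: c_def field_simps)
  qed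
  then have l: "lambda_vee s $ k $ l = (if k = l then c else 0) - (if k = None then (if l = None then s else 0) else 0)" for k l :: "'n option"
    by (cases k; cases l) (simp_all add: lambda_vee_def c_def mat_def)
  have "(A ** lambda_vee s ** B) $ i $ j = (\<Sum>l\<in>UNIV. (\<Sum>k\<in>UNIV. A $ i $ k * lambda_vee s $ k $ l) * B $ l $ j)"
    by (simp add: matrix_matrix_mult_def)
  also have "(\<lambda>l. \<Sum>k\<in>UNIV. A $ i $ k * lambda_vee s $ k $ l) = (\<lambda>l. A $ i $ l * c - (if l = None then A $ i $ None * s else 0))"
  proof
    fix l
    have "A $ i $ k * lambda_vee s $ k $ l = (if k = l then A $ i $ l * c else 0) - (if k = None then A $ i $ None * (if l = None then s else 0) else 0)" for k
      by (simp add: l right_diff_distrib)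
    then show "(\<Sum>k\<in>UNIV. A $ i $ k * lambda_vee s $ k $ l) = A $ i $ l * c - (if l = None then A $ i $ None * s else 0)"
      by (simp add: sum_subtractf)
  qed
  also have "(\<Sum>l\<in>UNIV. (A $ i $ l * c - (if l = None then A $ i $ None * s else 0)) * B $ l $ j) =
      (\<Sum>l\<in>UNIV. c * (A $ i $ l * B $ l $ j) - (if l = None then A $ i $ None * s * B $ None $ j else 0))"
    by (rule sum.cong) (auto simp: algebra_simps)
  also have "\<dots> = c * (A ** B) $ i $ j - s * (A *v e_last) $ i * (transpose B *v e_last) $ j"
    by (simp add: sum_subtractf matrix_matrix_mult_def sum_distrib_left e_last_def matrix_axis transpose_def)
  finally show ?thesis
    by (simp add: c_def)
qed

lemma lambda_pairing_eq:
  "lambda_pairing s X = s / of_nat (CARD('n) + 1) * trace X - s * X $ None $ None" for X :: "('n::finite) cmat"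
proof -
  have e: "(transpose X *v e_last) $ i = X $ None $ i" "(e_last :: 'n cvec) $ i = (if i = None then 1 else 0)" for i
    by (simp_all add: e_last_def matrix_axis transpose_def) (simp add: axis_def)
  have "(lambda_vee s ** X) $ i $ i = s / of_nat (CARD('n) + 1) * X $ i $ i - (if i = None then s * X $ None $ None else 0)" for i
    using lambda_vee_conj[of "mat 1" s X i i]
    by (simp add: e)
  then show ?thesis
    by (simp add: lambda_pairing_def trace_def sum_subtractf sum_distrib_left)
qed

lemma matrix_inv_eqI:
  fixes A B :: "complex^'m^'m"
  assumes AB: "A ** B = mat 1"
  shows "matrix_inv A = B"
proof -
  have BA: "B ** A = mat 1"
    using AB matrix_left_right_inverse by blast
  have "matrix_inv A ** A = mat 1"
    using someI[of "\<lambda>A'. A ** A' = mat 1 \<and> A' ** A = mat 1" B] AB BA by (simp add: matrix_inv_def)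
  then have "matrix_inv A ** (A ** B) = B"
    by (simp add: matrix_mul_assoc)
  then show ?thesis
    by (simp add: AB)
qed

text \<open>lambda is a multiple of the trace minus s times the corner entry. The trace of t' t^-1
  vanishes, and the corner entry is the logarithmic derivative of the multiplier d.\<close>

lemma t_loc_pairing:
  assumes s: "s \<noteq> 0" and M: "orth M" and x: "(M *v pvec x) $ None \<noteq> 0"
  obtains t' where "(t_loc s M has_derivative t') (at x)"
    and "\<And>v. lambda_pairing s (t' v ** matrix_inv (t_loc s M x)) = - s * dscale_factor M (fst x) (fst v) / scale_factor M (fst x)"
proof -
  obtain T' where T': "(trans_map M s has_derivative T') (at x)"
    using trans_map_derivative[OF M x] by blast
  define y where "y = trans_map M s x"
  define d where "d = scale_factor M (fst x)"
  have l: "linked M s x y d"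
    using x by (simp add: linked_iff[OF M] y_def d_def)
  have d: "d \<noteq> 0" and p: "pvec y = d *s (M *v pvec x)"
    using l by (simp_all add: linked_def)
  have Mo: "M ** transpose M = mat 1" "transpose M ** M = mat 1"
    using M by (simp_all add: orth_def)
  define t' where "t' v = (V_mat s x ** transpose M) ** dU_mat s y (T' v) + (V_mat s x ** 0 + dV_mat s x v ** transpose M) ** U_mat s y" for v
  have D: "(t_loc s M has_derivative t') (at x)"
    unfolding t_loc_def[abs_def] t'_def[abs_def] y_def
    by (intro has_derivative_matrix_mult has_derivative_V has_derivative_const has_derivative_compose[OF T' has_derivative_U])
  define ti where "ti = V_mat s y ** M ** U_mat s x"
  have "t_loc s M x ** ti = V_mat s x ** (transpose M ** (U_mat s y ** V_mat s y) ** M) ** U_mat s x"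
    by (simp only: t_loc_def ti_def y_def matrix_mul_assoc)
  then have inv: "t_loc s M x ** ti = mat 1"
    by (simp add: U_V Mo V_U)
  have mi: "matrix_inv (t_loc s M x) = ti"
    by (rule matrix_inv_eqI[OF inv])
  have distr: "(A + B) ** C = A ** C + B ** C" for A B C :: "'a cmat"
    by (simp add: vec_eq_iff matrix_matrix_mult_def distrib_right sum.distrib)
  \<comment> \<open>After the product rule, cancellation of inverses and cyclicity of the trace
    reduce the two terms to \<open>trace_dU_V\<close> and \<open>trace_dV_U\<close>.\<close>
  have tr: "trace (t' v ** ti) = 0" for v
  proof -
    have 1: "(V_mat s x ** transpose M) ** dU_mat s y (T' v) ** ti = (V_mat s x ** transpose M) ** (dU_mat s y (T' v) ** V_mat s y ** M ** U_mat s x)"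
      by (simp only: ti_def matrix_mul_assoc)
    have "trace ((V_mat s x ** transpose M) ** dU_mat s y (T' v) ** ti) = trace (dU_mat s y (T' v) ** V_mat s y ** M ** (U_mat s x ** V_mat s x) ** transpose M)"
      unfolding 1 trace_mul_sym[of "V_mat s x ** transpose M"] by (simp only: matrix_mul_assoc)
    also have "\<dots> = trace (dU_mat s y (T' v) ** V_mat s y ** (M ** transpose M))"
      by (simp only: U_V matrix_mul_rid matrix_mul_assoc)
    also have "\<dots> = 0"
      by (simp add: Mo trace_dU_V)
    finally have 2: "trace ((V_mat s x ** transpose M) ** dU_mat s y (T' v) ** ti) = 0" .
    have "dV_mat s x v ** transpose M ** U_mat s y ** ti = dV_mat s x v ** (transpose M ** (U_mat s y ** V_mat s y) ** M) ** U_mat s x"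
      by (simp only: ti_def matrix_mul_assoc)
    also have "\<dots> = dV_mat s x v ** U_mat s x"
      by (simp add: U_V Mo)
    finally have 3: "trace (dV_mat s x v ** transpose M ** U_mat s y ** ti) = 0"
      by (simp add: trace_dV_U)
    have "t' v ** ti = (V_mat s x ** transpose M) ** dU_mat s y (T' v) ** ti + dV_mat s x v ** transpose M ** U_mat s y ** ti"
      by (simp add: t'_def distr)
    then show ?thesis
      using 2 3 by (simp add: trace_add)
  qed
  \<comment> \<open>The corner entry of t coincides with \<open>scale_factor\<close> on the open
    chart domain, hence so do the derivatives.\<close>
  have "t' v $ None $ None = dscale_factor M (fst x) (fst v)" for v
  proof -
    have "((\<lambda>x. t_loc s M x $ None $ None) has_derivative (\<lambda>v. t' v $ None $ None)) (at x)"
      by (intro has_derivative_nth D)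
    then have "((\<lambda>x. scale_factor M (fst x)) has_derivative (\<lambda>v. t' v $ None $ None)) (at x)"
    proof (rule has_derivative_transform_within_open[OF _ open_chart_domain])
      fix z
      assume "z \<in> {z. (M *v pvec z) $ None \<noteq> 0}"
      then have "linked M s z (trans_map M s z) (scale_factor M (fst z))"
        by (simp add: linked_iff[OF M])
      from arg_cong[OF t_loc_e(1)[OF s M this], of "\<lambda>v. v $ None"]
      show "t_loc s M z $ None $ None = scale_factor M (fst z)"
        by (simp add: t_loc_def e_last_def matrix_axis)
    qed (use x in simp)
    moreover have "((\<lambda>x. scale_factor M (fst x)) has_derivative (\<lambda>v. dscale_factor M (fst x) (fst v))) (at x)"
      using x by (intro has_derivative_compose[OF has_derivative_fst' has_derivative_scale_factor]) (simp add: pvec_def)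
    ultimately show ?thesis
      using has_derivative_unique by metis
  qed
  note t'_None = this
  have "ti *v e_last = (1 / d) *s e_last"
  proof -
    have "M *v pvec x = (1 / d) *s pvec y"
      using d by (simp add: p vec_eq_iff)
    then show ?thesis
      by (simp add: ti_def matrix_vector_mul_assoc[symmetric] U_e vector_scalar_commute V_p)
  qed
  then have "(t' v ** ti) *v e_last = (1 / d) *s (t' v *v e_last)" for v
    by (simp add: matrix_vector_mul_assoc[symmetric] vector_scalar_commute)
  from arg_cong[OF this, of "\<lambda>v. v $ None"] have nn: "(t' v ** ti) $ None $ None = dscale_factor M (fst x) (fst v) / d" for v
    by (simp add: e_last_def matrix_axis t'_None)
  show ?thesis
    by (rule that[OF D]) (simp add: mi lambda_pairing_eq tr nn d_def)
qed

section \<open>Projective charts and the gluing rule\<close>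

lemma proj_point_eq_iff: "proj_point a = proj_point b \<longleftrightarrow> (\<exists>c. c \<noteq> 0 \<and> a = c *s b)"
proof
  assume "proj_point a = proj_point b"
  moreover have "a \<in> proj_point a"
    unfolding proj_point_def by (intro CollectI exI[of _ 1]) simp
  ultimately show "\<exists>c. c \<noteq> 0 \<and> a = c *s b"
    by (auto simp: proj_point_def)
next
  assume "\<exists>c. c \<noteq> 0 \<and> a = c *s b"
  then obtain c where c: "c \<noteq> 0" "a = c *s b"
    by blast
  have "\<exists>e. e \<noteq> 0 \<and> d *s b = e *s a" if "d \<noteq> 0" for d
    using that c by (intro exI[of _ "d / c"]) (simp add: vec_eq_iff)
  moreover have "\<exists>e. e \<noteq> 0 \<and> d *s a = e *s b" if "d \<noteq> 0" for d
    using that c by (intro exI[of _ "d * c"]) (simp add: vec_eq_iff)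
  ultimately show "proj_point a = proj_point b"
    unfolding proj_point_def by blast
qed

lemma phi_inv_eq: "phi_inv \<sigma> \<alpha> z = proj_point (\<sigma> \<alpha> *v snoc z 1)"
  using U_e[of 1 "(z, 0)"] by (simp add: phi_inv_def U_mat_def u_0 pvec_def)

lemma phi_inv_in_U: "phi_inv \<sigma> \<alpha> z \<in> U_chart \<beta> \<longleftrightarrow> (\<sigma> \<alpha> *v snoc z 1) $ \<beta> \<noteq> 0"
proof
  assume "(\<sigma> \<alpha> *v snoc z 1) $ \<beta> \<noteq> 0"
  then show "phi_inv \<sigma> \<alpha> z \<in> U_chart \<beta>"
    unfolding U_chart_def phi_inv_eq by blast
qed (auto simp: U_chart_def phi_inv_eq proj_point_eq_iff)

lemma phi_phi_inv:
  assumes \<sigma>: "sigma_family \<sigma>" and z: "(chg \<sigma> \<alpha> \<beta> *v snoc z 1) $ None \<noteq> 0"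
  shows "phi \<sigma> \<beta> (phi_inv \<sigma> \<alpha> z) = zmap (chg \<sigma> \<alpha> \<beta>) z"
  unfolding phi_def phi_inv_eq
proof (rule the_equality)
  let ?M = "chg \<sigma> \<alpha> \<beta>"
  have M: "orth ?M"
    by (rule orth_chg[OF \<sigma>])
  \<comment> \<open>With s = 0 and \<xi> = 0 the vector q is 0, so \<open>linked_iff\<close>
    specialises to its projective part for p.\<close>
  have "linked ?M 0 (z, 0) (trans_map ?M 0 (z, 0)) (scale_factor ?M z)"
    using z by (simp add: linked_iff[OF M] pvec_def)
  then have "scale_factor ?M z \<noteq> 0" and p: "snoc (zmap ?M z) 1 = scale_factor ?M z *s (?M *v snoc z 1)"
    by (simp_all add: linked_def pvec_def trans_map_def)
  have "\<sigma> \<beta> *v snoc (zmap ?M z) 1 = scale_factor ?M z *s (\<sigma> \<alpha> *v snoc z 1)"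
    by (simp add: p vector_scalar_commute sigma_chg[OF \<sigma>])
  then show "proj_point (\<sigma> \<alpha> *v snoc z 1) = proj_point (\<sigma> \<beta> *v snoc (zmap ?M z) 1)"
    using \<open>scale_factor ?M z \<noteq> 0\<close> proj_point_eq_iff by metis
  fix z'
  assume "proj_point (\<sigma> \<alpha> *v snoc z 1) = proj_point (\<sigma> \<beta> *v snoc z' 1)"
  then obtain c where c: "c \<noteq> 0" "\<sigma> \<alpha> *v snoc z 1 = c *s (\<sigma> \<beta> *v snoc z' 1)"
    by (auto simp: proj_point_eq_iff)
  have "?M *v snoc z 1 = c *s snoc z' 1"
    by (simp add: chg_apply c(2) vector_scalar_commute orth_cancel(1)[OF sigma_orth(1)[OF \<sigma>]])
  then show "z' = zmap ?M z"
    using c(1) by (simp add: zmap_def scale_factor_def vec_eq_iff)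
qed

lemma covector_zero: "(\<And>v. covector a v = 0) \<Longrightarrow> a = 0"
proof -
  assume *: "\<And>v. covector a v = 0"
  have "a $ i = 0" for i
    using *[of "axis i 1"] by (simp add: covector_def axis_def if_distrib[of "\<lambda>x. _ * x"] cong: if_cong)
  then show ?thesis
    by (simp add: vec_eq_iff)
qed

text \<open>A kernel vector would combine (v, 0) and (z, 1) to 0, which the last entry excludes
  unless v = 0. Surjectivity lets the covector \<xi> of the second chart be recovered from its
  values on images.\<close>

lemma surj_dzmap:
  assumes M: "orth M" and z: "(M *v snoc z 1) $ None \<noteq> 0"
  shows "surj (dzmap M z)"
proof (rule linear_inj_imp_surj)
  show lin: "linear (dzmap M z)"
    by (rule has_derivative_linear[OF has_derivative_zmap[OF z]])
  show "inj (dzmap M z)"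
  proof (rule linear_injective_0[OF lin, THEN iffD2], intro allI impI)
    fix v
    assume "dzmap M z v = 0"
    moreover have "snoc 0 0 = (0 :: 'a cvec)"
      by (auto simp: vec_eq_iff snoc_def split: option.split)
    ultimately have "scale_factor M z *s (M *v snoc v 0) + dscale_factor M z v *s (M *v snoc z 1) = 0"
      using snoc_dzmap[OF z, of v] by simp
    then have "transpose M *v (M *v (scale_factor M z *s snoc v 0 + dscale_factor M z v *s snoc z 1)) = 0"
      by (simp add: matrix_vector_right_distrib vector_scalar_commute)
    then have eq: "(scale_factor M z *s snoc v 0 + dscale_factor M z v *s snoc z 1) $ i = 0" for i
      by (simp only: orth_cancel(1)[OF M] zero_index)
    have "dscale_factor M z v = 0"
      using eq[of None] by simp
    moreover have "scale_factor M z \<noteq> 0"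
      using z by (simp add: scale_factor_def)
    ultimately have "v $ k = 0" for k
      using eq[of "Some k"] by simp
    then show "v = 0"
      by (simp add: vec_eq_iff)
  qed
qed

text \<open>The affine correction by lambda is exactly what the orbit relation predicts: the new q
  is paired with the derivative of the new p = d M p, and the derivative of d contributes s d' /
  d.\<close>

lemma glue_rel_iff:
  assumes \<sigma>: "sigma_family \<sigma>" and s: "s \<noteq> 0"
  shows "((\<alpha>, x), (\<beta>, y)) \<in> glue_rel s \<sigma> \<longleftrightarrow> (\<exists>d. linked (chg \<sigma> \<alpha> \<beta>) s x y d)"
proof (cases "(chg \<sigma> \<alpha> \<beta> *v pvec x) $ None = 0")
  case True
  have "phi_inv \<sigma> \<alpha> (fst x) \<notin> U_chart \<beta>"
    using True chg_None[OF \<sigma>, of \<alpha> \<beta> "pvec x"] by (simp add: phi_inv_in_U pvec_def)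
  then show ?thesis
    using True by (cases x; cases y) (simp add: glue_rel_def linked_iff[OF orth_chg[OF \<sigma>]])
next
  case False
  define M where "M = chg \<sigma> \<alpha> \<beta>"
  have M: "orth M"
    unfolding M_def by (rule orth_chg[OF \<sigma>])
  have x: "(M *v pvec x) $ None \<noteq> 0" and z: "(M *v snoc (fst x) 1) $ None \<noteq> 0"
    using False by (simp_all add: M_def pvec_def)
  define T where "T = trans_map M s x"
  define d where "d = scale_factor M (fst x)"
  have l: "linked M s x T d"
    using x by (simp add: linked_iff[OF M] T_def d_def)
  have d0: "d \<noteq> 0"
    using l by (simp add: linked_def)
  have U: "phi_inv \<sigma> \<alpha> (fst x) \<in> U_chart \<alpha> \<inter> U_chart \<beta>"
  proof
    have "(chg \<sigma> \<alpha> \<alpha> *v snoc (fst x) 1) $ None = 1"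
      by (simp add: chg_apply orth_cancel(1)[OF sigma_orth(1)[OF \<sigma>]])
    then show "phi_inv \<sigma> \<alpha> (fst x) \<in> U_chart \<alpha>"
      using chg_None[OF \<sigma>, of \<alpha> \<alpha> "snoc (fst x) 1"] by (simp add: phi_inv_in_U)
    show "phi_inv \<sigma> \<alpha> (fst x) \<in> U_chart \<beta>"
      using False chg_None[OF \<sigma>, of \<alpha> \<beta> "snoc (fst x) 1"] by (simp add: phi_inv_in_U pvec_def)
  qed
  have phi_x: "(phi \<sigma> \<beta> \<circ> phi_inv \<sigma> \<alpha>) (fst x) = fst T"
    using phi_phi_inv[OF \<sigma> z[unfolded M_def]] by (simp add: T_def trans_map_def M_def)
  have D_phi: "frechet_derivative (phi \<sigma> \<beta> \<circ> phi_inv \<sigma> \<alpha>) (at (fst x)) = dzmap M (fst x)"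
  proof (rule frechet_derivative_at[symmetric], rule has_derivative_transform_within_open[OF has_derivative_zmap[OF z]])
    have "isCont (\<lambda>z. (M *v snoc z 1) $ None) z" for z
      by (rule has_derivative_continuous[OF has_derivative_nth[OF has_derivative_matrix[OF
          has_derivative_snoc[OF has_derivative_ident has_derivative_const]]]])
    then have "open ((\<lambda>z. (M *v snoc z 1) $ None) -` (- {0}))"
      by (intro open_vimage) (auto simp: continuous_on_eq_continuous_at)
    then show "open {z. (M *v snoc z 1) $ None \<noteq> 0}"
      by (simp add: vimage_def)
    show "fst x \<in> {z. (M *v snoc z 1) $ None \<noteq> 0}"
      using z by simp
  qed (simp add: phi_phi_inv[OF \<sigma>] M_def)
  obtain t' where t': "(t_loc s M has_derivative t') (at x)"
    "\<And>v. lambda_pairing s (t' v ** matrix_inv (t_loc s M x)) = - s * dscale_factor M (fst x) (fst v) / d"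
    using t_loc_pairing[OF s M x] unfolding d_def by blast
  have D_t: "frechet_derivative (t_mat s \<sigma> \<alpha> \<beta>) (at x) = t'"
    by (rule frechet_derivative_at[symmetric], rule has_derivative_transform_within_open[OF t'(1) open_chart_domain[of M]])
      (use x in \<open>simp_all add: M_def t_mat_eq[OF \<sigma> s]\<close>)
  \<comment> \<open>The term d M dp pairs with q(T) to \<xi> v because d q(T) = M q(x); the term d'
    M p pairs to s d' / d because p . q = s.\<close>
  have pairing: "covector (snd x) v + s * dscale_factor M (fst x) v / d = covector (snd T) (dzmap M (fst x) v)" for v
  proof -
    have "covector (qvec s T) (snoc (dzmap M (fst x) v) 0) =
      d * covector (qvec s T) (M *v snoc v 0) + dscale_factor M (fst x) v * covector (qvec s T) (M *v snoc (fst x) 1)"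
      by (simp add: snoc_dzmap[OF z] covector_add covector_scale d_def)
    also have "d * covector (qvec s T) (M *v snoc v 0) = covector (M *v qvec s x) (M *v snoc v 0)"
      using l by (simp add: linked_def covector_scale[symmetric])
    also have "\<dots> = covector (snd x) v"
      by (simp add: covector_orth[OF M] qvec_def covector_snoc)
    also have "covector (qvec s T) (M *v snoc (fst x) 1) = s / d"
    proof -
      have "covector (qvec s T) (M *v snoc (fst x) 1) = covector (d *s qvec s T) (M *v pvec x) / d"
        using d0 by (simp add: covector_scale pvec_def)
      also have "\<dots> = s / d"
        using l by (simp add: linked_def covector_orth[OF M] covector_commute[of "qvec s x"] covector_pq)
      finally show ?thesis .
    qed
    finally show ?thesis
      by (simp add: qvec_def covector_snoc mult.commute)
  qed
  have "((\<alpha>, x), (\<beta>, y)) \<in> glue_rel s \<sigma> \<longleftrightarrow> fst y = fst T \<and>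
      (\<forall>v. covector (snd y) (dzmap M (fst x) v) = covector (snd x) v + s * dscale_factor M (fst x) v / d)"
  proof -
    have "((\<alpha>, x), (\<beta>, y)) \<in> glue_rel s \<sigma> \<longleftrightarrow> phi_inv \<sigma> \<alpha> (fst x) \<in> U_chart \<alpha> \<inter> U_chart \<beta> \<and>
      fst y = (phi \<sigma> \<beta> \<circ> phi_inv \<sigma> \<alpha>) (fst x) \<and>
     (\<forall>v v'. covector (snd y) (frechet_derivative (phi \<sigma> \<beta> \<circ> phi_inv \<sigma> \<alpha>) (at (fst x)) v) =
        covector (snd x) v - lambda_pairing s
          (frechet_derivative (t_mat s \<sigma> \<alpha> \<beta>) (at (fst x, snd x)) (v, v') ** matrix_inv (t_mat s \<sigma> \<alpha> \<beta> (fst x, snd x))))"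
      unfolding glue_rel_def by (cases x; cases y) auto
    then show ?thesis
      using U by (simp only: phi_x D_phi prod.collapse D_t t_mat_eq[OF \<sigma> s False] M_def[symmetric] t'(2)) simp
  qed
  also have "\<dots> \<longleftrightarrow> y = T"
  proof
    assume *: "fst y = fst T \<and> (\<forall>v. covector (snd y) (dzmap M (fst x) v) = covector (snd x) v + s * dscale_factor M (fst x) v / d)"
    have "covector (snd y - snd T) v = 0" for v
    proof -
      obtain u where "v = dzmap M (fst x) u"
        using surj_dzmap[OF M z] by (metis surj_def)
      then show ?thesis
        using * pairing[of u] by (simp add: covector_diff)
    qed
    then have "snd y - snd T = 0"
      by (rule covector_zero)
    with * show "y = T"
      by (simp add: prod_eq_iff)
  qed (simp add: pairing)
  also have "\<dots> \<longleftrightarrow> (\<exists>d. linked M s x y d)"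
    using x by (simp add: linked_iff[OF M] T_def)
  finally show ?thesis
    by (simp add: M_def)
qed

section \<open>The charts of the twisted cotangent bundle\<close>

lemma linked_sym:
  assumes M: "orth M" and l: "linked M s x y d"
  shows "linked (transpose M) s y x (1 / d)"
proof -
  have d: "d \<noteq> 0" and p: "pvec y = d *s (M *v pvec x)" and q: "M *v qvec s x = d *s qvec s y"
    using l by (simp_all add: linked_def)
  have "transpose M *v pvec y = d *s pvec x"
    by (simp add: p vector_scalar_commute orth_cancel[OF M])
  moreover have "d *s (transpose M *v qvec s y) = qvec s x"
    by (simp add: vector_scalar_commute[symmetric] q[symmetric] orth_cancel[OF M])
  then have "(1 / d) *s qvec s x = transpose M *v qvec s y"
    by (rule scale_cancel[OF d, symmetric])
  ultimately show ?thesis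
    using d by (simp add: linked_def)
qed

lemma linked_trans:
  assumes "linked M s x y d" "linked N s y w e"
  shows "linked (N ** M) s x w (d * e)"
proof -
  have y: "pvec y = d *s (M *v pvec x)" "d *s qvec s y = M *v qvec s x"
    and w: "pvec w = e *s (N *v pvec y)" "e *s qvec s w = N *v qvec s y"
    using assms by (simp_all add: linked_def)
  have "pvec w = (d * e) *s (N *v (M *v pvec x))"
    by (simp add: w(1) y(1) vector_scalar_commute mult.commute)
  moreover have "(d * e) *s qvec s w = N *v (d *s qvec s y)"
    by (simp add: w(2)[symmetric] vector_scalar_commute)
  ultimately show ?thesis
    using assms by (simp add: linked_def matrix_vector_mul_assoc y(2))
qed

lemma chg_mult: "sigma_family \<sigma> \<Longrightarrow> chg \<sigma> \<beta> \<gamma> ** chg \<sigma> \<alpha> \<beta> = chg \<sigma> \<alpha> \<gamma>"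
proof -
  assume "sigma_family \<sigma>"
  then have "\<sigma> \<beta> ** transpose (\<sigma> \<beta>) = mat 1"
    using sigma_orth(1) orth_def by blast
  moreover have "chg \<sigma> \<beta> \<gamma> ** chg \<sigma> \<alpha> \<beta> = transpose (\<sigma> \<gamma>) ** (\<sigma> \<beta> ** transpose (\<sigma> \<beta>)) ** \<sigma> \<alpha>"
    by (simp only: chg_def matrix_mul_assoc)
  ultimately show ?thesis
    by (simp add: chg_def)
qed

lemma chg_self: "sigma_family \<sigma> \<Longrightarrow> chg \<sigma> \<alpha> \<alpha> = mat 1"
  using sigma_orth(1) by (auto simp: chg_def orth_def)

lemma Z_point_eq:
  fixes x :: "('n::{finite,linorder}) coords"
  assumes "sigma_family \<sigma>" "s \<noteq> 0"
  shows "Z_point s \<sigma> \<alpha> x = {(\<beta>, y). \<exists>d. linked (chg \<sigma> \<alpha> \<beta>) s x y d}"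
proof (rule set_eqI)
  fix p :: "'n option \<times> 'n coords"
  obtain \<beta> y where p: "p = (\<beta>, y)"
    by (cases p)
  show "p \<in> Z_point s \<sigma> \<alpha> x \<longleftrightarrow> p \<in> {(\<beta>, y). \<exists>d. linked (chg \<sigma> \<alpha> \<beta>) s x y d}"
    by (simp only: p Z_point_def Image_singleton_iff glue_rel_iff[OF assms] mem_Collect_eq prod.case)
qed

text \<open>\<open>linked\<close> is reflexive, symmetric and transitive along the matrices
  \<open>chg\<close>, with multipliers 1, 1/d and d e, so the classes behave as equivalence
  classes.\<close>

lemma Z_point_eq_iff:
  assumes \<sigma>: "sigma_family \<sigma>" and s: "s \<noteq> 0"
  shows "Z_point s \<sigma> \<alpha> x = Z_point s \<sigma> \<beta> y \<longleftrightarrow> (\<exists>d. linked (chg \<sigma> \<alpha> \<beta>) s x y d)"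
proof
  have "linked (chg \<sigma> \<beta> \<beta>) s y y 1"
    by (simp add: chg_self[OF \<sigma>] linked_def)
  then have "(\<beta>, y) \<in> Z_point s \<sigma> \<beta> y"
    by (auto simp: Z_point_eq[OF assms])
  then show "\<exists>d. linked (chg \<sigma> \<alpha> \<beta>) s x y d" if "Z_point s \<sigma> \<alpha> x = Z_point s \<sigma> \<beta> y"
    using \<open>(\<beta>, y) \<in> Z_point s \<sigma> \<beta> y\<close> unfolding that[symmetric] by (simp add: Z_point_eq[OF assms])
next
  assume "\<exists>d. linked (chg \<sigma> \<alpha> \<beta>) s x y d"
  then obtain d where d: "linked (chg \<sigma> \<alpha> \<beta>) s x y d"
    by blast
  have d': "linked (chg \<sigma> \<beta> \<alpha>) s y x (1 / d)"
    using linked_sym[OF orth_chg[OF \<sigma>] d] by (simp add: transpose_chg)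
  have "(\<exists>e. linked (chg \<sigma> \<alpha> \<gamma>) s x w e) \<longleftrightarrow> (\<exists>e. linked (chg \<sigma> \<beta> \<gamma>) s y w e)" for \<gamma> w
    using linked_trans[OF d, of "chg \<sigma> \<beta> \<gamma>" w] linked_trans[OF d', of "chg \<sigma> \<alpha> \<gamma>" w]
    unfolding chg_mult[OF \<sigma>] by blast
  then show "Z_point s \<sigma> \<alpha> x = Z_point s \<sigma> \<beta> y"
    by (simp add: Z_point_eq[OF assms])
qed

lemma Z_transition_eq:
  assumes \<sigma>: "sigma_family \<sigma>" and s: "s \<noteq> 0" and x: "(chg \<sigma> \<alpha> \<beta> *v pvec x) $ None \<noteq> 0"
  shows "Z_transition s \<sigma> \<alpha> \<beta> x = trans_map (chg \<sigma> \<alpha> \<beta>) s x"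
  unfolding Z_transition_def Z_coord_def comp_def Z_point_eq_iff[OF \<sigma> s] linked_iff[OF orth_chg[OF \<sigma>]]
  by (rule the_equality) (use x in auto)

lemma Z_transition_derivative:
  assumes \<sigma>: "sigma_family \<sigma>" and s: "s \<noteq> 0" and eq: "Z_point s \<sigma> \<alpha> x = Z_point s \<sigma> \<beta> y"
  obtains d d' where "linked (chg \<sigma> \<alpha> \<beta>) s x y d"
    and "\<And>v. dlinked (chg \<sigma> \<alpha> \<beta>) s x y d v (frechet_derivative (Z_transition s \<sigma> \<alpha> \<beta>) (at x) v) (d' v)"
proof -
  let ?M = "chg \<sigma> \<alpha> \<beta>"
  obtain d where l: "linked ?M s x y d"
    using eq by (auto simp: Z_point_eq_iff[OF \<sigma> s])
  then have x: "(?M *v pvec x) $ None \<noteq> 0" and d: "d = scale_factor ?M (fst x)" and y: "y = trans_map ?M s x"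
    by (simp_all add: linked_iff[OF orth_chg[OF \<sigma>]])
  obtain T' where T': "(trans_map ?M s has_derivative T') (at x)"
    and dl: "\<And>v. dlinked ?M s x (trans_map ?M s x) (scale_factor ?M (fst x)) v (T' v) (dscale_factor ?M (fst x) (fst v))"
    using trans_map_derivative[OF orth_chg[OF \<sigma>] x] by blast
  have "(Z_transition s \<sigma> \<alpha> \<beta> has_derivative T') (at x)"
    by (rule has_derivative_transform_within_open[OF T' open_chart_domain[of ?M]])
      (use x in \<open>simp_all add: Z_transition_eq[OF \<sigma> s]\<close>)
  then have "frechet_derivative (Z_transition s \<sigma> \<alpha> \<beta>) (at x) = T'"
    by (rule frechet_derivative_at[symmetric])
  with l dl show ?thesis
    by (intro that[of d "\<lambda>v. dscale_factor ?M (fst x) (fst v)"]) (simp_all add: d y)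
qed

text \<open>Conjugating the decomposition of \<open>lambda_vee\<close> produces the rank one term s
  p (q/s), with both vectors rotated by \<open>\<sigma> \<alpha>\<close>.\<close>

lemma mu_loc:
  fixes x :: "('n::{finite,linorder}) coords"
  assumes \<sigma>: "sigma_family \<sigma>" and s: "s \<noteq> 0"
  shows "(h_mat s \<sigma> \<alpha> x ** lambda_vee s ** matrix_inv (h_mat s \<sigma> \<alpha> x)) $ i $ j =
    (if i = j then s / of_nat (CARD('n) + 1) else 0) - (\<sigma> \<alpha> *v pvec x) $ i * (\<sigma> \<alpha> *v qvec s x) $ j"
proof -
  have \<sigma>o: "\<sigma> \<alpha> ** transpose (\<sigma> \<alpha>) = mat 1"
    using sigma_orth(1)[OF \<sigma>, of \<alpha>] by (simp add: orth_def)
  have "h_mat s \<sigma> \<alpha> x ** (V_mat s x ** transpose (\<sigma> \<alpha>)) = \<sigma> \<alpha> ** (U_mat s x ** V_mat s x) ** transpose (\<sigma> \<alpha>)"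
    by (simp only: h_mat_eq matrix_mul_assoc)
  then have inv: "h_mat s \<sigma> \<alpha> x ** (V_mat s x ** transpose (\<sigma> \<alpha>)) = mat 1"
    by (simp add: U_V \<sigma>o)
  show ?thesis
    unfolding lambda_vee_conj matrix_inv_eqI[OF inv] inv
    using s by (simp add: h_mat_eq matrix_vector_mul_assoc[symmetric] U_e matrix_transpose_mul V_e vector_scalar_commute)
      (simp add: mat_def)
qed

text \<open>The product of entries of p and q is unchanged along orbits, so the image set in
  \<open>mu_plus\<close> is a singleton. Expanding the trace, the part beyond |p|^2 |q|^2 is
  cancelled by the constant added in \<open>tau\<close>.\<close>

lemma tau_Z_point:
  fixes x :: "('n::{finite,linorder}) coords"
  assumes \<sigma>: "sigma_family \<sigma>" and s: "s \<noteq> 0"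
  shows "tau s \<sigma> (Z_point s \<sigma> \<alpha> x) = tau_loc s x"
proof -
  define c where "c = s / of_nat (CARD('n) + 1)"
  define P where "P = \<sigma> \<alpha> *v pvec x"
  define Q where "Q = \<sigma> \<alpha> *v qvec s x"
  define m :: "'n cmat" where "m = (\<chi> i j. (if i = j then c else 0) - P $ i * Q $ j)"
  have const: "h_mat s \<sigma> \<beta> y ** lambda_vee s ** matrix_inv (h_mat s \<sigma> \<beta> y) = m"
    if l: "linked (chg \<sigma> \<alpha> \<beta>) s x y d" for \<beta> y d
  proof -
    have y: "pvec y = d *s (chg \<sigma> \<alpha> \<beta> *v pvec x)" "d *s qvec s y = chg \<sigma> \<alpha> \<beta> *v qvec s x"
      using l by (simp_all add: linked_def)
    have p: "\<sigma> \<beta> *v pvec y = d *s P"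
      by (simp add: y(1) vector_scalar_commute sigma_chg[OF \<sigma>] P_def)
    have q: "d *s (\<sigma> \<beta> *v qvec s y) = Q"
      by (simp only: vector_scalar_commute[symmetric] y(2) sigma_chg[OF \<sigma>] Q_def)
    have "(\<sigma> \<beta> *v pvec y) $ i * (\<sigma> \<beta> *v qvec s y) $ j = P $ i * Q $ j" for i j
      by (simp add: p q[symmetric])
    then show ?thesis
      unfolding vec_eq_iff mu_loc[OF \<sigma> s] by (simp add: m_def c_def)
  qed
  have "linked (chg \<sigma> \<alpha> \<alpha>) s x x 1"
    by (simp add: chg_self[OF \<sigma>] linked_def)
  then have "(\<alpha>, x) \<in> Z_point s \<sigma> \<alpha> x"
    by (auto simp only: Z_point_eq[OF \<sigma> s] mem_Collect_eq prod.case)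
  then have mu: "mu_plus s \<sigma> (Z_point s \<sigma> \<alpha> x) = m"
    unfolding mu_plus_def
  proof (intro the_elem_image_unique)
    fix p
    assume "p \<in> Z_point s \<sigma> \<alpha> x"
    then obtain \<beta> y d where "p = (\<beta>, y)" "linked (chg \<sigma> \<alpha> \<beta>) s x y d"
      by (cases p) (auto simp only: Z_point_eq[OF \<sigma> s] mem_Collect_eq prod.case)
    then show "(case p of (\<alpha>, x) \<Rightarrow> h_mat s \<sigma> \<alpha> x ** lambda_vee s ** matrix_inv (h_mat s \<sigma> \<alpha> x)) = m"
      using const by (simp only: prod.case)
  qed blast
  have PQ: "(\<Sum>i\<in>UNIV. P $ i * Q $ i) = s"
    using covector_orth[OF sigma_orth(1)[OF \<sigma>], of \<alpha> "pvec x" "qvec s x"]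
    by (simp add: covector_pq P_def Q_def) (simp add: covector_def)
  have "trace (m ** adj m) = (\<Sum>i\<in>UNIV. \<Sum>j\<in>UNIV. m $ i $ j * cnj (m $ i $ j))"
    by (simp add: trace_def matrix_matrix_mult_def adj_def)
  also have "\<dots> = (\<Sum>i\<in>UNIV. \<Sum>j\<in>UNIV. (if j = i then c * cnj c - c * cnj (P $ i * Q $ i) - cnj c * (P $ i * Q $ i) else 0)
      + P $ i * cnj (P $ i) * (Q $ j * cnj (Q $ j)))"
    by (intro sum.cong refl) (auto simp: m_def algebra_simps)
  also have "\<dots> = (\<Sum>i\<in>UNIV. c * cnj c - c * cnj (P $ i * Q $ i) - cnj c * (P $ i * Q $ i)) + herm P P * herm Q Q"
    by (simp add: sum.distrib herm_def sum_product)
  also have "(\<Sum>i\<in>UNIV. c * cnj c - c * cnj (P $ i * Q $ i) - cnj c * (P $ i * Q $ i)) =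
     of_nat (CARD('n) + 1) * (c * cnj c) - c * cnj s - cnj c * s"
    by (simp add: sum_subtractf sum_distrib_left[symmetric] PQ[symmetric] card_option)
  \<comment> \<open>With c = s/(n+1) the three terms are one and twice minus one copy of
    |s|^2/(n+1).\<close>
  also have "\<dots> = - of_real ((cmod s)\<^sup>2 / real (CARD('n) + 1))"
  proof -
    define N where "N = (of_nat (CARD('n) + 1) :: complex)"
    have N: "N \<noteq> 0" "cnj N = N"
      unfolding N_def by (metis of_nat_0_eq_iff Suc_eq_plus1 nat.distinct(1)) (simp only: complex_cnj_of_nat)
    show ?thesis
      unfolding of_real_divide complex_norm_square c_def of_real_of_nat_eq N_def[symmetric] complex_cnj_divide N(2)
      using N(1) by (simp add: field_simps)
  qed
  finally have "Re (trace (m ** adj m)) = nsq P * nsq Q - (cmod s)\<^sup>2 / real (CARD('n) + 1)"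
    by (simp add: herm_self)
  then show ?thesis
    by (simp add: tau_def mu tau_loc_def P_def Q_def nsq_orth[OF sigma_orth(1)[OF \<sigma>]])
qed

text \<open>Since (del_bar - del) tau at u is i times dtau at i u, this makes i/4 (del_bar - del)
  tau equal to \<open>theta0\<close>.\<close>

lemma dtau_mult_i: "dtau s x (mult_i u) = - 4 * theta0 s x u"
  by (simp add: dtau_def theta0_def mult_i_eq dpvec_simps dqvec_simps herm_scale algebra_simps)

text \<open>Differentiability of f at tau ensures that the Frechet derivatives in the formula are
  genuine and commute with the embedding of the reals.\<close>

lemma omega_I_formula_eq:
  fixes x :: "('n::{finite,linorder}) coords"
  assumes \<sigma>: "sigma_family \<sigma>" and s: "s \<noteq> 0"
    and f: "(f_fun CARD('n) ((cmod s)\<^sup>2) a has_real_derivative f') (at (tau_loc s x))"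
  shows "omega_I_formula s \<sigma> a \<alpha> x v w =
    ext_deriv (\<lambda>y u. f_fun CARD('n) ((cmod s)\<^sup>2) a (tau_loc s y) * theta0 s y u) x v w"
proof -
  let ?F = "\<lambda>u y. f_fun CARD('n) ((cmod s)\<^sup>2) a (tau_loc s y) * theta0 s y u"
  have del: "\<i> / 4 * of_real (f_fun CARD('n) ((cmod s)\<^sup>2) a (tau_loc s y)) * (del_bar (tau_loc s) y u - del (tau_loc s) y u)
      = of_real (?F u y)" for y u
  proof -
    have "frechet_derivative (tau_loc s) (at y) = dtau s y"
      by (rule frechet_derivative_at[OF has_derivative_tau_loc, symmetric])
    then have "del_bar (tau_loc s) y u - del (tau_loc s) y u = \<i> * of_real (dtau s y (mult_i u))"
      by (simp add: del_def del_bar_def field_simps)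
    then show ?thesis
      by (simp add: dtau_mult_i mult.left_commute[of "of_real _" \<i>])
  qed
  have D: "((\<lambda>y. of_real (?F u y) :: complex) has_derivative (\<lambda>h. of_real (frechet_derivative (?F u) (at x) h))) (at x)" for u
    using ext_deriv_theta(2)[OF f, of u] unfolding frechet_derivative_works
    by (rule bounded_linear.has_derivative[OF bounded_linear_of_real])
  show ?thesis
    unfolding omega_I_formula_def tau_Z_point[OF \<sigma> s] del ext_deriv_def
      frechet_derivative_at[OF D, symmetric]
    by simp
qed

section \<open>The case a = 0\<close>

lemma omega_I_formula_0:
  fixes x :: "('n::{finite,linorder}) coords"
  assumes \<sigma>: "sigma_family \<sigma>" and s: "s \<noteq> 0"
  shows "omega_I_formula s \<sigma> 0 \<alpha> x = W_form s x"
proof (intro ext)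
  fix v w
  have f: "f_fun CARD('n) ((cmod s)\<^sup>2) 0 = (\<lambda>\<tau>. \<tau> powr (-1/2))"
    by (simp add: fun_eq_iff f_fun_def)
  have D: "(f_fun CARD('n) ((cmod s)\<^sup>2) 0 has_real_derivative (-1/2) * (tau_loc s x) powr (-1/2 - 1)) (at (tau_loc s x))"
    unfolding f by (rule has_real_derivative_powr[OF tau_loc_pos[OF s]])
  show "omega_I_formula s \<sigma> 0 \<alpha> x v w = W_form s x v w"
    unfolding omega_I_formula_eq[OF \<sigma> s D] W_form_ext_deriv[OF s] f by (simp add: theta_def[abs_def])
qed

lemma W_inj: "s \<noteq> 0 \<Longrightarrow> inj (W_form s x)"
proof (rule injI)
  fix u v
  assume s: "s \<noteq> 0" and eq: "W_form s x u = W_form s x v"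
  have "W_form s x (u - v) (mult_i (u - v)) = 0"
    using W_bilinear[of s x] by (simp add: bilinear_lsub eq)
  then show "u = v"
    using W_positive[OF s, of "u - v" x] by (cases "u - v = 0") auto
qed

text \<open>The real part of a complex bilinear form determines the imaginary part, by replacing w
  with -i w, and the imaginary part is nondegenerate.\<close>

lemma omega_J_inj: "inj (omega_J \<alpha> x)"
proof (rule injI)
  \<comment> \<open>The form \<open>omega_plus\<close> is independent of s, so the value s = 1 may
    be used to obtain nondegeneracy.\<close>
  interpret Q: quaternionic_chart "W_form 1" mult_i "J_op 1" "\<lambda>v w. Re (omega_plus v w)"
    "\<lambda>v w. Im (omega_plus v (w :: 'a coords))"
    by (rule quaternionic_chart_W) simp
  fix u v
  assume eq: "omega_J \<alpha> x u = omega_J \<alpha> x v"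
  have "Re (omega_plus u w) = Re (omega_plus v w)" for w
    using fun_cong[OF eq, of w] by (simp add: omega_J_def)
  from this[of "cscale (- \<i>) _"] have "Im (omega_plus u w) = Im (omega_plus v w)" for w
    by (simp add: omega_plus_simps)
  then have "u - v = 0"
    by (intro Q.K_nondegenerate) (simp add: Q.K_simps)
  then show "u = v"
    by simp
qed

text \<open>In \<open>J_struct\<close> the inverse is taken among all functions on the tangent
  space; injectivity together with an explicit preimage fixes its value.\<close>

lemma J_struct_W: "s \<noteq> 0 \<Longrightarrow> J_struct (\<lambda>\<alpha>. W_form s) \<alpha> x = J_op s x"
proof
  fix v
  assume s: "s \<noteq> 0"
  have "omega_K \<alpha> x v = W_form s x (J_op s x v)"
    by (simp add: fun_eq_iff omega_K_def W_J[OF s])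
  then show "J_struct (\<lambda>\<alpha>. W_form s) \<alpha> x v = J_op s x v"
    by (simp add: J_struct_def inv_f_f[OF W_inj[OF s]])
qed

lemma K_struct_W: "s \<noteq> 0 \<Longrightarrow> K_struct (\<lambda>\<alpha>. W_form s) \<alpha> x = (\<lambda>v. mult_i (J_op s x v))"
proof
  fix v
  assume s: "s \<noteq> 0"
  interpret Q: quaternionic_chart "W_form s" mult_i "J_op s" "\<lambda>v w. Re (omega_plus v w)"
    "\<lambda>v w. Im (omega_plus v (w :: 'a coords))"
    by (rule quaternionic_chart_W[OF s])
  have "W_form s x v = omega_J \<alpha> x (mult_i (J_op s x v))"
    by (simp add: fun_eq_iff omega_J_def mult_i_eq omega_plus_simps Q.K_J)
  then show "K_struct (\<lambda>\<alpha>. W_form s) \<alpha> x v = mult_i (J_op s x v)"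
    by (simp add: K_struct_def inv_f_f[OF omega_J_inj])
qed

text \<open>Compatibility with coordinate changes comes from \<open>dlinked\<close>: their
  derivatives preserve the form and commute with I and J. The pointwise and differential identities
  come from the chart locale.\<close>

lemma hyperkaehler_W:
  fixes \<sigma> :: "('n::{finite,linorder}) option \<Rightarrow> 'n cmat"
  assumes \<sigma>: "sigma_family \<sigma>" and s: "s \<noteq> 0"
  shows "smooth_two_form s \<sigma> (\<lambda>\<alpha>. W_form s)"
    and "hyperkaehler s \<sigma> (\<lambda>\<alpha> x v w. W_form s x v (mult_i w)) I_struct
      (\<lambda>\<alpha>. J_op s) (\<lambda>\<alpha> x v. mult_i (J_op s x v))"
proof -
  interpret Q: quaternionic_chart "W_form s" mult_i "J_op s" "\<lambda>v w. Re (omega_plus v w)"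
    "\<lambda>v w. Im (omega_plus v (w :: 'n coords))"
    by (rule quaternionic_chart_W[OF s])
  define D where "D \<alpha> \<beta> x = frechet_derivative (Z_transition s \<sigma> \<alpha> \<beta>) (at x)" for \<alpha> \<beta> x
  have W_D: "W_form s x v w = W_form s y (D \<alpha> \<beta> x v) (D \<alpha> \<beta> x w)"
    and D_i: "D \<alpha> \<beta> x (mult_i v) = mult_i (D \<alpha> \<beta> x v)"
    and D_J: "D \<alpha> \<beta> x (J_op s x v) = J_op s y (D \<alpha> \<beta> x v)"
    if Z: "Z_point s \<sigma> \<alpha> x = Z_point s \<sigma> \<beta> y" for \<alpha> \<beta> x y v w
  proof -
    obtain d d' where l: "linked (chg \<sigma> \<alpha> \<beta>) s x y d"
      and dl: "\<And>v. dlinked (chg \<sigma> \<alpha> \<beta>) s x y d v (D \<alpha> \<beta> x v) (d' v)"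
      using Z_transition_derivative[OF \<sigma> s Z] unfolding D_def by blast
    note M = orth_chg[OF \<sigma>, of \<alpha> \<beta>]
    show "W_form s x v w = W_form s y (D \<alpha> \<beta> x v) (D \<alpha> \<beta> x w)"
      by (simp add: W_form_def dlinked_H[OF s M l dl dl])
    show "D \<alpha> \<beta> x (mult_i v) = mult_i (D \<alpha> \<beta> x v)"
      unfolding mult_i_eq by (rule dlinked_unique[OF s M l dl dlinked_cscale[OF dl]])
    show "D \<alpha> \<beta> x (J_op s x v) = J_op s y (D \<alpha> \<beta> x v)"
      by (rule dlinked_J[OF s M l dl dl])
  qed
  have lin_i: "bounded_linear (mult_i :: 'n coords \<Rightarrow> _)"
    using Q.linear_I by (simp add: linear_conv_bounded_linear)
  have W_vv: "W_form s x v v = 0" for x and v :: "'n coords"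
    using W_alternating[of s x v v] by simp
  show "smooth_two_form s \<sigma> (\<lambda>\<alpha>. W_form s)"
    unfolding smooth_two_form_def smooth_bilinear_field_def
    using W_bilinear smooth_W[OF s] W_D[unfolded D_def] W_vv by blast
  have metric: "Q.metric x v w = W_form s x v (mult_i w)" for x v w
    by (simp add: Q.metric_def)
  have bil: "bilinear (\<lambda>v w. W_form s x v (mult_i w))" for x :: "'n coords"
    unfolding bilinear_def by (intro conjI allI linearI; simp add: Q.form_simps Q.I_simps)
  have "riemannian_metric s \<sigma> (\<lambda>\<alpha> x v w. W_form s x v (mult_i w))"
    unfolding riemannian_metric_def smooth_bilinear_field_def
  proof (intro conjI allI impI)
    fix \<alpha> \<beta> x y v w
    assume "Z_point s \<sigma> \<alpha> x = Z_point s \<sigma> \<beta> y"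
    then show "W_form s x v (mult_i w) = W_form s y (frechet_derivative (Z_transition s \<sigma> \<alpha> \<beta>) (at x) v)
        (mult_i (frechet_derivative (Z_transition s \<sigma> \<alpha> \<beta>) (at x) w))"
      using W_D D_i unfolding D_def by metis
  qed (rule bil, rule smooth_W[OF s], rule Q.form_I_swap, rule W_positive[OF s], assumption)
  moreover have "smooth_endo_field s \<sigma> I_struct"
    unfolding smooth_endo_field_def I_struct_def
    using Q.linear_I smooth_const D_i[unfolded D_def] by blast
  moreover have "smooth_endo_field s \<sigma> (\<lambda>\<alpha>. J_op s)"
    unfolding smooth_endo_field_def
    using Q.linear_J smooth_J_op[OF s] D_J[unfolded D_def] by blast
  moreover have "smooth_endo_field s \<sigma> (\<lambda>\<alpha> x v. mult_i (J_op s x v))"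
    unfolding smooth_endo_field_def
  proof (intro conjI allI impI)
    show "linear (\<lambda>v. mult_i (J_op s x v))" for x :: "'n coords"
      by (rule linear_compose[OF Q.linear_J Q.linear_I, unfolded comp_def])
    show "smooth (\<lambda>x. mult_i (J_op s x v))" for v :: "'n coords"
      by (rule smooth_linear[OF lin_i smooth_J_op[OF s]])
    fix \<alpha> \<beta> x y v
    assume "Z_point s \<sigma> \<alpha> x = Z_point s \<sigma> \<beta> y"
    then show "frechet_derivative (Z_transition s \<sigma> \<alpha> \<beta>) (at x) (mult_i (J_op s x v)) =
       mult_i (J_op s y (frechet_derivative (Z_transition s \<sigma> \<alpha> \<beta>) (at x) v))"
      using D_i D_J unfolding D_def by metis
  qed
  moreover have g_I: "W_form s x (mult_i v) (mult_i (mult_i w)) = W_form s x v (mult_i w)" for x and v w :: "'n coords"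
    by (rule W_mult_i)
  moreover have g_J: "W_form s x (J_op s x v) (mult_i (J_op s x w)) = W_form s x v (mult_i w)" for x and v w :: "'n coords"
  proof -
    have "W_form s x (J_op s x v) (mult_i (J_op s x w)) = - Im (omega_plus v (J_op s x (mult_i w)))"
      by (simp add: W_J[OF s] Q.J_I Q.K_simps)
    also have "\<dots> = Im (omega_plus (J_op s x (mult_i w)) v)"
      by (subst omega_plus_alternating) simp
    also have "\<dots> = W_form s x v (mult_i w)"
      by (simp add: Q.K_J W_alternating[of s x v "mult_i w"])
    finally show ?thesis .
  qed
  moreover have "W_form s x (mult_i (J_op s x v)) (mult_i (mult_i (J_op s x w))) = W_form s x v (mult_i w)" for x and v w :: "'n coords"
    by (simp only: g_I g_J)
  moreover have "mult_i (mult_i v) = - v" "J_op s x (J_op s x v) = - v"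
    "mult_i (J_op s x (mult_i (J_op s x v))) = - v" for x and v :: "'n coords"
    by (simp_all add: Q.I_I Q.J_J Q.J_I Q.I_simps)
  moreover have "mult_i (J_op s x (mult_i (J_op s x v))) = - v" for x and v :: "'n coords"
    by (simp add: Q.I_I Q.J_J Q.J_I Q.I_simps)
  moreover have "levi_civita (\<lambda>\<alpha> x v w. W_form s x v (mult_i w)) (\<lambda>\<alpha>. Q.christoffel)"
    unfolding levi_civita_def
    using Q.christoffel_bilinear Q.christoffel_sym Q.metric_parallel[unfolded metric] by blast
  moreover have "parallel_endo (\<lambda>\<alpha>. Q.christoffel) I_struct"
    unfolding parallel_endo_def I_struct_def by (simp add: Q.christoffel_I_right)
  moreover have "parallel_endo (\<lambda>\<alpha>. Q.christoffel) (\<lambda>\<alpha>. J_op s)"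
    unfolding parallel_endo_def using Q.J_parallel by blast
  moreover have "parallel_endo (\<lambda>\<alpha>. Q.christoffel) (\<lambda>\<alpha> x v. mult_i (J_op s x v))"
    unfolding parallel_endo_def using Q.I_J_parallel by blast
  ultimately show "hyperkaehler s \<sigma> (\<lambda>\<alpha> x v w. W_form s x v (mult_i w)) I_struct
      (\<lambda>\<alpha>. J_op s) (\<lambda>\<alpha> x v. mult_i (J_op s x v))"
    unfolding hyperkaehler_def by (auto simp: I_struct_def)
qed

lemma provides_hyperkaehler_metric_0:
  fixes \<sigma> :: "('n::{finite,linorder}) option \<Rightarrow> 'n cmat"
  assumes \<sigma>: "sigma_family \<sigma>" and s: "s \<noteq> 0"
  shows "provides_hyperkaehler_metric s \<sigma> 0"
proof -
  have "J_struct (\<lambda>\<alpha>. W_form s) = (\<lambda>\<alpha>::'n option. J_op s)"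
    "K_struct (\<lambda>\<alpha>. W_form s) = (\<lambda>(\<alpha>::'n option) x v. mult_i (J_op s x v))"
    by (intro ext, simp only: J_struct_W[OF s] K_struct_W[OF s])+
  then have "hyperkaehler s \<sigma> (\<lambda>\<alpha> x v w. W_form s x v (I_struct \<alpha> x w)) I_struct
      (J_struct (\<lambda>\<alpha>. W_form s)) (K_struct (\<lambda>\<alpha>. W_form s))"
    using hyperkaehler_W(2)[OF \<sigma> s] by (simp only: I_struct_def)
  then show ?thesis
    unfolding provides_hyperkaehler_metric_def
    by (intro exI[of _ "\<lambda>\<alpha>. W_form s"] exI[of _ "\<lambda>\<alpha> x v w. W_form s x v (I_struct \<alpha> x w)"] conjI ballI impI
        allI refl hyperkaehler_W(1)[OF \<sigma> s] omega_I_formula_0[OF \<sigma> s, symmetric])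
qed

section \<open>The case a > 0\<close>

lemma f_fun_differentiable:
  assumes "a > 0" "\<tau> > \<tau>\<^sub>0" "\<tau>\<^sub>0 \<ge> 0"
  shows "\<exists>f'. (f_fun n \<tau>\<^sub>0 a has_real_derivative f') (at \<tau>)"
proof -
  have pos: "a + (\<tau> - \<tau>\<^sub>0) ^ n > 0" "\<tau> * (\<tau> - \<tau>\<^sub>0) > 0"
    using assms by (auto intro: add_pos_nonneg)
  have "((\<lambda>\<tau>. a + (\<tau> - \<tau>\<^sub>0) ^ n) has_real_derivative (0 + of_nat n * (1 - 0) * (\<tau> - \<tau>\<^sub>0) ^ (n - 1))) (at \<tau>)"
    by (auto intro!: derivative_eq_intros)
  from DERIV_fun_powr[OF this pos(1), of "1 / real n"]
  obtain D1 where D1: "((\<lambda>\<tau>. (a + (\<tau> - \<tau>\<^sub>0) ^ n) powr (1 / real n)) has_real_derivative D1) (at \<tau>)"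
    by blast
  have D2: "((\<lambda>\<tau>. \<tau> * (\<tau> - \<tau>\<^sub>0)) has_real_derivative (\<tau> + (\<tau> - \<tau>\<^sub>0))) (at \<tau>)"
    by (auto intro!: derivative_eq_intros)
  have "(a + (\<tau> - \<tau>\<^sub>0) ^ n) powr (1 / real n) / (\<tau> * (\<tau> - \<tau>\<^sub>0)) > 0"
    using pos by simp
  from DERIV_fun_powr[OF DERIV_divide[OF D1 D2] this, of "1/2"] less_imp_neq[OF pos(2), symmetric]
  obtain D where "((\<lambda>\<tau>. ((a + (\<tau> - \<tau>\<^sub>0) ^ n) powr (1 / real n) / (\<tau> * (\<tau> - \<tau>\<^sub>0))) powr (1/2)) has_real_derivative D) (at \<tau>)"
    by blast
  moreover have "f_fun n \<tau>\<^sub>0 a = (\<lambda>\<tau>. ((a + (\<tau> - \<tau>\<^sub>0) ^ n) powr (1 / real n) / (\<tau> * (\<tau> - \<tau>\<^sub>0))) powr (1/2))"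
    using assms(1) by (simp add: f_fun_def fun_eq_iff)
  ultimately show ?thesis
    by auto
qed

lemma f_fun_square:
  assumes "a > 0" "\<tau> > \<tau>\<^sub>0" "\<tau>\<^sub>0 \<ge> 0"
  shows "(f_fun n \<tau>\<^sub>0 a \<tau>)\<^sup>2 = (a + (\<tau> - \<tau>\<^sub>0) ^ n) powr (1 / real n) / (\<tau> * (\<tau> - \<tau>\<^sub>0))"
  using assms by (simp add: f_fun_def powr_half_sqrt)

text \<open>The points and the tangent vector below satisfy \<open>\<partial>\<tau>(v) = 0\<close>, so that only the term of
  \<open>\<omega>\<^sub>I(v, I v)\<close> with the factor \<open>f(\<tau>)\<close> survives; it is unbounded as the points approach the locus
  \<open>\<tau> = \<tau>\<^sub>0\<close>.\<close>

lemma omega_I_formula_near_minimum: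
  fixes \<sigma> :: "('n::{finite,linorder}) option \<Rightarrow> 'n cmat" and k :: 'n and e :: real
  assumes \<sigma>: "sigma_family \<sigma>" and s: "s \<noteq> 0" and a: "a > 0" and e: "e > 0"
  defines "x \<equiv> ((0, axis k (of_real e)) :: 'n coords)" and "v \<equiv> ((axis k 1, axis k (cnj s)) :: 'n coords)"
  shows "tau_loc s x = (cmod s)\<^sup>2 + e\<^sup>2"
    and "omega_I_formula s \<sigma> a \<alpha> x v (mult_i v) =
      2 * f_fun CARD('n) ((cmod s)\<^sup>2) a ((cmod s)\<^sup>2 + e\<^sup>2) * ((cmod s)\<^sup>2 + e\<^sup>2)"
proof -
  have ax: "(\<Sum>i\<in>UNIV. axis k (c::complex) $ i * d $ i) = c * d $ k" for c d
    by (simp add: axis_def if_distrib[of "\<lambda>x. x * _"] cong: if_cong)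
  have p: "pvec x = snoc 0 1" and q: "qvec s x = snoc (axis k (of_real e)) s"
    by (simp_all add: pvec_def qvec_def x_def)
  \<comment> \<open>The \<xi>-component \<open>cnj s\<close> of v is chosen so that dq, with entries
    \<open>cnj s\<close> and -e, is Hermitian orthogonal to q, with entries e and s; dp is
    orthogonal to p as z = 0.\<close>
  have dp: "dpvec v = snoc (axis k 1) 0" and dq: "dqvec x v = snoc (axis k (cnj s)) (- of_real e)"
    by (simp_all add: dpvec_def dqvec_def x_def v_def) (simp add: covector_def ax)
  have herm_snoc: "herm (snoc b c) (snoc b' c') = herm b b' + c * cnj c'" for b b' :: "(complex, 'n) vec" and c c'
    by (simp add: herm_def sum_option)
  have herm_axis: "herm (axis k c) b = c * cnj (b $ k)" for c b
    using ax[of c "cvec b"] by (simp add: herm_def)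
  have h0: "herm 0 b = 0" "herm b 0 = 0" for b :: "(complex, 'n) vec"
    by (simp_all add: herm_def)
  have nsq_eq: "nsq u = Re (herm u u)" for u :: "'n cvec"
    by (simp add: herm_self)
  have ss: "s * cnj s = of_real ((cmod s)\<^sup>2)"
    by (simp only: complex_norm_square)
  have nP: "nsq (pvec x) = 1" and nQ: "nsq (qvec s x) = (cmod s)\<^sup>2 + e\<^sup>2"
    by (simp_all add: nsq_eq p q herm_snoc herm_axis h0 ss power2_eq_square flip: of_real_mult)
  show tau: "tau_loc s x = (cmod s)\<^sup>2 + e\<^sup>2"
    by (simp add: tau_loc_def nP nQ)
  have hp: "herm (dpvec v) (pvec x) = 0" and hq: "herm (dqvec x v) (qvec s x) = 0"
    by (simp_all add: p q dp dq herm_snoc herm_axis)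
  have "herm (dpvec v) (dpvec v) = 1" "herm (dqvec x v) (dqvec x v) = of_real ((cmod s)\<^sup>2 + e\<^sup>2)"
    using ss by (simp_all add: dp dq herm_snoc herm_axis mult.commute power2_eq_square)
  then have dth: "dtheta0 s x v (mult_i v) = 2 * ((cmod s)\<^sup>2 + e\<^sup>2)"
    by (simp add: dtheta0_def mult_i_eq dpvec_simps dqvec_simps herm_scale hp hq nP nQ del: of_real_add)
  have zero: "dtau s x v = 0" "theta0 s x v = 0"
    by (simp_all add: dtau_def theta0_def hp hq)
  obtain f' where f': "(f_fun CARD('n) ((cmod s)\<^sup>2) a has_real_derivative f') (at (tau_loc s x))"
    using f_fun_differentiable[OF a, of "(cmod s)\<^sup>2" "tau_loc s x"] e by (auto simp: tau)
  show "omega_I_formula s \<sigma> a \<alpha> x v (mult_i v) =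
      2 * f_fun CARD('n) ((cmod s)\<^sup>2) a ((cmod s)\<^sup>2 + e\<^sup>2) * ((cmod s)\<^sup>2 + e\<^sup>2)"
    unfolding omega_I_formula_eq[OF \<sigma> s f'] ext_deriv_theta(1)[OF f'] zero dth tau by simp
qed

lemma not_provides_hyperkaehler_metric:
  fixes \<sigma> :: "('n::{finite,linorder}) option \<Rightarrow> 'n cmat"
  assumes \<sigma>: "sigma_family \<sigma>" and s: "s \<noteq> 0" and a: "a > 0"
  shows "\<not> provides_hyperkaehler_metric s \<sigma> a"
proof
  assume "provides_hyperkaehler_metric s \<sigma> a"
  then obtain \<omega> where two: "smooth_two_form s \<sigma> \<omega>"
    and ext: "\<And>p \<alpha> x. p \<in> Z_space s \<sigma> \<Longrightarrow> tau s \<sigma> p > (cmod s)\<^sup>2 \<Longrightarrow> p = Z_point s \<sigma> \<alpha> x \<Longrightarrow> \<omega> \<alpha> x = omega_I_formula s \<sigma> a \<alpha> x"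
    unfolding provides_hyperkaehler_metric_def by blast
  \<comment> \<open>Any index will do; types are nonempty, which reflects n >= 1.\<close>
  obtain k :: 'n where True
    by blast
  define v where "v = ((axis k 1, axis k (cnj s)) :: 'n coords)"
  define x where "x e = ((0, axis k (of_real e)) :: 'n coords)" for e :: real
  define h where "h e = \<omega> None (x e) v (mult_i v)" for e
  define S where "S = (cmod s)\<^sup>2"
  have S: "S > 0"
    using s by (simp add: S_def)
  have h: "h e = 2 * f_fun CARD('n) S a (S + e\<^sup>2) * (S + e\<^sup>2)" if e: "e > 0" for e
  proof -
    have "tau s \<sigma> (Z_point s \<sigma> None (x e)) > S"
      using omega_I_formula_near_minimum(1)[OF \<sigma> s a e, of k] e
      by (simp add: tau_Z_point[OF \<sigma> s] x_def S_def)
    moreover have "Z_point s \<sigma> None (x e) \<in> Z_space s \<sigma>"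
      unfolding Z_point_def Z_space_def quotient_def by blast
    ultimately show ?thesis
      using ext omega_I_formula_near_minimum(2)[OF \<sigma> s a e, of None k]
      by (simp add: h_def x_def v_def S_def)
  qed
  \<comment> \<open>Here tau = S + e^2, so f^2 has the denominator tau e^2. The factor e^2 cancels
    the pole, while continuity of h at 0 would make the product tend to 0.\<close>
  have bound: "4 * a powr (1 / real CARD('n)) * S \<le> (h e)\<^sup>2 * e\<^sup>2" if e: "e > 0" for e
  proof -
    have "(h e)\<^sup>2 * e\<^sup>2 = 4 * (f_fun CARD('n) S a (S + e\<^sup>2))\<^sup>2 * (S + e\<^sup>2)\<^sup>2 * e\<^sup>2"
      by (simp add: h[OF e] power_mult_distrib)
    also have "\<dots> = 4 * (a + (e\<^sup>2) ^ CARD('n)) powr (1 / real CARD('n)) * (S + e\<^sup>2)"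
      using f_fun_square[OF a, of S "S + e\<^sup>2" "CARD('n)"] e S add_pos_nonneg[OF S, of "e\<^sup>2"]
      by (simp add: power2_eq_square)
    also have "\<dots> \<ge> 4 * a powr (1 / real CARD('n)) * S"
      using a S by (intro mult_mono powr_mono2) auto
    finally show ?thesis .
  qed
  have "smooth (\<lambda>x. \<omega> None x v (mult_i v))"
    using two unfolding smooth_two_form_def smooth_bilinear_field_def by blast
  then have cont: "continuous_on UNIV (\<lambda>x. \<omega> None x v (mult_i v))"
    by (rule smooth_continuous)
  have "x = (\<lambda>e. (0, e *\<^sub>R axis k 1))"
    by (auto simp: x_def fun_eq_iff vec_eq_iff axis_def of_real_def)
  then have "continuous_on UNIV x"
    by (simp only:) (intro continuous_intros)
  then have "continuous_on UNIV h"
    unfolding h_def using continuous_on_compose2[OF cont] by auto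
  then have "isCont h 0"
    by (simp add: continuous_on_eq_continuous_at)
  moreover have e: "(\<lambda>n. inverse (real (Suc n))) \<longlonglongrightarrow> 0"
    by (rule LIMSEQ_inverse_real_of_nat)
  ultimately have "(\<lambda>n. h (inverse (real (Suc n)))) \<longlonglongrightarrow> h 0"
    by (rule isCont_tendsto_compose)
  then have "(\<lambda>n. (h (inverse (real (Suc n))))\<^sup>2 * (inverse (real (Suc n)))\<^sup>2) \<longlonglongrightarrow> (h 0)\<^sup>2 * 0\<^sup>2"
    by (intro tendsto_mult tendsto_power e)
  then have "4 * a powr (1 / real CARD('n)) * S \<le> (h 0)\<^sup>2 * 0\<^sup>2"
    by (rule LIMSEQ_le_const) (use bound in auto)
  then show False
    using a mult_pos_pos[OF S, of "a powr (1 / real CARD('n))"] by (simp add: mult.commute)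
qed

lemma f_fun_eq_imp:
  assumes a: "a \<ge> 0" and n: "n > 0" and \<tau>0: "\<tau>\<^sub>0 \<ge> 0"
    and f: "\<forall>\<tau>>\<tau>\<^sub>0. f_fun n \<tau>\<^sub>0 a \<tau> = \<tau> powr (-1/2)"
  shows "a = 0"
proof (rule ccontr)
  assume "a \<noteq> 0"
  then have a: "a > 0"
    using assms(1) by simp
  \<comment> \<open>At tau_0 + 1 the power (tau - tau_0)^n is 1, so comparing squares leaves (a +
    1)^(1/n) = 1.\<close>
  define t where "t = \<tau>\<^sub>0 + 1"
  have t: "t > 0" "t > \<tau>\<^sub>0" "t - \<tau>\<^sub>0 = 1"
    using \<tau>0 by (simp_all add: t_def)
  have sq: "(f_fun n \<tau>\<^sub>0 a t)\<^sup>2 = (a + 1) powr (1 / real n) / t"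
    using f_fun_square[OF a t(2) \<tau>0, of n] t by simp
  have ft: "f_fun n \<tau>\<^sub>0 a t = t powr (-1/2)"
    using f t(2) by blast
  have tt: "(t powr (-1/2))\<^sup>2 = 1 / t"
  proof -
    have "(t powr (-1/2))\<^sup>2 = t powr (-1/2 + -1/2)"
      by (simp only: power2_eq_square powr_add)
    also have "\<dots> = t powr (- 1)"
      by simp
    also have "\<dots> = 1 / t"
      using powr_minus_divide[of t 1] t(1) by simp
    finally show ?thesis .
  qed
  have "(a + 1) powr (1 / real n) / t = 1 / t"
    by (simp only: sq[symmetric] ft tt)
  then have "(a + 1) powr (1 / real n) = 1"
    using t(1) by (metis divide_cancel_right less_irrefl)
  moreover have "(a + 1) powr (1 / real n) > 1 powr (1 / real n)"
    using a n by (intro powr_less_mono2) auto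
  ultimately show False
    by (simp only: powr_one_eq_one less_irrefl)
qed

text \<open>The second conjunct renders the phrase "i.e. f(tau) = tau^(-1/2)"; f is compared on tau
  > tau_0, where its formula makes sense for every a.\<close>

theorem theorem4p6:
  fixes s :: complex and a :: real
    and \<sigma> :: "('n::{finite,linorder}) option \<Rightarrow> 'n cmat"
  assumes "s \<noteq> 0" and "a \<ge> 0" and "sigma_family \<sigma>"
  shows "(provides_hyperkaehler_metric s \<sigma> a \<longleftrightarrow> a = 0) \<and>
         (a = 0 \<longleftrightarrow>
            (\<forall>\<tau> > (cmod s)\<^sup>2. f_fun CARD('n) ((cmod s)\<^sup>2) a \<tau> = \<tau> powr (-1/2)))"
proof
  show "provides_hyperkaehler_metric s \<sigma> a \<longleftrightarrow> a = 0"
    using provides_hyperkaehler_metric_0[OF assms(3,1)] not_provides_hyperkaehler_metric[OF assms(3,1)]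
      assms(2) by (cases "a = 0") auto
  show "a = 0 \<longleftrightarrow> (\<forall>\<tau> > (cmod s)\<^sup>2. f_fun CARD('n) ((cmod s)\<^sup>2) a \<tau> = \<tau> powr (-1/2))"
  proof
    show "\<forall>\<tau> > (cmod s)\<^sup>2. f_fun CARD('n) ((cmod s)\<^sup>2) a \<tau> = \<tau> powr (-1/2)" if "a = 0"
      using that by (simp only: f_fun_def if_True simp_thms)
  qed (rule f_fun_eq_imp[OF assms(2)], simp_all only: zero_less_card_finite zero_le_power2)
qed

end
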